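(* Let $(M_i)_{i\ge0}$ be a sequence of nonnegative integer matrices in fixed-size Frobenius normal form with diagonal blocks $A_k$ for $1\le k\le\hat l$ (so in particular these blocks are either identically zero or reduced and primitive), and let $\nu$ be a nonzero ergodic $\mathcal{FC}_M$-invariant Borel measure on $\Sigma_M^{0,+}$. Then: (i) There exists a unique $k$, $1\le k\le\hat l$, such that the restriction $\nu_{A_k}$ of $\nu$ to $\Sigma_{A_k}^{0,+}$ is positive. This measure is $\mathcal{FC}_{A_k}$-invariant and ergodic, with $\nu$ its invariant extension to $\Sigma_M^{0,+}$. It is either positive infinite, or positive finite, on all nonempty open subsets of $\Sigma_{A_k}^{0,+}$. This correspondence, between ergodic Borel measures on $\Sigma_M^{0,+}$ and on $\Sigma_{A_k}^{0,+}$ for some $k$, is bijective. Also, one is conservative iff the other is. (ii) $\nu$ is positive finite on some open set of $\Sigma_M^{0,+}$ if and only if $\nu_{A_k}$ from (i) is positive finite, if and only if $\nu_{A_k}$ equals $\nu_{\mathbf w}^{A_k}$ for some point $\mathbf w$ in an extreme ray of $\mathcal V_{A_k}$. The measure $\nu$ is itself finite iff $\mathbf w$ is $M/A_k$-distinguished, i.e. $\nu=\nu_{\iota(\mathbf w)}$.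
   Context: **Fixed-size Frobenius normal form.** The $M_i$ ($i\ge 0$) are $(l\times l)$, rows indexed by $\mathcal A_i$ and columns by $\mathcal A_{i+1}$, with a block upper triangular form (zero blocks below the diagonal) with $\hat l$ square diagonal blocks $(A_k)_i$ of sizes independent of $i$; each sequence $A_k=((A_k)_i)_{i\ge0}$ is either identically zero (zero for all $i$) or reduced and primitive. The block columns which, for all $i$, are nonzero only in the diagonal block occur first; the block rows which, for all $i$, are nonzero only in the diagonal block occur last (a block of both kinds is arbitrarily assigned to one of these). $A_k$ is indexed by subalphabets $\mathcal A_i^k\subseteq\mathcal A_i$. Reduced: no all-zero rows or columns. Primitive: for every $k$ there is $n>k$ with $M_k\cdots M_n$ strictly positive. **Path space.** There are $(M_i)_{ab}$ edges $e\in\mathcal E_i$ from $e^-=a\in\mathcal A_i$ to $e^+=b\in\mathcal A_{i+1}$. $\Sigma_M^{0,+}$ is the compact space of edge paths $e=(.e_0e_1\dots)$, $e_i\in\mathcal E_i$, $e_i^+=e_{i+1}^-$, with the topology from $\prod_i\mathcal E_i$; thin cylinders are $[.e_0\dots e_n]=\{\tilde e:\tilde e_i=e_i,0\le i\le n\}$. $\Sigma_{A_k}^{0,+}\subseteq\Sigma_M^{0,+}$ is the set of paths all of whose vertices lie in the subalphabets $\mathcal A_i^k$. $\mathcal{FC}_M$ is the group of homeomorphisms of $\Sigma_M^{0,+}$ generated by the involutions interchanging two thin cylinders $[.e_0\dots e_n]$, $[.f_0\dots f_n]$ with $e_n^+=f_n^+$, leaving the tails unchanged and fixing all other points; similarly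 $\mathcal{FC}_{A_k}$ on $\Sigma_{A_k}^{0,+}$. **Measures.** Borel measures may be infinite. Ergodic: every invariant Borel set or its complement has measure zero. A Borel set $E$ is wandering for the action of a group $G$ if $(\gamma(E))_{\gamma\in G}$ is an infinite family of pairwise disjoint sets; the action is conservative if every wandering set has measure zero. The invariant extension to $\Sigma_M^{0,+}$ of an $\mathcal{FC}_{A_k}$-invariant Borel measure on $\Sigma_{A_k}^{0,+}$ is the unique $\mathcal{FC}_M$-invariant measure on the orbit $\mathcal{FC}_M(\Sigma_{A_k}^{0,+})$ which restricts to it, with the complement of this orbit given measure zero. **Eigenvector sequences.** For a nonnegative matrix sequence $K$ with alphabets $\mathcal A_i$: $\mathcal V_K^{\mathbf 0}$ is the convex cone of sequences $\mathbf w=(\mathbf w_i)_{i\ge0}$, $\mathbf w_i\in\mathbb R^{\mathcal A_i}$, $\mathbf w_i\ge0$, $\mathbf w_i=K_i\mathbf w_{i+1}$; $\mathcal V_K$ is the set of those with $\mathbf w_i\neq\mathbf 0$ for all $i$. Extreme rays of $\mathcal V_K$ are those of this cone (excluding the vertex). For $\mathbf w\in\mathcal V_K$, $\nu_{\mathbf w}=\nu_{\mathbf w}^K$ is the Borel measure on $\Sigma_K^{0,+}$ with $\nu_{\mathbf w}([.e_0\dots e_{n-1}])=(\mathbf w_n)_s$, $s=e_{n-1}^+$. For $A\le M$ (submatrix sequence), $\mathbf w\in\mathcal V_A$ is $M/A$-distinguished if $\iota(\mathbf w)=\lim_{m\to\infty}M^m(\mathtt e(\mathbf w))$ exists, where $\mathtt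 e$ fills in zeros outside the subalphabets of $A$ and $(M^m\mathbf v)_i=M_iM_{i+1}\cdots M_{i+m-1}\mathbf v_{i+m}$.
   Formalization: Conservativity: if wandering means that the distinct images of E form an infinite disjoint collection, “ν_{A_k} conservative implies ν conservative” fails for some finite Σ_{A_k}, so it is asserted only for infinite Σ_{A_k}; for families indexed by the group the equivalence is asserted as written. *)

theory Defs
  imports "HOL-Analysis.Analysis" "HOL-Algebra.Bij" "HOL-Algebra.Generated_Groups"
begin

text \<open>
  A sequence of nonnegative integer matrices is a pair of a function \<open>K\<close> and a sequence \<open>A\<close> of
  finite alphabets: the rows of \<open>K i\<close> are indexed by \<open>A i\<close>, its columns by \<open>A (Suc i)\<close>, and entries
  outside these alphabets are ignored.  The submatrix sequence for subalphabets \<open>B i \<subseteq> A i\<close> is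
  therefore given by the same \<open>K\<close> together with \<open>B\<close>.
\<close>

type_synonym 'v matseq = "nat \<Rightarrow> 'v \<Rightarrow> 'v \<Rightarrow> nat"
type_synonym 'v alphabets = "nat \<Rightarrow> 'v set"

text \<open>\<open>mat_prod K A i m\<close> is \<open>K\<^sub>i K\<^sub>i\<^sub>+\<^sub>1 \<dots> K\<^sub>i\<^sub>+\<^sub>m\<^sub>-\<^sub>1\<close> (\<open>m\<close> factors).\<close>

primrec mat_prod :: "'v matseq \<Rightarrow> 'v alphabets \<Rightarrow> nat \<Rightarrow> nat \<Rightarrow> 'v \<Rightarrow> 'v \<Rightarrow> nat" where
  "mat_prod K A i 0 a b = (if a = b then 1 else 0)"
| "mat_prod K A i (Suc m) a b = (\<Sum>c\<in>A (i + m). mat_prod K A i m a c * K (i + m) c b)"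

definition zero_seq :: "'v matseq \<Rightarrow> 'v alphabets \<Rightarrow> bool" where
  "zero_seq K A \<longleftrightarrow> (\<forall>i. \<forall>a\<in>A i. \<forall>b\<in>A (Suc i). K i a b = 0)"

definition reduced :: "'v matseq \<Rightarrow> 'v alphabets \<Rightarrow> bool" where
  "reduced K A \<longleftrightarrow> (\<forall>i. (\<forall>a\<in>A i. \<exists>b\<in>A (Suc i). K i a b \<noteq> 0) \<and>
                        (\<forall>b\<in>A (Suc i). \<exists>a\<in>A i. K i a b \<noteq> 0))"

definition primitive :: "'v matseq \<Rightarrow> 'v alphabets \<Rightarrow> bool" where
  "primitive K A \<longleftrightarrow>
     (\<forall>k. \<exists>n>k. \<forall>a\<in>A k. \<forall>b\<in>A (Suc n). mat_prod K A k (Suc n - k) a b > 0)"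


text \<open>
  \<open>B k i\<close> is the subalphabet of \<open>A i\<close> belonging to the \<open>k\<close>-th block.  Blocks are ordered by their
  number; the order of the letters inside a block plays no role.
\<close>

definition column_only_diag :: "'v matseq \<Rightarrow> nat \<Rightarrow> (nat \<Rightarrow> 'v alphabets) \<Rightarrow> nat \<Rightarrow> bool" where
  "column_only_diag M lh B k \<longleftrightarrow>
     (\<forall>i. \<forall>j\<in>{1..lh}. j \<noteq> k \<longrightarrow> (\<forall>a\<in>B j i. \<forall>b\<in>B k (Suc i). M i a b = 0))"

definition row_only_diag :: "'v matseq \<Rightarrow> nat \<Rightarrow> (nat \<Rightarrow> 'v alphabets) \<Rightarrow> nat \<Rightarrow> bool" where
  "row_only_diag M lh B k \<longleftrightarrow>
     (\<forall>i. \<forall>j\<in>{1..lh}. j \<noteq> k \<longrightarrow> (\<forall>a\<in>B k i. \<forall>b\<in>B j (Suc i). M i a b = 0))"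

text \<open>
  In the last clause the blocks \<open>1, \<dots>, p\<close> are those listed first and \<open>q + 1, \<dots>, lh\<close> those listed
  last; a block of both kinds may be in either group, all remaining blocks are of neither kind.
\<close>

definition fixed_size_frobenius_nf ::
  "nat \<Rightarrow> nat \<Rightarrow> 'v matseq \<Rightarrow> 'v alphabets \<Rightarrow> (nat \<Rightarrow> 'v alphabets) \<Rightarrow> bool" where
  "fixed_size_frobenius_nf l lh M A B \<longleftrightarrow>
     (\<forall>i. finite (A i) \<and> card (A i) = l) \<and>
     (\<forall>i. A i = (\<Union>k\<in>{1..lh}. B k i) \<and> disjoint_family_on (\<lambda>k. B k i) {1..lh}) \<and>
     (\<forall>k\<in>{1..lh}. \<forall>i. B k i \<noteq> {} \<and> card (B k i) = card (B k 0)) \<and>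
     (\<forall>j\<in>{1..lh}. \<forall>k\<in>{1..lh}. k < j \<longrightarrow>
        (\<forall>i. \<forall>a\<in>B j i. \<forall>b\<in>B k (Suc i). M i a b = 0)) \<and>
     (\<forall>k\<in>{1..lh}. zero_seq M (B k) \<or> (reduced M (B k) \<and> primitive M (B k))) \<and>
     (\<exists>p q. p \<le> q \<and> q \<le> lh \<and>
        (\<forall>k\<in>{1..p}. column_only_diag M lh B k) \<and>
        (\<forall>k\<in>{q+1..lh}. row_only_diag M lh B k) \<and>
        (\<forall>k\<in>{p+1..q}. \<not> column_only_diag M lh B k \<and> \<not> row_only_diag M lh B k))"


text \<open>The edge \<open>(a, b, j)\<close> is the \<open>j\<close>-th of the \<open>K i a b\<close> edges from \<open>a \<in> A i\<close> to \<open>b \<in> A (Suc i)\<close>.\<close>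

type_synonym 'v edge = "'v \<times> 'v \<times> nat"
type_synonym 'v path = "nat \<Rightarrow> 'v edge"

definition src :: "'v edge \<Rightarrow> 'v" where "src e = fst e"
definition tgt :: "'v edge \<Rightarrow> 'v" where "tgt e = fst (snd e)"

definition edges :: "'v matseq \<Rightarrow> 'v alphabets \<Rightarrow> nat \<Rightarrow> 'v edge set" where
  "edges K A i = {(a, b, j). a \<in> A i \<and> b \<in> A (Suc i) \<and> j < K i a b}"

definition path_space :: "'v matseq \<Rightarrow> 'v alphabets \<Rightarrow> 'v path set" where
  "path_space K A = {e. \<forall>i. e i \<in> edges K A i \<and> tgt (e i) = src (e (Suc i))}"

definition path_topology :: "'v matseq \<Rightarrow> 'v alphabets \<Rightarrow> 'v path topology" where
  "path_topology K A =
     subtopology (product_topology (\<lambda>i. discrete_topology (edges K A i)) UNIV) (path_space K A)"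

definition path_borel :: "'v matseq \<Rightarrow> 'v alphabets \<Rightarrow> 'v path measure" where
  "path_borel K A = sigma (path_space K A) {U. openin (path_topology K A) U}"

text \<open>Finite words \<open>e\<^sub>0 \<dots> e\<^sub>n\<close> are represented by functions of which only the values at
  \<open>0, \<dots>, n\<close> matter.\<close>

definition word :: "'v matseq \<Rightarrow> 'v alphabets \<Rightarrow> nat \<Rightarrow> 'v path \<Rightarrow> bool" where
  "word K A n e \<longleftrightarrow> (\<forall>i\<le>n. e i \<in> edges K A i) \<and> (\<forall>i<n. tgt (e i) = src (e (Suc i)))"

definition cylinder :: "'v matseq \<Rightarrow> 'v alphabets \<Rightarrow> nat \<Rightarrow> 'v path \<Rightarrow> 'v path set" where
  "cylinder K A n e = {x \<in> path_space K A. \<forall>i\<le>n. x i = e i}"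

definition replace_prefix :: "nat \<Rightarrow> 'v path \<Rightarrow> 'v path \<Rightarrow> 'v path" where
  "replace_prefix n f x = (\<lambda>i. if i \<le> n then f i else x i)"

definition cyl_swap ::
  "'v matseq \<Rightarrow> 'v alphabets \<Rightarrow> nat \<Rightarrow> 'v path \<Rightarrow> 'v path \<Rightarrow> 'v path \<Rightarrow> 'v path" where
  "cyl_swap K A n e f =
     (\<lambda>x\<in>path_space K A.
        if x \<in> cylinder K A n e then replace_prefix n f x
        else if x \<in> cylinder K A n f then replace_prefix n e x
        else x)"

definition FC :: "'v matseq \<Rightarrow> 'v alphabets \<Rightarrow> ('v path \<Rightarrow> 'v path) set" where
  "FC K A = generate (BijGroup (path_space K A))
     {cyl_swap K A n e f |n e f. word K A n e \<and> word K A n f \<and> tgt (e n) = tgt (f n)}"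


definition invariant_borel_measure :: "'v matseq \<Rightarrow> 'v alphabets \<Rightarrow> 'v path measure \<Rightarrow> bool" where
  "invariant_borel_measure K A \<mu> \<longleftrightarrow>
     sets \<mu> = sets (path_borel K A) \<and>
     (\<forall>\<gamma>\<in>FC K A. \<forall>E\<in>sets \<mu>. emeasure \<mu> (\<gamma> ` E) = emeasure \<mu> E)"

definition ergodic :: "('x \<Rightarrow> 'x) set \<Rightarrow> 'x measure \<Rightarrow> bool" where
  "ergodic G \<mu> \<longleftrightarrow>
     (\<forall>E\<in>sets \<mu>. (\<forall>\<gamma>\<in>G. \<gamma> ` E = E) \<longrightarrow>
        emeasure \<mu> E = 0 \<or> emeasure \<mu> (space \<mu> - E) = 0)"

definition ergodic_measures :: "'v matseq \<Rightarrow> 'v alphabets \<Rightarrow> 'v path measure set" where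
  "ergodic_measures K A =
     {\<mu>. invariant_borel_measure K A \<mu> \<and> ergodic (FC K A) \<mu> \<and> emeasure \<mu> (space \<mu>) \<noteq> 0}"

text \<open>
  Two readings of ``\<open>(\<gamma>(E))\<close> for \<open>\<gamma> \<in> G\<close> is an infinite family of pairwise disjoint sets'':
  \<open>wandering\<close> takes it as a family indexed by \<open>G\<close>, so that distinct group elements have disjoint
  images; \<open>wandering_images\<close> takes it as the collection of the images, so that several group
  elements may have the same image.
\<close>

definition wandering :: "('x \<Rightarrow> 'x) set \<Rightarrow> 'x measure \<Rightarrow> 'x set \<Rightarrow> bool" where
  "wandering G \<mu> E \<longleftrightarrow> E \<in> sets \<mu> \<and> infinite G \<and> disjoint_family_on (\<lambda>\<gamma>. \<gamma> ` E) G"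

definition conservative :: "('x \<Rightarrow> 'x) set \<Rightarrow> 'x measure \<Rightarrow> bool" where
  "conservative G \<mu> \<longleftrightarrow> (\<forall>E. wandering G \<mu> E \<longrightarrow> emeasure \<mu> E = 0)"

definition wandering_images :: "('x \<Rightarrow> 'x) set \<Rightarrow> 'x measure \<Rightarrow> 'x set \<Rightarrow> bool" where
  "wandering_images G \<mu> E \<longleftrightarrow>
     E \<in> sets \<mu> \<and> infinite ((\<lambda>\<gamma>. \<gamma> ` E) ` G) \<and> disjoint ((\<lambda>\<gamma>. \<gamma> ` E) ` G)"

definition conservative_images :: "('x \<Rightarrow> 'x) set \<Rightarrow> 'x measure \<Rightarrow> bool" where
  "conservative_images G \<mu> \<longleftrightarrow> (\<forall>E. wandering_images G \<mu> E \<longrightarrow> emeasure \<mu> E = 0)"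

definition FC_orbit :: "'v matseq \<Rightarrow> 'v alphabets \<Rightarrow> 'v path set \<Rightarrow> 'v path set" where
  "FC_orbit K A S = (\<Union>\<gamma>\<in>FC K A. \<gamma> ` S)"

definition invariant_extension ::
  "'v matseq \<Rightarrow> 'v alphabets \<Rightarrow> 'v alphabets \<Rightarrow> 'v path measure \<Rightarrow> 'v path measure" where
  "invariant_extension M A B \<mu> =
     (THE \<nu>. invariant_borel_measure M A \<nu> \<and>
             restrict_space \<nu> (path_space M B) = \<mu> \<and>
             emeasure \<nu> (path_space M A - FC_orbit M A (path_space M B)) = 0)"

definition positive_on_block :: "'v matseq \<Rightarrow> (nat \<Rightarrow> 'v alphabets) \<Rightarrow> 'v path measure \<Rightarrow> nat \<Rightarrow> bool" where
  "positive_on_block M B \<nu> k \<longleftrightarrow> emeasure \<nu> (path_space M (B k)) > 0"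

text \<open>Meaningful only if exactly one block has positive measure.\<close>

definition positive_block :: "'v matseq \<Rightarrow> nat \<Rightarrow> (nat \<Rightarrow> 'v alphabets) \<Rightarrow> 'v path measure \<Rightarrow> nat" where
  "positive_block M lh B \<nu> = (THE k. k \<in> {1..lh} \<and> positive_on_block M B \<nu> k)"


text \<open>Vectors in \<open>\<real>\<^bsup>A i\<^esup>\<close> are functions that vanish outside \<open>A i\<close>.\<close>

type_synonym 'v vecseq = "nat \<Rightarrow> 'v \<Rightarrow> real"

definition eigen_cone0 :: "'v matseq \<Rightarrow> 'v alphabets \<Rightarrow> 'v vecseq set" where
  "eigen_cone0 K A =
     {w. (\<forall>i a. a \<notin> A i \<longrightarrow> w i a = 0) \<and>
         (\<forall>i. \<forall>a\<in>A i. w i a \<ge> 0 \<and> w i a = (\<Sum>b\<in>A (Suc i). real (K i a b) * w (Suc i) b))}"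

definition eigen_cone :: "'v matseq \<Rightarrow> 'v alphabets \<Rightarrow> 'v vecseq set" where
  "eigen_cone K A = {w \<in> eigen_cone0 K A. \<forall>i. w i \<noteq> (\<lambda>a. 0)}"

definition ray :: "'v vecseq \<Rightarrow> 'v vecseq set" where
  "ray w = {(\<lambda>i a. t * w i a) |t. t > 0}"

definition extreme_rays :: "'v matseq \<Rightarrow> 'v alphabets \<Rightarrow> 'v vecseq set set" where
  "extreme_rays K A =
     {ray w |w. w \<in> eigen_cone K A \<and>
        (\<forall>u\<in>eigen_cone0 K A. \<forall>v\<in>eigen_cone0 K A. (\<lambda>i a. u i a + v i a) \<in> ray w \<longrightarrow>
           u \<in> insert (\<lambda>i a. 0) (ray w) \<and> v \<in> insert (\<lambda>i a. 0) (ray w))}"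

text \<open>The word \<open>e\<^sub>0 \<dots> e\<^sub>n\<close> ends at level \<open>n + 1\<close>.\<close>

definition eigen_measure :: "'v matseq \<Rightarrow> 'v alphabets \<Rightarrow> 'v vecseq \<Rightarrow> 'v path measure" where
  "eigen_measure K A w =
     (THE \<mu>. sets \<mu> = sets (path_borel K A) \<and>
        (\<forall>n e. word K A n e \<longrightarrow> emeasure \<mu> (cylinder K A n e) = ennreal (w (Suc n) (tgt (e n)))))"

definition zero_fill :: "'v alphabets \<Rightarrow> 'v vecseq \<Rightarrow> 'v vecseq" where
  "zero_fill B w = (\<lambda>i a. if a \<in> B i then w i a else 0)"

definition mat_iterate ::
  "'v matseq \<Rightarrow> 'v alphabets \<Rightarrow> nat \<Rightarrow> 'v vecseq \<Rightarrow> 'v vecseq" where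
  "mat_iterate M A m v = (\<lambda>i a. \<Sum>b\<in>A (i + m). real (mat_prod M A i m a b) * v (i + m) b)"

definition distinguished ::
  "'v matseq \<Rightarrow> 'v alphabets \<Rightarrow> 'v alphabets \<Rightarrow> 'v vecseq \<Rightarrow> bool" where
  "distinguished M A B w \<longleftrightarrow>
     w \<in> eigen_cone M B \<and>
     (\<forall>i. \<forall>a\<in>A i. convergent (\<lambda>m. mat_iterate M A m (zero_fill B w) i a))"

definition iota ::
  "'v matseq \<Rightarrow> 'v alphabets \<Rightarrow> 'v alphabets \<Rightarrow> 'v vecseq \<Rightarrow> 'v vecseq" where
  "iota M A B w =
     (\<lambda>i a. if a \<in> A i then lim (\<lambda>m. mat_iterate M A m (zero_fill B w) i a) else 0)"

end

theory Submission
  imports Defs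
begin

text \<open>Two paths lie in one orbit of the group exactly when they have a common tail
(\<open>FC_orbit_eq_saturation\<close>), and the orbit of a Borel set is covered by countably many of its images
(\<open>saturation_partition\<close>).  This replaces all finiteness conditions on measures: an invariant
measure is controlled on a whole orbit by its values on any Borel set that generates the orbit.

The block number of the vertices along a path cannot decrease, so it is eventually constant; the final
block has a nonzero edge and is therefore reduced and primitive, and since its columns are nonzero the
path has the tail of a path inside the block.  The path space is thus the disjoint union of the
finitely many orbits of the block path spaces (\<open>path_in_some_orbit\<close>, \<open>orbits_disjoint\<close>), and an
ergodic measure lives on exactly one of them.  Restriction to the block loses nothing because an
invariant measure is determined on the orbit; conversely an invariant measure on the block extends
(\<open>extension_exists\<close>) because elements of the big group that carry part of the block path space into
itself are pieced together from elements of the small group (\<open>transfer_invariant\<close>).  Invariant sets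
correspond in the same way, so ergodicity passes in both directions.

In a primitive block the measure of a cylinder depends on its last vertex only, and cylinders inside
any two given ones can be made to end at the same vertex; so cylinder measures are all zero or none,
and all infinite or none (\<open>cylinder_dichotomy\<close>).

Finite invariant measures on a block correspond to nonnegative eigenvector sequences
(\<open>eigen_measure_exists\<close>, \<open>invariant_represents\<close>), and ergodic ones to extreme rays: by
\<open>ergodic_dominated_unique\<close> a summand of an ergodic measure is a multiple of it, the Hahn
decomposition of the two measures being invariant after saturation.

A path that is eventually in the block and has a vertex in it at level \<open>i\<close> stays in it from then
on.  So the part of a cylinder that has entered the block after \<open>m\<close> steps increases with \<open>m\<close> to
the whole cylinder up to a null set, and its measure is an entry of the \<open>m\<close>-th iterate of the zero-filled
sequence (\<open>iterate_measure\<close>).  The limit that defines \<open>iota\<close> is therefore the measure of a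
cylinder, which ties finiteness of the measure to the existence of these limits.

Conservativity is decided by stabilisers.  In an infinite group of cylinder interchanges two distinct
elements agree at any given path, so a wandering set in the indexed sense is empty, and one in the sense
of distinct images is a single point with infinite orbit.\<close>

section \<open>The group of cylinder interchanges\<close>

lemma src_in: "e \<in> edges K A i \<Longrightarrow> src e \<in> A i"
  and tgt_in: "e \<in> edges K A i \<Longrightarrow> tgt e \<in> A (Suc i)"
  by (auto simp: edges_def src_def tgt_def)

lemma path_word: "x \<in> path_space K A \<Longrightarrow> word K A n x"
  by (auto simp: path_space_def word_def)

lemma cylinder_subset: "cylinder K A n e \<subseteq> path_space K A"
  by (auto simp: cylinder_def)

lemma in_cylinder_self: "x \<in> path_space K A \<Longrightarrow> x \<in> cylinder K A n x"
  by (auto simp: cylinder_def)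

lemma cylinder_cong: "(\<And>i. i \<le> n \<Longrightarrow> e i = f i) \<Longrightarrow> cylinder K A n e = cylinder K A n f"
  by (auto simp: cylinder_def)

lemma cylinder_antimono: "n \<le> m \<Longrightarrow> cylinder K A m x \<subseteq> cylinder K A n x"
  by (auto simp: cylinder_def)

lemma cylinder_eq: "x \<in> cylinder K A n e \<Longrightarrow> cylinder K A n x = cylinder K A n e"
  by (auto simp: cylinder_def)

lemma replace_prefix_cylinder:
  assumes "word K A n f" "x \<in> path_space K A" "tgt (f n) = src (x (Suc n))"
  shows "replace_prefix n f x \<in> cylinder K A n f"
proof -
  have "replace_prefix n f x i \<in> edges K A i \<and>
        tgt (replace_prefix n f x i) = src (replace_prefix n f x (Suc i))" for i
    using assms by (cases "i < n"; cases "i = n")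
      (auto simp: replace_prefix_def word_def path_space_def)
  then show ?thesis
    by (auto simp: cylinder_def path_space_def replace_prefix_def)
qed

lemma cylinder_tgt: "x \<in> cylinder K A n e \<Longrightarrow> tgt (e n) = src (x (Suc n))"
  unfolding cylinder_def path_space_def by (metis (mono_tags, lifting) le_refl mem_Collect_eq)

definition swaps :: "'v matseq \<Rightarrow> 'v alphabets \<Rightarrow> ('v path \<Rightarrow> 'v path) set" where
  "swaps K A = {cyl_swap K A n e f |n e f. word K A n e \<and> word K A n f \<and> tgt (e n) = tgt (f n)}"

lemma FC_generate: "FC K A = generate (BijGroup (path_space K A)) (swaps K A)"
  by (simp add: FC_def swaps_def)

lemma cyl_swap_in:
  assumes "word K A n e" "word K A n f" "tgt (e n) = tgt (f n)" "x \<in> path_space K A"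
  shows "cyl_swap K A n e f x \<in> path_space K A"
proof -
  have "replace_prefix n g x \<in> path_space K A"
    if "x \<in> cylinder K A n e \<or> x \<in> cylinder K A n f" "g = e \<or> g = f" for g
  proof -
    have "tgt (g n) = src (x (Suc n))"
      using that assms(3) cylinder_tgt[of x K A n e] cylinder_tgt[of x K A n f] by metis
    then show ?thesis
      using that(2) assms replace_prefix_cylinder[of K A n g x] cylinder_subset[of K A n g] by blast
  qed
  then show ?thesis using assms(4) by (simp add: cyl_swap_def)
qed

lemma cyl_swap_swap:
  assumes "word K A n e" "word K A n f" "tgt (e n) = tgt (f n)" "x \<in> path_space K A"
  shows "cyl_swap K A n e f (cyl_swap K A n e f x) = x"
proof -
  have rr: "replace_prefix n g (replace_prefix n h x) = x" if "x \<in> cylinder K A n g" for g h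
    using that by (auto simp: replace_prefix_def cylinder_def)
  have r: "replace_prefix n g x = x" if "x \<in> cylinder K A n g" for g
    using that by (auto simp: replace_prefix_def cylinder_def)
  have c: "replace_prefix n g x \<in> cylinder K A n g"
    if "x \<in> cylinder K A n e \<or> x \<in> cylinder K A n f" "g = e \<or> g = f" for g
  proof (rule replace_prefix_cylinder)
    show "tgt (g n) = src (x (Suc n))"
      using that assms(3) cylinder_tgt[of x K A n e] cylinder_tgt[of x K A n f] by metis
  qed (use that assms in auto)
  have eq: "cylinder K A n e = cylinder K A n f" if "z \<in> cylinder K A n e" "z \<in> cylinder K A n f" for z
    using cylinder_eq that by metis
  note cs = cylinder_subset[of K A n e] cylinder_subset[of K A n f]
  consider "x \<in> cylinder K A n e" | "x \<notin> cylinder K A n e" "x \<in> cylinder K A n f"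
    | "x \<notin> cylinder K A n e" "x \<notin> cylinder K A n f" by blast
  then show ?thesis
  proof cases
    case 1
    then have s: "cyl_swap K A n e f x = replace_prefix n f x" using assms by (simp add: cyl_swap_def)
    have y: "replace_prefix n f x \<in> cylinder K A n f" using c 1 by blast
    show ?thesis
    proof (cases "replace_prefix n f x \<in> cylinder K A n e")
      case True
      then have "x \<in> cylinder K A n f" using eq y 1 by blast
      then have "replace_prefix n f x = x" by (rule r)
      then show ?thesis using s by simp
    next
      case False
      then show ?thesis using s y cs rr[OF 1] by (auto simp: cyl_swap_def)
    qed
  next
    case 2
    then have s: "cyl_swap K A n e f x = replace_prefix n e x" using assms by (simp add: cyl_swap_def)
    have y: "replace_prefix n e x \<in> cylinder K A n e" using c 2 by blast
    then show ?thesis using s cs rr[OF 2(2)] by (auto simp: cyl_swap_def)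
  next
    case 3
    then show ?thesis using assms by (auto simp: cyl_swap_def)
  qed
qed

lemma swaps_in: "s \<in> swaps K A \<Longrightarrow> x \<in> path_space K A \<Longrightarrow> s x \<in> path_space K A"
  and swaps_swap: "s \<in> swaps K A \<Longrightarrow> x \<in> path_space K A \<Longrightarrow> s (s x) = x"
  by (auto simp: swaps_def cyl_swap_in cyl_swap_swap)

lemma swaps_Bij: "swaps K A \<subseteq> Bij (path_space K A)"
proof
  fix s assume s: "s \<in> swaps K A"
  have "bij_betw s (path_space K A) (path_space K A)"
    by (rule bij_betwI[where g = s]) (use s swaps_in swaps_swap in auto)
  moreover have "s \<in> extensional (path_space K A)"
    using s by (auto simp: swaps_def cyl_swap_def)
  ultimately show "s \<in> Bij (path_space K A)" by (simp add: Bij_def)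
qed

lemma FC_subset_Bij: "FC K A \<subseteq> Bij (path_space K A)"
  using group.generate_incl[OF group_BijGroup, of "swaps K A" "path_space K A"] swaps_Bij[of K A]
  by (simp add: FC_generate BijGroup_def)

lemma FC_bij: "\<gamma> \<in> FC K A \<Longrightarrow> bij_betw \<gamma> (path_space K A) (path_space K A)"
  using FC_subset_Bij[of K A] by (auto simp: Bij_def)

lemma FC_in: "\<gamma> \<in> FC K A \<Longrightarrow> x \<in> path_space K A \<Longrightarrow> \<gamma> x \<in> path_space K A"
  using FC_bij by (metis bij_betw_apply)

lemma swaps_FC: "s \<in> swaps K A \<Longrightarrow> s \<in> FC K A"
  by (simp add: FC_generate generate.incl)

lemma FC_compose:
  assumes "g \<in> FC K A" "h \<in> FC K A" shows "compose (path_space K A) g h \<in> FC K A"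
proof -
  have "g \<otimes>\<^bsub>BijGroup (path_space K A)\<^esub> h \<in> FC K A"
    using assms unfolding FC_generate by (rule generate.eng)
  then show ?thesis using assms FC_subset_Bij[of K A] by (simp add: BijGroup_def subset_iff)
qed

lemma BijGroup_one: "\<one>\<^bsub>BijGroup S\<^esub> = (\<lambda>x\<in>S. x)"
  by (simp add: BijGroup_def)

lemma FC_id: "(\<lambda>x\<in>path_space K A. x) \<in> FC K A"
  using generate.one[of "BijGroup (path_space K A)" "swaps K A"] unfolding FC_generate BijGroup_one .

text \<open>Every generator is an involution, so inverses need no case of their own.\<close>

lemma FC_induct [consumes 1, case_names id swap comp]:
  assumes "\<gamma> \<in> FC K A"
    and id: "P (\<lambda>x\<in>path_space K A. x)"
    and swap: "\<And>s. s \<in> swaps K A \<Longrightarrow> P s"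
    and comp: "\<And>g h. g \<in> FC K A \<Longrightarrow> h \<in> FC K A \<Longrightarrow> P g \<Longrightarrow> P h \<Longrightarrow> P (compose (path_space K A) g h)"
  shows "P \<gamma>"
  using assms(1) unfolding FC_generate
proof (induction rule: generate.induct)
  case one
  then show ?case using id unfolding BijGroup_one .
next
  case (incl h)
  then show ?case by (rule swap)
next
  case (inv h)
  have hB: "h \<in> Bij (path_space K A)" using inv swaps_Bij by blast
  have "compose (path_space K A) h h = (\<lambda>x\<in>path_space K A. x)"
    using inv by (auto simp: compose_def fun_eq_iff swaps_swap)
  then have "h \<otimes>\<^bsub>BijGroup (path_space K A)\<^esub> h = \<one>\<^bsub>BijGroup (path_space K A)\<^esub>"
    using hB by (simp add: BijGroup_def)
  then have "inv\<^bsub>BijGroup (path_space K A)\<^esub> h = h"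
    using hB by (intro group.inv_equality[OF group_BijGroup]) (simp_all add: BijGroup_def)
  then show ?case using swap inv by simp
next
  case (eng h1 h2)
  then have "h1 \<in> FC K A" "h2 \<in> FC K A" by (simp_all add: FC_generate)
  then show ?case
    using eng comp[of h1 h2] FC_subset_Bij[of K A] by (simp add: BijGroup_def subset_iff)
qed

lemma FC_inverse:
  assumes "\<gamma> \<in> FC K A"
  obtains \<delta> where "\<delta> \<in> FC K A" "\<And>x. x \<in> path_space K A \<Longrightarrow> \<delta> (\<gamma> x) = x"
    "\<And>x. x \<in> path_space K A \<Longrightarrow> \<gamma> (\<delta> x) = x"
proof -
  have "\<exists>\<delta>\<in>FC K A. \<forall>x\<in>path_space K A. \<delta> (\<gamma> x) = x \<and> \<gamma> (\<delta> x) = x" using assms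
  proof (induction rule: FC_induct)
  case id
  then show ?case by (intro bexI[OF _ FC_id]) auto
next
  case (swap s)
  then show ?case by (intro bexI[OF _ swaps_FC]) (auto simp: swaps_swap)
next
  case (comp g h)
  then obtain g' h' where "g' \<in> FC K A" "h' \<in> FC K A"
    "\<forall>x\<in>path_space K A. g' (g x) = x \<and> g (g' x) = x" "\<forall>x\<in>path_space K A. h' (h x) = x \<and> h (h' x) = x"
    by blast
  then show ?case using comp(1,2)
    by (intro bexI[OF _ FC_compose[of h' _ _ g']]) (auto simp: compose_def FC_in)
  qed
  then show ?thesis using that by blast
qed

text \<open>An element of the group rewrites prefixes of some bounded length: the prefix of the image
  depends on the prefix of the argument alone, and the tail is untouched.\<close>

lemma FC_prefix:
  assumes "\<gamma> \<in> FC K A"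
  shows "\<exists>N. (\<forall>x\<in>path_space K A. \<forall>i>N. \<gamma> x i = x i) \<and>
  (\<forall>x\<in>path_space K A. \<forall>y\<in>path_space K A. \<forall>n\<ge>N. (\<forall>i\<le>n. x i = y i) \<longrightarrow> (\<forall>i\<le>n. \<gamma> x i = \<gamma> y i))"
  using assms
proof (induction rule: FC_induct)
  case id
  then show ?case by auto
next
  case (swap s)
  then obtain n e f where s: "s = cyl_swap K A n e f" unfolding swaps_def by blast
  have c: "x \<in> cylinder K A n g \<longleftrightarrow> y \<in> cylinder K A n g"
    if "x \<in> path_space K A" "y \<in> path_space K A" "n \<le> m" "\<forall>i\<le>m. x i = y i" for x y m g
    using that by (auto simp: cylinder_def)
  have pre: "cyl_swap K A n e f x i = cyl_swap K A n e f y i"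
    if "x \<in> path_space K A" "y \<in> path_space K A" "n \<le> m" "\<forall>i\<le>m. x i = y i" "i \<le> m" for x y m i
    using that c[OF that(1-4), of e] c[OF that(1-4), of f]
    by (auto simp: cyl_swap_def replace_prefix_def)
  have tail: "cyl_swap K A n e f x i = x i" if "x \<in> path_space K A" "n < i" for x i
    using that by (auto simp: cyl_swap_def replace_prefix_def)
  show ?case unfolding s
    by (intro exI[of _ n] conjI ballI allI impI; (rule tail | rule pre); assumption)
next
  case (comp g h)
  obtain N where N: "(\<forall>x\<in>path_space K A. \<forall>i>N. g x i = x i) \<and>
     (\<forall>x\<in>path_space K A. \<forall>y\<in>path_space K A. \<forall>n\<ge>N. (\<forall>i\<le>n. x i = y i) \<longrightarrow> (\<forall>i\<le>n. g x i = g y i))"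
    using comp.IH(1) ..
  obtain N' where N': "(\<forall>x\<in>path_space K A. \<forall>i>N'. h x i = x i) \<and>
     (\<forall>x\<in>path_space K A. \<forall>y\<in>path_space K A. \<forall>n\<ge>N'. (\<forall>i\<le>n. x i = y i) \<longrightarrow> (\<forall>i\<le>n. h x i = h y i))"
    using comp.IH(2) ..
  note g = conjunct1[OF N, rule_format] conjunct2[OF N, rule_format]
  note h = conjunct1[OF N', rule_format] conjunct2[OF N', rule_format]
  have hi: "h y \<in> path_space K A" if "y \<in> path_space K A" for y
    using comp(2) that by (rule FC_in)
  have pre: "g (h x) i = g (h y) i"
    if "x \<in> path_space K A" "y \<in> path_space K A" "max N N' \<le> n" "\<forall>i\<le>n. x i = y i" "i \<le> n" for x y n i
  proof (rule g(2)[OF hi hi _ _ that(5)])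
    show "h x j = h y j" if "j \<le> n" for j
      using \<open>\<forall>i\<le>n. x i = y i\<close> \<open>max N N' \<le> n\<close>
      by (intro h(2)[OF \<open>x \<in> _\<close> \<open>y \<in> _\<close> _ _ that]) auto
  qed (use that in auto)
  have tail: "g (h x) i = x i" if "x \<in> path_space K A" "max N N' < i" for x i
    using that g(1) h(1) hi by simp
  show ?case
  proof (intro exI[of _ "max N N'"] conjI ballI allI impI)
    fix x y n i
    assume xy: "x \<in> path_space K A" "y \<in> path_space K A" "max N N' \<le> n" "\<forall>i\<le>n. x i = y i" "i \<le> n"
    show "compose (path_space K A) g h x i = compose (path_space K A) g h y i"
      using pre[OF xy] xy(1,2) unfolding compose_def by simp
  qed (simp add: compose_def tail)
qed

lemma FC_tail: "\<gamma> \<in> FC K A \<Longrightarrow> \<exists>N. \<forall>x\<in>path_space K A. \<forall>i>N. \<gamma> x i = x i"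
  by (drule FC_prefix) (elim ex_forward conjunct1)

text \<open>Paths serve as words, so the prefixes of two paths with a common tail can be interchanged directly.\<close>

lemma swap_path:
  assumes "x \<in> path_space K A" "y \<in> path_space K A" "\<And>i. n < i \<Longrightarrow> x i = y i"
  shows "cyl_swap K A n x y \<in> swaps K A" "cyl_swap K A n x y x = y"
proof -
  have "tgt (x n) = tgt (y n)"
    using assms(1,2) assms(3)[of "Suc n"] by (simp add: path_space_def)
  then show "cyl_swap K A n x y \<in> swaps K A"
    using path_word[OF assms(1), of n] path_word[OF assms(2), of n] unfolding swaps_def by blast
  show "cyl_swap K A n x y x = y"
    using assms(1,3) in_cylinder_self[OF assms(1), of n] by (simp add: cyl_swap_def replace_prefix_def fun_eq_iff)
qed

text \<open>Orbits are the classes of paths with a common tail, hence the orbit of a set is its saturation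
  under tail equivalence.\<close>

definition saturation :: "'v matseq \<Rightarrow> 'v alphabets \<Rightarrow> 'v path set \<Rightarrow> 'v path set" where
  "saturation K A E = {y \<in> path_space K A. \<exists>x\<in>E. \<exists>n. \<forall>i>n. x i = y i}"

lemma saturation_eq_swaps:
  assumes "E \<subseteq> path_space K A"
  shows "saturation K A E = (\<Union>s\<in>swaps K A. s ` E)"
proof (intro equalityI subsetI)
  fix y assume "y \<in> saturation K A E"
  then obtain x n where xn: "y \<in> path_space K A" "x \<in> E" "\<forall>i>n. x i = y i"
    by (auto simp: saturation_def)
  then have s: "cyl_swap K A n x y \<in> swaps K A" "cyl_swap K A n x y x = y"
    using assms by (auto intro!: swap_path)
  show "y \<in> (\<Union>s\<in>swaps K A. s ` E)"
    by (rule UN_I[OF s(1)], rule image_eqI[of y "cyl_swap K A n x y" x], simp_all add: s xn)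
next
  fix y assume "y \<in> (\<Union>s\<in>swaps K A. s ` E)"
  then obtain s x where sx: "s \<in> swaps K A" "x \<in> E" "y = s x" by blast
  then have x: "x \<in> path_space K A" using assms by blast
  obtain N where "\<forall>x\<in>path_space K A. \<forall>i>N. s x i = x i"
    using FC_tail[OF swaps_FC[OF sx(1)]] ..
  then have "\<forall>i>N. x i = y i" using x sx(3) by simp
  then show "y \<in> saturation K A E"
    using sx swaps_in[OF sx(1) x] unfolding saturation_def by blast
qed

lemma FC_orbit_eq_saturation:
  assumes "E \<subseteq> path_space K A"
  shows "FC_orbit K A E = saturation K A E"
proof
  show "saturation K A E \<subseteq> FC_orbit K A E"
    using swaps_FC by (auto simp: saturation_eq_swaps[OF assms] FC_orbit_def)
  show "FC_orbit K A E \<subseteq> saturation K A E"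
  proof
    fix y assume "y \<in> FC_orbit K A E"
    then obtain g x where gx: "g \<in> FC K A" "x \<in> E" "y = g x" by (auto simp: FC_orbit_def)
    then have x: "x \<in> path_space K A" using assms by blast
    obtain N where "\<forall>x\<in>path_space K A. \<forall>i>N. g x i = x i"
      using FC_tail[OF gx(1)] ..
    then have "\<forall>i>N. x i = y i" using x gx(3) by simp
    then show "y \<in> saturation K A E"
      using gx FC_in[OF gx(1) x] unfolding saturation_def by blast
  qed
qed

lemma saturation_subset: "saturation K A E \<subseteq> path_space K A"
  by (auto simp: saturation_def)

lemma subset_saturation: "E \<subseteq> path_space K A \<Longrightarrow> E \<subseteq> saturation K A E"
  by (auto simp: saturation_def)

lemma saturationI:
  assumes "y \<in> path_space K A" "x \<in> E" "\<And>i. n < i \<Longrightarrow> x i = y i"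
  shows "y \<in> saturation K A E"
  unfolding saturation_def using assms by (intro CollectI conjI bexI[of _ x] exI[of _ n]) simp_all

lemma saturationE:
  assumes "y \<in> saturation K A E"
  obtains x n where "x \<in> E" "\<forall>i>n. x i = y i"
  using assms unfolding saturation_def by (elim CollectE conjE bexE exE)

lemma saturation_mono: "E \<subseteq> F \<Longrightarrow> saturation K A E \<subseteq> saturation K A F"
  unfolding saturation_def by blast

lemma FC_saturation_iff:
  assumes g: "\<gamma> \<in> FC K A" and x: "x \<in> path_space K A"
  shows "\<gamma> x \<in> saturation K A E \<longleftrightarrow> x \<in> saturation K A E"
proof -
  obtain N where "\<forall>x\<in>path_space K A. \<forall>i>N. \<gamma> x i = x i" using FC_tail[OF g] ..
  then have N: "\<gamma> x i = x i" if "N < i" for i using x that by simp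
  show ?thesis
  proof
    assume "\<gamma> x \<in> saturation K A E"
    then obtain y n where y: "y \<in> E" "\<forall>i>n. y i = \<gamma> x i" by (rule saturationE)
    show "x \<in> saturation K A E"
      by (rule saturationI[OF x y(1), where n = "max n N"]) (use y(2) N in simp)
  next
    assume "x \<in> saturation K A E"
    then obtain y n where y: "y \<in> E" "\<forall>i>n. y i = x i" by (rule saturationE)
    show "\<gamma> x \<in> saturation K A E"
      by (rule saturationI[OF FC_in[OF g x] y(1), where n = "max n N"]) (use y(2) N in simp)
  qed
qed

text \<open>Invariance under the group is thus a condition on tails, with no reference to group elements.\<close>

lemma FC_invariant_iff:
  assumes "E \<subseteq> path_space K A"
  shows "(\<forall>\<gamma>\<in>FC K A. \<gamma> ` E = E) \<longleftrightarrow> saturation K A E \<subseteq> E"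
proof
  assume "\<forall>\<gamma>\<in>FC K A. \<gamma> ` E = E"
  then show "saturation K A E \<subseteq> E"
    unfolding FC_orbit_eq_saturation[OF assms, symmetric] FC_orbit_def by blast
next
  assume s: "saturation K A E \<subseteq> E"
  have sub: "g ` E \<subseteq> E" if "g \<in> FC K A" for g
    using s that FC_orbit_eq_saturation[OF assms] by (auto simp: FC_orbit_def)
  show "\<forall>\<gamma>\<in>FC K A. \<gamma> ` E = E"
  proof
    fix g assume g: "g \<in> FC K A"
    obtain h where h: "h \<in> FC K A" "\<And>x. x \<in> path_space K A \<Longrightarrow> g (h x) = x"
      by (rule FC_inverse[OF g]) blast
    have "E \<subseteq> g ` E"
    proof
      fix x assume x: "x \<in> E"
      then have "x = g (h x)" "h x \<in> E" using h(2) assms sub[OF h(1)] by auto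
      then show "x \<in> g ` E" by (rule image_eqI[of x g "h x"])
    qed
    then show "g ` E = E" using sub[OF g] by blast
  qed
qed

lemma saturation_idem: "saturation K A (saturation K A E) \<subseteq> saturation K A E"
proof
  fix y assume y: "y \<in> saturation K A (saturation K A E)"
  then obtain x n where x: "x \<in> saturation K A E" "\<forall>i>n. x i = y i" by (rule saturationE)
  from x(1) obtain z m where z: "z \<in> E" "\<forall>i>m. z i = x i" by (rule saturationE)
  show "y \<in> saturation K A E"
    by (rule saturationI[OF subsetD[OF saturation_subset y] z(1), of "max n m"]) (use x(2) z(2) in simp)
qed

section \<open>Borel sets of the path space\<close>

lemma topspace_path: "topspace (path_topology K A) = path_space K A"
  by (auto simp: path_topology_def path_space_def)

text \<open>The basic open sets of the product topology constrain finitely many coordinates, all below some bound.\<close>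

lemma openin_path_iff:
  "openin (path_topology K A) U \<longleftrightarrow> U \<subseteq> path_space K A \<and> (\<forall>x\<in>U. \<exists>n. cylinder K A n x \<subseteq> U)"
proof
  let ?P = "product_topology (\<lambda>i. discrete_topology (edges K A i)) UNIV"
  assume "openin (path_topology K A) U"
  then obtain T where T: "openin ?P T" "U = T \<inter> path_space K A"
    by (auto simp: path_topology_def openin_subtopology)
  show "U \<subseteq> path_space K A \<and> (\<forall>x\<in>U. \<exists>n. cylinder K A n x \<subseteq> U)"
  proof (intro conjI ballI)
    show "U \<subseteq> path_space K A" using T by simp
    fix x assume "x \<in> U"
    then obtain V where V: "finite {i. V i \<noteq> edges K A i}" "x \<in> Pi\<^sub>E UNIV V" "Pi\<^sub>E UNIV V \<subseteq> T"
      using T by (auto simp: openin_product_topology_alt)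
    obtain n where n: "{i. V i \<noteq> edges K A i} \<subseteq> {..n}"
      using V(1) finite_nat_iff_bounded_le by blast
    have "cylinder K A n x \<subseteq> Pi\<^sub>E UNIV V"
    proof
      fix y assume y: "y \<in> cylinder K A n x"
      have "y i \<in> V i" for i
      proof (cases "i \<le> n")
        case True
        then show ?thesis using y V(2) by (auto simp: cylinder_def PiE_iff)
      next
        case False
        then have "V i = edges K A i" using n by auto
        then show ?thesis using y by (auto simp: cylinder_def path_space_def)
      qed
      then show "y \<in> Pi\<^sub>E UNIV V" by auto
    qed
    then show "\<exists>n. cylinder K A n x \<subseteq> U" using V(3) T(2) cylinder_subset by (meson le_inf_iff subset_trans)
  qed
next
  let ?P = "product_topology (\<lambda>i. discrete_topology (edges K A i)) UNIV"
  assume U: "U \<subseteq> path_space K A \<and> (\<forall>x\<in>U. \<exists>n. cylinder K A n x \<subseteq> U)"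
  have "openin (path_topology K A) (cylinder K A n x)" if "x \<in> path_space K A" for n x
  proof -
    let ?T = "Pi\<^sub>E UNIV (\<lambda>i. if i \<le> n then {x i} else edges K A i)"
    have "finite {i. (if i \<le> n then {x i} else edges K A i) \<noteq> edges K A i}"
      by (rule finite_subset[of _ "{..n}"]) auto
    then have "openin ?P ?T"
      unfolding openin_product_topology_alt using that
      by (intro ballI exI[of _ "\<lambda>i. if i \<le> n then {x i} else edges K A i"]) (auto simp: path_space_def)
    moreover have "cylinder K A n x = ?T \<inter> path_space K A"
      by (fastforce simp: cylinder_def path_space_def PiE_iff split: if_splits)
    ultimately show ?thesis by (auto simp: path_topology_def openin_subtopology)
  qed
  then show "openin (path_topology K A) U"
    using U by (subst openin_subopen) (meson in_cylinder_self subset_iff)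
qed

lemma openin_cylinder: "openin (path_topology K A) (cylinder K A n e)"
  by (auto simp: openin_path_iff cylinder_eq[of _ K A n e] cylinder_subset
      intro!: exI[of _ n])

text \<open>Matching of consecutive edges is a closed condition, since its failure is visible at two coordinates;
  so the path space is closed in a product of finite discrete spaces.\<close>

lemma compact_path_space:
  assumes "\<And>i. finite (edges K A i)"
  shows "compact_space (path_topology K A)"
proof -
  let ?P = "product_topology (\<lambda>i. discrete_topology (edges K A i)) UNIV"
  have c: "compact_space ?P"
    using assms by (simp add: compact_space_product_topology compact_space_discrete_topology)
  have "openin ?P (topspace ?P - path_space K A)"
    unfolding openin_product_topology_alt
  proof
    fix x assume x: "x \<in> topspace ?P - path_space K A"
    then have xe: "x i \<in> edges K A i" for i by auto
    then obtain i where i: "tgt (x i) \<noteq> src (x (Suc i))" using x by (auto simp: path_space_def)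
    let ?V = "\<lambda>j. if j = i \<or> j = Suc i then {x j} else edges K A j"
    have "finite {j \<in> UNIV. ?V j \<noteq> topspace (discrete_topology (edges K A j))}"
      by (rule finite_subset[of _ "{i, Suc i}"]) auto
    moreover have "Pi\<^sub>E UNIV ?V \<subseteq> topspace ?P - path_space K A"
    proof
      fix y assume y: "y \<in> Pi\<^sub>E UNIV ?V"
      have yj: "y j \<in> ?V j" for j using y by blast
      then have "y j \<in> edges K A j" for j using xe by (metis singletonD)
      moreover have "y i = x i" "y (Suc i) = x (Suc i)" using yj[of i] yj[of "Suc i"] by auto
      ultimately show "y \<in> topspace ?P - path_space K A" using i by (auto simp: path_space_def intro!: exI[of _ i])
    qed
    ultimately show "\<exists>V. finite {j \<in> UNIV. V j \<noteq> topspace (discrete_topology (edges K A j))} \<and>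
        (\<forall>j\<in>UNIV. openin (discrete_topology (edges K A j)) (V j)) \<and> x \<in> Pi\<^sub>E UNIV V \<and>
        Pi\<^sub>E UNIV V \<subseteq> topspace ?P - path_space K A"
      using xe by (intro exI[of _ ?V]) auto
  qed
  moreover have "path_space K A \<subseteq> topspace ?P" by (auto simp: path_space_def)
  ultimately have "closedin ?P (path_space K A)" by (simp add: closedin_def)
  then show ?thesis
    using c by (simp add: path_topology_def closedin_compact_space compact_space_subtopology)
qed

lemma space_path_borel [simp]: "space (path_borel K A) = path_space K A"
  unfolding path_borel_def by (rule space_measure_of) (auto simp: openin_path_iff)

lemma sets_path_borel: "sets (path_borel K A) = sigma_sets (path_space K A) {U. openin (path_topology K A) U}"
  unfolding path_borel_def by (rule sets_measure_of) (auto simp: openin_path_iff)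

lemma open_in_sets: "openin (path_topology K A) U \<Longrightarrow> U \<in> sets (path_borel K A)"
  by (simp add: sets_path_borel sigma_sets.Basic)

lemma cylinder_in_sets [simp]: "cylinder K A n e \<in> sets (path_borel K A)"
  by (intro open_in_sets openin_cylinder)

lemma path_space_in_sets [simp]: "path_space K A \<in> sets (path_borel K A)"
  using sets.top[of "path_borel K A"] by simp

lemma coordinate_event_sets: "{x \<in> path_space K A. P (x i)} \<in> sets (path_borel K A)"
proof (rule open_in_sets)
  show "openin (path_topology K A) {x \<in> path_space K A. P (x i)}"
    unfolding openin_path_iff
  proof (intro conjI ballI)
    fix x assume x: "x \<in> {x \<in> path_space K A. P (x i)}"
    have "cylinder K A i x \<subseteq> {x \<in> path_space K A. P (x i)}"
    proof
      fix y assume "y \<in> cylinder K A i x"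
      then have "y \<in> path_space K A" "y i = x i" unfolding cylinder_def by auto
      then show "y \<in> {x \<in> path_space K A. P (x i)}" using x by simp
    qed
    then show "\<exists>n. cylinder K A n x \<subseteq> {x \<in> path_space K A. P (x i)}" ..
  qed blast
qed

text \<open>This form of continuity matches what prefix-rewriting maps satisfy by construction.\<close>

lemma continuous_measurable:
  assumes f: "\<And>x. x \<in> path_space K A \<Longrightarrow> f x \<in> path_space L B"
    and cont: "\<And>x n. x \<in> path_space K A \<Longrightarrow> \<exists>N. \<forall>y\<in>cylinder K A N x. f y \<in> cylinder L B n (f x)"
  shows "f \<in> measurable (path_borel K A) (path_borel L B)"
proof (rule measurableI)
  show "x \<in> space (path_borel K A) \<Longrightarrow> f x \<in> space (path_borel L B)" for x using f by simp
  have "f \<in> measurable (path_borel K A) (sigma (path_space L B) {U. openin (path_topology L B) U})"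
  proof (rule measurable_measure_of)
    show "{U. openin (path_topology L B) U} \<subseteq> Pow (path_space L B)" by (auto simp: openin_path_iff)
    show "f \<in> space (path_borel K A) \<rightarrow> path_space L B" using f by auto
    fix U assume "U \<in> {U. openin (path_topology L B) U}"
    then have U: "\<And>x. x \<in> U \<Longrightarrow> \<exists>n. cylinder L B n x \<subseteq> U" by (auto simp: openin_path_iff)
    have "openin (path_topology K A) (f -` U \<inter> path_space K A)"
      unfolding openin_path_iff
    proof (intro conjI ballI)
      fix x assume x: "x \<in> f -` U \<inter> path_space K A"
      then obtain n where n: "cylinder L B n (f x) \<subseteq> U" using U by blast
      obtain N where "\<forall>y\<in>cylinder K A N x. f y \<in> cylinder L B n (f x)" using cont x by blast
      then show "\<exists>N. cylinder K A N x \<subseteq> f -` U \<inter> path_space K A"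
        using n cylinder_subset by (intro exI[of _ N]) blast
    qed auto
    then show "f -` U \<inter> space (path_borel K A) \<in> sets (path_borel K A)" by (simp add: open_in_sets)
  qed
  then show "E \<in> sets (path_borel L B) \<Longrightarrow> f -` E \<inter> space (path_borel K A) \<in> sets (path_borel K A)" for E
    unfolding path_borel_def[of L B] by (rule measurable_sets)
qed

lemma FC_measurable:
  assumes "\<gamma> \<in> FC K A" shows "\<gamma> \<in> measurable (path_borel K A) (path_borel K A)"
proof (rule continuous_measurable)
  show "x \<in> path_space K A \<Longrightarrow> \<gamma> x \<in> path_space K A" for x by (rule FC_in[OF assms])
  fix x n assume x: "x \<in> path_space K A"
  obtain N where N: "(\<forall>x\<in>path_space K A. \<forall>i>N. \<gamma> x i = x i) \<and>
    (\<forall>x\<in>path_space K A. \<forall>y\<in>path_space K A. \<forall>n\<ge>N. (\<forall>i\<le>n. x i = y i) \<longrightarrow> (\<forall>i\<le>n. \<gamma> x i = \<gamma> y i))"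
    using FC_prefix[OF assms] ..
  have "\<gamma> y i = \<gamma> x i" if "y \<in> cylinder K A (max N n) x" "i \<le> n" for y i
    by (rule conjunct2[OF N, rule_format, of _ _ "max N n"]) (use that x in \<open>auto simp: cylinder_def\<close>)
  then have "\<forall>y\<in>cylinder K A (max N n) x. \<gamma> y \<in> cylinder K A n (\<gamma> x)"
    using FC_in[OF assms] by (auto simp: cylinder_def)
  then show "\<exists>N. \<forall>y\<in>cylinder K A N x. \<gamma> y \<in> cylinder K A n (\<gamma> x)" by blast
qed

lemma FC_image_sets:
  assumes "\<gamma> \<in> FC K A" "E \<in> sets (path_borel K A)"
  shows "\<gamma> ` E \<in> sets (path_borel K A)"
proof -
  obtain \<delta> where d: "\<delta> \<in> FC K A" "\<And>x. x \<in> path_space K A \<Longrightarrow> \<delta> (\<gamma> x) = x"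
    "\<And>x. x \<in> path_space K A \<Longrightarrow> \<gamma> (\<delta> x) = x" by (rule FC_inverse[OF assms(1)]) blast
  have E: "E \<subseteq> path_space K A" using sets.sets_into_space[OF assms(2)] by simp
  have "\<gamma> ` E = \<delta> -` E \<inter> space (path_borel K A)"
  proof (intro equalityI subsetI)
    show "x \<in> \<delta> -` E \<inter> space (path_borel K A)" if "x \<in> \<gamma> ` E" for x
      using that d(2) E FC_in[OF assms(1)] by auto
    show "x \<in> \<gamma> ` E" if "x \<in> \<delta> -` E \<inter> space (path_borel K A)" for x
      using that d(3) by (intro image_eqI[of x \<gamma> "\<delta> x"]) auto
  qed
  then show ?thesis using measurable_sets[OF FC_measurable[OF d(1)] assms(2)] by simp
qed

text \<open>Sets on which two group elements agree are used to cut a set into pieces that a single element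
  moves.\<close>

lemma coordinate_agree_sets:
  assumes "f \<in> measurable (path_borel K A) (path_borel K A)" "g \<in> measurable (path_borel K A) (path_borel K A)"
    and fin: "\<And>i. finite (edges K A i)"
  shows "{x \<in> path_space K A. f x = g x} \<in> sets (path_borel K A)"
proof -
  have c: "{x \<in> path_space K A. h x i = v} \<in> sets (path_borel K A)"
    if h: "h \<in> measurable (path_borel K A) (path_borel K A)" for h i v
  proof -
    from measurable_sets[OF h coordinate_event_sets[where P = "\<lambda>e. e = v" and i = i]] measurable_space[OF h]
    show ?thesis by (simp add: vimage_def) (smt (verit, best) Collect_cong Int_def mem_Collect_eq space_path_borel)
  qed
  have "{x \<in> path_space K A. f x = g x} =
    (\<Inter>i. \<Union>v\<in>edges K A i. {x \<in> path_space K A. f x i = v} \<inter> {x \<in> path_space K A. g x i = v})"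
    using measurable_space[OF assms(1)] by (force simp: fun_eq_iff path_space_def)
  also have "\<dots> \<in> sets (path_borel K A)"
    using c[OF assms(1)] c[OF assms(2)]
    by (intro sets.countable_INT' image_subsetI sets.finite_UN fin sets.Int) auto
  finally show ?thesis .
qed

lemma finite_edges:
  assumes "\<And>i. finite (A i)" shows "finite (edges K A i)"
proof -
  have "edges K A i \<subseteq> (\<Union>a\<in>A i. \<Union>b\<in>A (Suc i). (\<lambda>j. (a, b, j)) ` {..<K i a b})"
    by (auto simp: edges_def)
  then show ?thesis by (rule finite_subset) (auto intro: assms)
qed

text \<open>A function that stands for a word has arbitrary values beyond the last position; fixing these values
  leaves finitely many representatives.\<close>

definition words :: "'v matseq \<Rightarrow> 'v alphabets \<Rightarrow> nat \<Rightarrow> 'v path set" where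
  "words K A n = {e \<in> extensional {..n}. word K A n e}"

lemma finite_words:
  assumes "\<And>i. finite (A i)" shows "finite (words K A n)"
proof (rule finite_subset)
  show "words K A n \<subseteq> Pi\<^sub>E {..n} (edges K A)"
    by (auto simp: words_def word_def PiE_def)
  show "finite (Pi\<^sub>E {..n} (edges K A))" by (intro finite_PiE finite_edges assms) auto
qed

lemma restrict_words: "word K A n e \<Longrightarrow> restrict e {..n} \<in> words K A n"
  by (auto simp: words_def word_def)

lemma cylinder_restrict: "cylinder K A n (restrict e {..n}) = cylinder K A n e"
  by (rule cylinder_cong) auto

text \<open>An interchange depends only on the finite words it is built from, not on the functions representing
  them.\<close>

lemma countable_swaps:
  assumes "\<And>i. finite (A i)" shows "countable (swaps K A)"
proof -
  have "swaps K A \<subseteq> (\<Union>n. (\<lambda>(e, f). cyl_swap K A n e f) ` (words K A n \<times> words K A n))"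
  proof
    fix s assume "s \<in> swaps K A"
    then obtain n e f where s: "s = cyl_swap K A n e f" "word K A n e" "word K A n f"
      by (auto simp: swaps_def)
    have "cyl_swap K A n e f = cyl_swap K A n (restrict e {..n}) (restrict f {..n})"
      unfolding cyl_swap_def cylinder_restrict by (auto simp: replace_prefix_def fun_eq_iff)
    then show "s \<in> (\<Union>n. (\<lambda>(e, f). cyl_swap K A n e f) ` (words K A n \<times> words K A n))"
      using s restrict_words by fastforce
  qed
  moreover have "countable (words K A n \<times> words K A n)" for n
    by (intro countable_finite finite_cartesian_product finite_words assms)
  ultimately show ?thesis by (auto intro: countable_subset)
qed

lemma cylinder_image_words:
  assumes "x \<in> path_space K A"
  shows "cylinder K A n x \<in> cylinder K A n ` words K A n"
proof -
  have "cylinder K A n (restrict x {..n}) \<in> cylinder K A n ` words K A n"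
    by (intro imageI restrict_words path_word assms)
  then show ?thesis by (simp only: cylinder_restrict)
qed

text \<open>The short cylinders may be left out because each of them is a union of longer ones.\<close>

lemma sets_path_borel_cylinders:
  assumes fin: "\<And>i. finite (A i)"
  shows "sets (path_borel K A) =
    sigma_sets (path_space K A) (insert {} {cylinder K A n x |n x. N \<le> n \<and> x \<in> path_space K A})"
    (is "_ = sigma_sets _ ?C")
proof (unfold sets_path_borel, rule sigma_sets_eqI)
  fix U assume "U \<in> {U. openin (path_topology K A) U}"
  then have U: "U \<subseteq> path_space K A" "\<And>x. x \<in> U \<Longrightarrow> \<exists>n. cylinder K A n x \<subseteq> U"
    by (auto simp: openin_path_iff)
  let ?D = "{C \<in> ?C. C \<subseteq> U}"
  have "?C \<subseteq> insert {} (\<Union>n. cylinder K A n ` words K A n)"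
  proof
    fix C assume "C \<in> ?C"
    then show "C \<in> insert {} (\<Union>n. cylinder K A n ` words K A n)"
    proof (elim insertE CollectE exE conjE)
      fix n x assume "C = cylinder K A n x" "x \<in> path_space K A"
      then show ?thesis using cylinder_image_words[of x K A n] by (intro insertI2 UN_I[of n]) simp_all
    qed simp
  qed
  moreover have "countable (insert {} (\<Union>n. cylinder K A n ` words K A n))"
    by (intro countable_insert countable_UN[OF countableI_type] countable_image countable_finite finite_words fin)
  ultimately have "countable ?C" by (rule countable_subset)
  then have "countable ?D" by (rule countable_subset[rotated]) (rule subsetI, elim CollectE conjE)
  moreover have "U = \<Union>?D"
  proof (intro equalityI subsetI)
    fix x assume x: "x \<in> U"
    then obtain n where n: "cylinder K A n x \<subseteq> U" using U(2) by blast
    have xs: "x \<in> path_space K A" using x U(1) by blast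
    have "cylinder K A (max N n) x \<subseteq> U"
      using cylinder_antimono[of n "max N n" K A x] n by simp
    moreover have "cylinder K A (max N n) x \<in> ?C"
      using xs by (intro insertI2 CollectI exI[of _ "max N n"] exI[of _ x]) simp
    ultimately show "x \<in> \<Union>?D"
      using in_cylinder_self[OF xs] by (intro UnionI[of "cylinder K A (max N n) x"] CollectI conjI)
  next
    fix x assume "x \<in> \<Union>?D"
    then show "x \<in> U" by (elim UnionE CollectE conjE) (rule subsetD)
  qed
  moreover have "sigma_sets (path_space K A) ?C \<supseteq> ?D"
    by (rule subsetI, elim CollectE conjE) (rule sigma_sets.Basic)
  ultimately show "U \<in> sigma_sets (path_space K A) ?C"
    using sigma_sets_UNION[of ?D "path_space K A" ?C] by (simp only: subset_iff)
next
  fix C assume "C \<in> ?C"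
  then show "C \<in> sigma_sets (path_space K A) {U. openin (path_topology K A) U}"
    by (auto intro!: sigma_sets.Basic openin_cylinder)
qed

lemma Int_stable_cylinders:
  "Int_stable (insert {} {cylinder K A n x |n x. N \<le> n \<and> x \<in> path_space K A})"
proof -
  have *: "cylinder K A n x \<inter> cylinder K A m y = {} \<or> cylinder K A n x \<inter> cylinder K A m y = cylinder K A m y"
    if "n \<le> m" for n m x y
    using that by (fastforce simp: cylinder_def)
  let ?C = "insert {} {cylinder K A n x |n x. N \<le> n \<and> x \<in> path_space K A}"
  have mem: "cylinder K A n x \<in> ?C" if "N \<le> n" "x \<in> path_space K A" for n x
    using that by blast
  have int: "cylinder K A n x \<inter> cylinder K A m y \<in> ?C"
    if "n \<le> m" "N \<le> m" "y \<in> path_space K A" for n m x y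
    using *[OF that(1), of x y] mem[OF that(2,3)] by (elim disjE) simp_all
  have "cylinder K A n x \<inter> cylinder K A m y \<in> ?C"
    if "N \<le> n" "N \<le> m" "x \<in> path_space K A" "y \<in> path_space K A" for n m x y
    using int[of n m y x] int[of m n x y] that by (cases "n \<le> m") (simp_all add: Int_commute)
  then show ?thesis unfolding Int_stable_def by blast
qed

text \<open>Long cylinders are all that is needed, and they are what group elements handle well: beyond the
  length of the prefixes it rewrites, a group element maps cylinders to cylinders.\<close>

lemma measure_eqI_cylinders:
  assumes fin: "\<And>i. finite (A i)"
    and sets: "sets \<mu> = sets (path_borel K A)" "sets \<nu> = sets (path_borel K A)"
    and eq: "\<And>n x. N \<le> n \<Longrightarrow> x \<in> path_space K A \<Longrightarrow>
      emeasure \<mu> (cylinder K A n x) = emeasure \<nu> (cylinder K A n x)"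
    and finite: "\<And>n x. N \<le> n \<Longrightarrow> x \<in> path_space K A \<Longrightarrow> emeasure \<mu> (cylinder K A n x) \<noteq> \<infinity>"
  shows "\<mu> = \<nu>"
proof (rule measure_eqI_generator_eq_countable[OF Int_stable_cylinders])
  let ?F = "cylinder K A N ` path_space K A"
  show "insert {} {cylinder K A n x |n x. N \<le> n \<and> x \<in> path_space K A} \<subseteq> Pow (path_space K A)"
    by (auto simp: cylinder_def)
  show "emeasure \<mu> X = emeasure \<nu> X"
    if "X \<in> insert {} {cylinder K A n x |n x. N \<le> n \<and> x \<in> path_space K A}" for X
    using that eq by (elim insertE CollectE exE conjE) simp_all
  show "sets \<mu> = sigma_sets (path_space K A) (insert {} {cylinder K A n x |n x. N \<le> n \<and> x \<in> path_space K A})"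
    "sets \<nu> = sigma_sets (path_space K A) (insert {} {cylinder K A n x |n x. N \<le> n \<and> x \<in> path_space K A})"
    unfolding sets by (rule sets_path_borel_cylinders[OF fin])+
  show "?F \<subseteq> insert {} {cylinder K A n x |n x. N \<le> n \<and> x \<in> path_space K A}" by auto
  show "\<Union>?F = path_space K A" using in_cylinder_self by (fastforce simp: cylinder_def)
  have "?F \<subseteq> cylinder K A N ` words K A N"
    using cylinder_image_words by blast
  then show "countable ?F" by (meson countable_finite finite_imageI finite_subset finite_words fin)
  show "a \<in> ?F \<Longrightarrow> emeasure \<mu> a \<noteq> \<infinity>" for a using finite by auto
qed

section \<open>Invariant measures\<close>

lemma inv_sets: "invariant_borel_measure K A \<mu> \<Longrightarrow> sets \<mu> = sets (path_borel K A)"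
  by (simp add: invariant_borel_measure_def)

lemma inv_space: "invariant_borel_measure K A \<mu> \<Longrightarrow> space \<mu> = path_space K A"
  using sets_eq_imp_space_eq[OF inv_sets] by (metis space_path_borel)

lemma inv_image:
  assumes "invariant_borel_measure K A \<mu>" "\<gamma> \<in> FC K A" "E \<in> sets (path_borel K A)"
  shows "emeasure \<mu> (\<gamma> ` E) = emeasure \<mu> E"
  using assms by (simp add: invariant_borel_measure_def)

lemma Borel_subset: "E \<in> sets (path_borel K A) \<Longrightarrow> E \<subseteq> path_space K A"
  using sets.sets_into_space[of E "path_borel K A"] by simp

lemma FC_inj: "\<gamma> \<in> FC K A \<Longrightarrow> inj_on \<gamma> (path_space K A)"
  using FC_bij by (rule bij_betw_imp_inj_on)

lemma singleton_sets:
  assumes "x \<in> path_space K A" shows "{x} \<in> sets (path_borel K A)"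
proof -
  have "{x} = (\<Inter>n. cylinder K A n x)"
    using assms by (auto simp: cylinder_def fun_eq_iff)
  moreover have "(\<Inter>n. cylinder K A n x) \<in> sets (path_borel K A)"
    by (intro sets.countable_INT' image_subsetI) auto
  ultimately show ?thesis by simp
qed

lemma null_subset:
  assumes "sets \<mu> = sets (path_borel K A)" "N \<in> sets (path_borel K A)" "emeasure \<mu> N = 0" "E \<subseteq> N"
  shows "emeasure \<mu> E = 0"
  using emeasure_eq_0[of N \<mu> E] assms by simp

text \<open>The saturation of a Borel set is cut into countably many Borel pieces, each of which is carried
  into the set by a single group element.  This is how statements about a set are spread over its orbit,
  with no finiteness of the measure required.\<close>

lemma saturation_partition:
  assumes fin: "\<And>i. finite (A i)" and Y: "Y \<in> sets (path_borel K A)"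
  obtains s D where "\<And>n::nat. s n \<in> FC K A" "\<And>n. D n \<in> sets (path_borel K A)" "disjoint_family D"
    "(\<Union>n. D n) = saturation K A Y" "\<And>n. s n ` D n \<subseteq> Y"
    "\<And>n x. x \<in> path_space K A \<Longrightarrow> s n (s n x) = x"
proof (cases "swaps K A = {}")
  case True
  show ?thesis
  proof (rule that[of "\<lambda>_. \<lambda>x\<in>path_space K A. x" "\<lambda>_. {}"])
    show "(\<Union>n::nat. {}) = saturation K A Y"
      using saturation_eq_swaps[OF Borel_subset[OF Y]] True by simp
  qed (auto simp: FC_id disjoint_family_on_def)
next
  case False
  define s where "s = from_nat_into (swaps K A)"
  have s: "range s = swaps K A"
    unfolding s_def using False countable_swaps[OF fin] by (rule range_from_nat_into)
  then have sn: "s n \<in> swaps K A" for n by blast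
  have sY: "s n ` Y \<in> sets (path_borel K A)" for n
    by (rule FC_image_sets[OF swaps_FC[OF sn] Y])
  show ?thesis
  proof (rule that[of s "disjointed (\<lambda>n. s n ` Y)"])
    show "s n \<in> FC K A" for n by (rule swaps_FC[OF sn])
    show "disjointed (\<lambda>n. s n ` Y) n \<in> sets (path_borel K A)" for n
      using sets.range_disjointed_sets[of "\<lambda>n. s n ` Y" "path_borel K A"] sY by blast
    show "disjoint_family (disjointed (\<lambda>n. s n ` Y))" by (rule disjoint_family_disjointed)
    show "(\<Union>n. disjointed (\<lambda>n. s n ` Y) n) = saturation K A Y"
      unfolding UN_disjointed_eq saturation_eq_swaps[OF Borel_subset[OF Y]] s[symmetric] by simp
    show inv: "s n (s n x) = x" if "x \<in> path_space K A" for n x by (rule swaps_swap[OF sn that])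
    show "s n ` disjointed (\<lambda>n. s n ` Y) n \<subseteq> Y" for n
    proof
      fix x assume "x \<in> s n ` disjointed (\<lambda>n. s n ` Y) n"
      then obtain y where y: "y \<in> Y" "x = s n (s n y)"
        using disjointed_subset[of "\<lambda>n. s n ` Y" n] by blast
      then have "x = y" using inv[of y n] Borel_subset[OF Y] by blast
      then show "x \<in> Y" using y by blast
    qed
  qed
qed

lemma saturation_sets:
  assumes "\<And>i. finite (A i)" "E \<in> sets (path_borel K A)"
  shows "saturation K A E \<in> sets (path_borel K A)"
proof -
  obtain s D where "\<And>n::nat. D n \<in> sets (path_borel K A)" "(\<Union>n. D n) = saturation K A E"
    by (rule saturation_partition[OF assms]) blast
  then show ?thesis by (metis sets.countable_UN image_subsetI)
qed

text \<open>Each piece of the partition of the saturation is moved into the given set without changing either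
  measure.\<close>

lemma invariant_le_on_saturation:
  assumes fin: "\<And>i. finite (A i)"
    and inv: "invariant_borel_measure K A \<mu>" "invariant_borel_measure K A \<nu>"
    and Y: "Y \<in> sets (path_borel K A)"
    and le: "\<And>E. E \<in> sets (path_borel K A) \<Longrightarrow> E \<subseteq> Y \<Longrightarrow> emeasure \<mu> E \<le> emeasure \<nu> E"
    and E: "E \<in> sets (path_borel K A)" "E \<subseteq> saturation K A Y"
  shows "emeasure \<mu> E \<le> emeasure \<nu> E"
proof -
  obtain s D where s: "\<And>n::nat. s n \<in> FC K A" and D: "\<And>n. D n \<in> sets (path_borel K A)" "disjoint_family D"
    "(\<Union>n. D n) = saturation K A Y" "\<And>n. s n ` D n \<subseteq> Y"
    by (rule saturation_partition[OF fin Y]) blast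
  have S: "E \<inter> D n \<in> sets (path_borel K A)" for n using D(1) E(1) by blast
  have dis: "disjoint_family (\<lambda>n. E \<inter> D n)"
    using D(2) by (auto simp: disjoint_family_on_def)
  have U: "(\<Union>n. E \<inter> D n) = E" using D(3) E(2) by blast
  have sum: "emeasure \<kappa> E = (\<Sum>n. emeasure \<kappa> (s n ` (E \<inter> D n)))" if k: "invariant_borel_measure K A \<kappa>" for \<kappa>
  proof -
    have "(\<Sum>n. emeasure \<kappa> (E \<inter> D n)) = emeasure \<kappa> (\<Union>n. E \<inter> D n)"
      by (rule suminf_emeasure[OF _ dis]) (use S inv_sets[OF k] in auto)
    then show ?thesis using U inv_image[OF k s S] by simp
  qed
  show ?thesis unfolding sum[OF inv(1)] sum[OF inv(2)]
  proof (rule suminf_le)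
    show "emeasure \<mu> (s n ` (E \<inter> D n)) \<le> emeasure \<nu> (s n ` (E \<inter> D n))" for n
      using D(4)[of n] by (intro le FC_image_sets[OF s S]) blast
  qed auto
qed

lemma null_saturation:
  assumes fin: "\<And>i. finite (A i)" and inv: "invariant_borel_measure K A \<mu>"
    and Y: "Y \<in> sets (path_borel K A)" "emeasure \<mu> Y = 0"
  shows "emeasure \<mu> (saturation K A Y) = 0"
proof -
  obtain s D where s: "\<And>n::nat. s n \<in> FC K A" and D: "\<And>n. D n \<in> sets (path_borel K A)" "disjoint_family D"
    "(\<Union>n. D n) = saturation K A Y" "\<And>n. s n ` D n \<subseteq> Y"
    by (rule saturation_partition[OF fin Y(1)]) blast
  have "emeasure \<mu> (D n) = 0" for n
  proof -
    have "emeasure \<mu> (s n ` D n) \<le> emeasure \<mu> Y"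
      using D(4) Y(1) inv_sets[OF inv] by (intro emeasure_mono) auto
    then show ?thesis using inv_image[OF inv s D(1)] Y(2) by simp
  qed
  then have "emeasure \<mu> (\<Union>n. D n) = 0"
    using D(1) inv_sets[OF inv] by (intro emeasure_UN_eq_0) auto
  then show ?thesis using D(3) by simp
qed

text \<open>This is the uniqueness of invariant extensions.\<close>

lemma invariant_eqI_saturation:
  assumes fin: "\<And>i. finite (A i)"
    and inv: "invariant_borel_measure K A \<mu>" "invariant_borel_measure K A \<nu>"
    and Y: "Y \<in> sets (path_borel K A)"
    and eq: "\<And>E. E \<in> sets (path_borel K A) \<Longrightarrow> E \<subseteq> Y \<Longrightarrow> emeasure \<mu> E = emeasure \<nu> E"
    and null: "emeasure \<mu> (path_space K A - saturation K A Y) = 0"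
      "emeasure \<nu> (path_space K A - saturation K A Y) = 0"
  shows "\<mu> = \<nu>"
proof (rule measure_eqI)
  show "sets \<mu> = sets \<nu>" using inv inv_sets by metis
  fix E assume "E \<in> sets \<mu>"
  then have E: "E \<in> sets (path_borel K A)" using inv_sets[OF inv(1)] by simp
  have S: "saturation K A Y \<in> sets (path_borel K A)" by (rule saturation_sets[OF fin Y])
  have split: "emeasure \<kappa> E = emeasure \<kappa> (E \<inter> saturation K A Y)"
    if k: "invariant_borel_measure K A \<kappa>" "emeasure \<kappa> (path_space K A - saturation K A Y) = 0" for \<kappa>
  proof -
    have "emeasure \<kappa> (E - saturation K A Y) = 0"
      using Borel_subset[OF E] S inv_sets[OF k(1)]
      by (intro emeasure_eq_0[OF _ k(2)] sets.Diff) auto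
    moreover have "E = (E \<inter> saturation K A Y) \<union> (E - saturation K A Y)" by blast
    moreover have "emeasure \<kappa> ((E \<inter> saturation K A Y) \<union> (E - saturation K A Y)) =
        emeasure \<kappa> (E \<inter> saturation K A Y) + emeasure \<kappa> (E - saturation K A Y)"
      using E S inv_sets[OF k(1)] by (intro plus_emeasure[symmetric]) auto
    ultimately show ?thesis by simp
  qed
  have ES: "E \<inter> saturation K A Y \<in> sets (path_borel K A)" using E S by blast
  have "emeasure \<mu> (E \<inter> saturation K A Y) \<le> emeasure \<nu> (E \<inter> saturation K A Y)"
    by (rule invariant_le_on_saturation[OF fin inv Y _ ES]) (simp_all add: eq)
  moreover have "emeasure \<nu> (E \<inter> saturation K A Y) \<le> emeasure \<mu> (E \<inter> saturation K A Y)"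
    by (rule invariant_le_on_saturation[OF fin inv(2,1) Y _ ES]) (simp_all add: eq)
  ultimately show "emeasure \<mu> E = emeasure \<nu> E"
    unfolding split[OF inv(1) null(1)] split[OF inv(2) null(2)] by (rule antisym)
qed

lemma ergodicD:
  assumes "ergodic (FC K A) \<mu>" "sets \<mu> = sets (path_borel K A)"
    "E \<in> sets (path_borel K A)" "saturation K A E \<subseteq> E"
  shows "emeasure \<mu> E = 0 \<or> emeasure \<mu> (path_space K A - E) = 0"
proof -
  have "space \<mu> = path_space K A" using sets_eq_imp_space_eq[OF assms(2)] by simp
  then show ?thesis
    using assms FC_invariant_iff[OF Borel_subset[OF assms(3)]] unfolding ergodic_def by metis
qed

lemma ergodicI:
  assumes "sets \<mu> = sets (path_borel K A)"
    and "\<And>E. E \<in> sets (path_borel K A) \<Longrightarrow> saturation K A E \<subseteq> E \<Longrightarrow>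
      emeasure \<mu> E = 0 \<or> emeasure \<mu> (path_space K A - E) = 0"
  shows "ergodic (FC K A) \<mu>"
  unfolding ergodic_def
proof (intro ballI impI)
  fix E assume "E \<in> sets \<mu>" "\<forall>\<gamma>\<in>FC K A. \<gamma> ` E = E"
  moreover have "space \<mu> = path_space K A" using sets_eq_imp_space_eq[OF assms(1)] by simp
  ultimately show "emeasure \<mu> E = 0 \<or> emeasure \<mu> (space \<mu> - E) = 0"
    using assms FC_invariant_iff[OF Borel_subset, of E K A] by simp
qed

lemma suminf_swap_ennreal: "(\<Sum>i. \<Sum>j. f i j) = (\<Sum>j. \<Sum>i. f i j :: ennreal)"
  using nn_integral_suminf[of f "count_space UNIV"]
  unfolding nn_integral_count_space_nat by simp

lemma emeasure_split_UN:
  fixes D :: "nat \<Rightarrow> 'a set"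
  assumes "P \<in> sets \<mu>" "\<And>n. D n \<in> sets \<mu>" "disjoint_family D" "P \<subseteq> (\<Union>n. D n)"
  shows "emeasure \<mu> P = (\<Sum>n. emeasure \<mu> (P \<inter> D n))"
proof -
  have "disjoint_family (\<lambda>n. P \<inter> D n)" using assms(3) unfolding disjoint_family_on_def by blast
  then have "(\<Sum>n. emeasure \<mu> (P \<inter> D n)) = emeasure \<mu> (\<Union>n. P \<inter> D n)"
    using assms(1,2) by (intro suminf_emeasure) auto
  also have "(\<Union>n. P \<inter> D n) = P" using assms(4) by blast
  finally show ?thesis ..
qed

section \<open>Subalphabets\<close>

locale subsystem =
  fixes K :: "'v matseq" and A B :: "'v alphabets"
  assumes fin: "\<And>i. finite (A i)" and sub: "\<And>i. B i \<subseteq> A i"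
begin

lemma finB: "finite (B i)"
  using fin sub by (rule rev_finite_subset)

lemma edges_sub: "edges K B i \<subseteq> edges K A i"
  using sub by (auto simp: edges_def)

lemma path_space_sub: "path_space K B \<subseteq> path_space K A"
  using edges_sub unfolding path_space_def by blast

lemma word_sub: "word K B n e \<Longrightarrow> word K A n e"
  using edges_sub unfolding word_def by blast

lemma path_space_B_iff: "x \<in> path_space K B \<longleftrightarrow> x \<in> path_space K A \<and> (\<forall>i. src (x i) \<in> B i)"
proof
  show "x \<in> path_space K B \<Longrightarrow> x \<in> path_space K A \<and> (\<forall>i. src (x i) \<in> B i)"
    using path_space_sub src_in unfolding path_space_def by blast
  assume x: "x \<in> path_space K A \<and> (\<forall>i. src (x i) \<in> B i)"
  have "x i \<in> edges K B i" for i
  proof -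
    have "x i \<in> edges K A i" "src (x i) \<in> B i" "tgt (x i) \<in> B (Suc i)"
      using x by (auto simp: path_space_def)
    then show ?thesis by (auto simp: edges_def src_def tgt_def)
  qed
  then show "x \<in> path_space K B" using x by (simp add: path_space_def)
qed

lemma cylinder_B: "cylinder K B n e = cylinder K A n e \<inter> path_space K B"
  using path_space_sub unfolding cylinder_def by blast

lemma path_space_B_sets: "path_space K B \<in> sets (path_borel K A)"
proof -
  have "path_space K B = (\<Inter>i. {x \<in> path_space K A. src (x i) \<in> B i})"
    using path_space_B_iff by blast
  also have "\<dots> \<in> sets (path_borel K A)"
    by (intro sets.countable_INT' image_subsetI coordinate_event_sets) auto
  finally show ?thesis .
qed

text \<open>The inclusion of path spaces is continuous, and an open set of the smaller space is the trace of
  the union of the cylinders of the larger space that meet the smaller space inside it.\<close>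

lemma sets_B: "sets (path_borel K B) = {E \<in> sets (path_borel K A). E \<subseteq> path_space K B}"
proof (rule equalityI; rule subsetI)
  fix E assume E: "E \<in> sets (path_borel K B)"
  have "E \<in> sets (path_borel K A)"
    using E unfolding sets_path_borel[of K B]
  proof (induction rule: sigma_sets.induct)
    case (Basic U)
    define V where "V = {x \<in> path_space K A. \<exists>n. cylinder K A n x \<inter> path_space K B \<subseteq> U}"
    have "openin (path_topology K A) V"
      unfolding openin_path_iff
    proof (intro conjI ballI)
      fix x assume "x \<in> V"
      then obtain n where n: "cylinder K A n x \<inter> path_space K B \<subseteq> U" unfolding V_def by blast
      have "cylinder K A n x \<subseteq> V"
      proof
        fix y assume "y \<in> cylinder K A n x"
        then show "y \<in> V" using n cylinder_eq[of y K A n x] cylinder_subset[of K A n x]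
          unfolding V_def by (intro CollectI conjI exI[of _ n]) auto
      qed
      then show "\<exists>n. cylinder K A n x \<subseteq> V" ..
    qed (simp add: V_def)
    moreover have "U = V \<inter> path_space K B"
    proof (intro equalityI subsetI)
      fix x assume x: "x \<in> U"
      then obtain n where "cylinder K B n x \<subseteq> U" "x \<in> path_space K B"
        using Basic unfolding mem_Collect_eq openin_path_iff by blast
      then show "x \<in> V \<inter> path_space K B"
        using path_space_sub unfolding V_def cylinder_B by blast
    next
      fix x assume "x \<in> V \<inter> path_space K B"
      then show "x \<in> U" using in_cylinder_self[of x K A] unfolding V_def by blast
    qed
    ultimately show ?case using open_in_sets path_space_B_sets by (metis sets.Int)
  next
    case Empty
    show ?case by simp
  next
    case (Compl a)
    then show ?case using path_space_B_sets by (intro sets.Diff)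
  next
    case (Union a)
    then show ?case by (intro sets.countable_UN) auto
  qed
  then show "E \<in> {E \<in> sets (path_borel K A). E \<subseteq> path_space K B}"
    using Borel_subset[OF E] by simp
next
  fix E assume "E \<in> {E \<in> sets (path_borel K A). E \<subseteq> path_space K B}"
  then have E: "E \<in> sets (path_borel K A)" "E \<inter> path_space K B = E" by auto
  have "(\<lambda>x. x) \<in> measurable (path_borel K B) (path_borel K A)"
  proof (rule continuous_measurable)
    show "x \<in> path_space K B \<Longrightarrow> x \<in> path_space K A" for x using path_space_sub by blast
    show "\<exists>N. \<forall>y\<in>cylinder K B N x. y \<in> cylinder K A n x" for x n
      using cylinder_B by blast
  qed
  from measurable_sets[OF this E(1)] show "E \<in> sets (path_borel K B)"
    using E(2) by simp
qed

text \<open>A word of the subsystem is a word of the whole, so every generator is the restriction of a generator.\<close>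

lemma FC_lift:
  assumes "\<gamma> \<in> FC K B"
  shows "\<exists>\<gamma>'\<in>FC K A. \<forall>x\<in>path_space K B. \<gamma>' x = \<gamma> x"
  using assms
proof (induction rule: FC_induct)
  case id
  then show ?case using path_space_sub by (intro bexI[OF _ FC_id]) auto
next
  case (swap s)
  then obtain n e f where s: "s = cyl_swap K B n e f" "word K B n e" "word K B n f" "tgt (e n) = tgt (f n)"
    unfolding swaps_def by blast
  then have "cyl_swap K A n e f \<in> swaps K A" unfolding swaps_def using word_sub by blast
  moreover have "cyl_swap K A n e f x = s x" if x: "x \<in> path_space K B" for x
    using x path_space_sub unfolding s(1) cyl_swap_def cylinder_B by auto
  ultimately show ?case using swaps_FC by blast
next
  case (comp g h)
  then obtain g' h' where "g' \<in> FC K A" "\<forall>x\<in>path_space K B. g' x = g x"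
    "h' \<in> FC K A" "\<forall>x\<in>path_space K B. h' x = h x" by blast
  then show ?case using FC_in[OF comp(2)] path_space_sub
    by (intro bexI[OF _ FC_compose[of g' K A h']]) (auto simp: compose_def)
qed

lemma saturation_B:
  "E \<subseteq> path_space K B \<Longrightarrow> saturation K B E = saturation K A E \<inter> path_space K B"
  using path_space_sub unfolding saturation_def by blast

text \<open>An element of the larger group that maps a part of the smaller path space into the smaller path
  space agrees there, piece by piece, with elements of the smaller group.\<close>

lemma transfer_invariant:
  assumes inv: "invariant_borel_measure K B \<mu>" and g: "\<gamma> \<in> FC K A"
    and P: "P \<in> sets (path_borel K A)" "P \<subseteq> path_space K B" "\<gamma> ` P \<subseteq> path_space K B"
  shows "emeasure \<mu> (\<gamma> ` P) = emeasure \<mu> P"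
proof (cases "swaps K B = {}")
  case True
  have "path_space K B = {}"
    using saturation_eq_swaps[of "path_space K B" K B] subset_saturation[of "path_space K B" K B] True
    by simp
  then show ?thesis using P by simp
next
  case False
  have Psub: "P \<subseteq> path_space K A" by (rule Borel_subset[OF P(1)])
  define t where "t = from_nat_into (swaps K B)"
  have t: "range t = swaps K B"
    unfolding t_def using False countable_swaps[OF finB] by (rule range_from_nat_into)
  then have tn: "t n \<in> FC K B" for n using swaps_FC by blast
  have "\<exists>u. \<forall>n. u n \<in> FC K A \<and> (\<forall>x\<in>path_space K B. u n x = t n x)"
    by (rule choice) (use FC_lift[OF tn] in blast)
  then obtain u where u: "\<And>n. u n \<in> FC K A" "\<And>n x. x \<in> path_space K B \<Longrightarrow> u n x = t n x" by blast
  \<comment> \<open>the Borel sets on which the given element agrees with the n-th interchange of the smaller group\<close>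
  define C where "C n = {x \<in> path_space K A. \<gamma> x = u n x}" for n
  have C: "C n \<in> sets (path_borel K A)" for n
    unfolding C_def by (rule coordinate_agree_sets[OF FC_measurable[OF g] FC_measurable[OF u(1)] finite_edges[OF fin]])
  define D where "D n = P \<inter> disjointed C n" for n
  have DA: "D n \<in> sets (path_borel K A)" for n
    using sets.range_disjointed_sets[of C "path_borel K A"] C P(1) unfolding D_def by blast
  then have DB: "D n \<in> sets (path_borel K B)" for n
    using P(2) unfolding sets_B D_def by blast
  have dis: "disjoint_family D"
    using disjoint_family_disjointed[of C] unfolding D_def disjoint_family_on_def by blast
  have "P \<subseteq> (\<Union>n. C n)"
  proof
    fix x assume x: "x \<in> P"
    obtain N where "\<forall>x\<in>path_space K A. \<forall>i>N. \<gamma> x i = x i" using FC_tail[OF g] ..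
    then have tl: "\<forall>i>N. \<gamma> x i = x i" using x Psub by blast
    have xB: "x \<in> path_space K B" "\<gamma> x \<in> path_space K B" using x P by auto
    have s: "cyl_swap K B N x (\<gamma> x) \<in> swaps K B" "cyl_swap K B N x (\<gamma> x) x = \<gamma> x"
      using tl by (auto intro!: swap_path xB)
    then obtain n where "cyl_swap K B N x (\<gamma> x) = t n" using t by (metis imageE)
    then have "\<gamma> x = u n x" using s(2) u(2)[OF xB(1)] by simp
    then show "x \<in> (\<Union>n. C n)" using x Psub unfolding C_def by blast
  qed
  then have U: "(\<Union>n. D n) = P" using UN_disjointed_eq[of C] unfolding D_def by blast
  have img: "\<gamma> ` D n = t n ` D n" for n
  proof (rule image_cong[OF refl])
    fix x assume "x \<in> D n"
    then have "x \<in> C n" "x \<in> P" using disjointed_subset[of C n] unfolding D_def by auto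
    then show "\<gamma> x = t n x" using u(2) P(2) unfolding C_def by auto
  qed
  have "disjoint_family (\<lambda>n. \<gamma> ` D n)"
    unfolding disjoint_family_on_def
  proof (intro ballI impI)
    fix m n :: nat assume "m \<noteq> n"
    then have "D m \<inter> D n = {}" using dis unfolding disjoint_family_on_def by blast
    moreover have "D m \<subseteq> path_space K A" "D n \<subseteq> path_space K A" using Psub unfolding D_def by auto
    ultimately show "\<gamma> ` D m \<inter> \<gamma> ` D n = {}"
      using inj_on_image_Int[OF FC_inj[OF g], of "D m" "D n"] by simp
  qed
  moreover have sets: "\<gamma> ` D n \<in> sets \<mu>" for n
    unfolding img inv_sets[OF inv] by (rule FC_image_sets[OF tn DB])
  ultimately have "emeasure \<mu> (\<Union>n. \<gamma> ` D n) = (\<Sum>n. emeasure \<mu> (\<gamma> ` D n))"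
    by (intro suminf_emeasure[symmetric]) auto
  also have "\<dots> = (\<Sum>n. emeasure \<mu> (D n))"
    unfolding img using inv_image[OF inv tn DB] by simp
  also have "\<dots> = emeasure \<mu> (\<Union>n. D n)"
    using DB inv_sets[OF inv] by (intro suminf_emeasure dis) auto
  finally show ?thesis unfolding image_UN[symmetric] U .
qed

lemma sets_restrict_B:
  assumes "sets \<nu> = sets (path_borel K A)"
  shows "sets (restrict_space \<nu> (path_space K B)) = sets (path_borel K B)"
    and "space (restrict_space \<nu> (path_space K B)) = path_space K B"
    and "E \<subseteq> path_space K B \<Longrightarrow> emeasure (restrict_space \<nu> (path_space K B)) E = emeasure \<nu> E"
proof -
  have sp: "space \<nu> = path_space K A" using sets_eq_imp_space_eq[OF assms] by simp
  have S: "path_space K B \<inter> space \<nu> \<in> sets \<nu>"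
    using path_space_B_sets path_space_sub unfolding sp assms by (simp add: Int_absorb2)
  show "sets (restrict_space \<nu> (path_space K B)) = sets (path_borel K B)"
    unfolding sets_B using sets_restrict_space_iff[OF S] assms by blast
  show "space (restrict_space \<nu> (path_space K B)) = path_space K B"
    using path_space_sub by (simp add: space_restrict_space sp Int_absorb2)
  show "emeasure (restrict_space \<nu> (path_space K B)) E = emeasure \<nu> E" if "E \<subseteq> path_space K B"
    by (rule emeasure_restrict_space[OF S that])
qed

lemma restrict_invariant:
  assumes "invariant_borel_measure K A \<nu>"
  shows "invariant_borel_measure K B (restrict_space \<nu> (path_space K B))"
  unfolding invariant_borel_measure_def
proof (intro conjI ballI)
  note R = sets_restrict_B[OF inv_sets[OF assms]]
  show "sets (restrict_space \<nu> (path_space K B)) = sets (path_borel K B)" by (rule R)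
  fix g E assume g: "g \<in> FC K B" and "E \<in> sets (restrict_space \<nu> (path_space K B))"
  then have E: "E \<in> sets (path_borel K A)" "E \<subseteq> path_space K B" unfolding R sets_B by auto
  obtain h where h: "h \<in> FC K A" "\<forall>x\<in>path_space K B. h x = g x" using FC_lift[OF g] by blast
  have "h ` E = g ` E" using h(2) E(2) by (intro image_cong) auto
  moreover have "g ` E \<subseteq> path_space K B" using FC_in[OF g] E(2) by blast
  ultimately show "emeasure (restrict_space \<nu> (path_space K B)) (g ` E) =
      emeasure (restrict_space \<nu> (path_space K B)) E"
    using R(3) E inv_image[OF assms h(1) E(1)] by metis
qed

section \<open>Restriction and extension of invariant measures\<close>

text \<open>A set that is invariant in the smaller path space is the trace of its saturation in the larger
  one, which is invariant there.\<close>

lemma restrict_ergodic: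
  assumes inv: "invariant_borel_measure K A \<nu>" and erg: "ergodic (FC K A) \<nu>"
  shows "ergodic (FC K B) (restrict_space \<nu> (path_space K B))"
proof (rule ergodicI)
  note R = sets_restrict_B[OF inv_sets[OF inv]]
  show "sets (restrict_space \<nu> (path_space K B)) = sets (path_borel K B)" by (rule R)
  fix E assume "E \<in> sets (path_borel K B)" and satE: "saturation K B E \<subseteq> E"
  then have E: "E \<in> sets (path_borel K A)" "E \<subseteq> path_space K B" unfolding sets_B by auto
  have EA: "E \<subseteq> path_space K A" using E(2) path_space_sub by blast
  have S: "saturation K A E \<in> sets (path_borel K A)" by (rule saturation_sets[OF fin E(1)])
  have "emeasure \<nu> (saturation K A E) = 0 \<or> emeasure \<nu> (path_space K A - saturation K A E) = 0"
    by (rule ergodicD[OF erg inv_sets[OF inv] S saturation_idem])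
  then show "emeasure (restrict_space \<nu> (path_space K B)) E = 0 \<or>
      emeasure (restrict_space \<nu> (path_space K B)) (path_space K B - E) = 0"
  proof
    assume "emeasure \<nu> (saturation K A E) = 0"
    then have "emeasure \<nu> E = 0"
      by (rule null_subset[OF inv_sets[OF inv] S _ subset_saturation[OF EA]])
    then show ?thesis using R(3)[OF E(2)] by simp
  next
    assume n: "emeasure \<nu> (path_space K A - saturation K A E) = 0"
    have "path_space K B - E \<subseteq> path_space K A - saturation K A E"
      using saturation_B[OF E(2)] satE path_space_sub by blast
    then have "emeasure \<nu> (path_space K B - E) = 0"
      by (rule null_subset[OF inv_sets[OF inv] sets.Diff[OF path_space_in_sets S] n])
    then show ?thesis using R(3)[of "path_space K B - E"] by auto
  qed
qed

lemma extension_unique: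
  assumes inv: "invariant_borel_measure K A \<mu>" "invariant_borel_measure K A \<nu>"
    and eq: "restrict_space \<mu> (path_space K B) = restrict_space \<nu> (path_space K B)"
    and null: "emeasure \<mu> (path_space K A - FC_orbit K A (path_space K B)) = 0"
      "emeasure \<nu> (path_space K A - FC_orbit K A (path_space K B)) = 0"
  shows "\<mu> = \<nu>"
proof (rule invariant_eqI_saturation[OF fin inv path_space_B_sets])
  show "emeasure \<mu> (path_space K A - saturation K A (path_space K B)) = 0"
    "emeasure \<nu> (path_space K A - saturation K A (path_space K B)) = 0"
    using null unfolding FC_orbit_eq_saturation[OF path_space_sub] .
  show "emeasure \<mu> E = emeasure \<nu> E" if "E \<subseteq> path_space K B" for E
    using sets_restrict_B(3)[OF inv_sets[OF inv(1)] that] sets_restrict_B(3)[OF inv_sets[OF inv(2)] that] eq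
    by metis
qed

lemma invariant_extension_eqI:
  assumes "invariant_borel_measure K A \<nu>"
    and "emeasure \<nu> (path_space K A - FC_orbit K A (path_space K B)) = 0"
  shows "invariant_extension K A B (restrict_space \<nu> (path_space K B)) = \<nu>"
  unfolding invariant_extension_def
  by (rule the_equality) (use assms extension_unique in auto)

text \<open>The orbit of the smaller path space is partitioned into pieces \<open>D n\<close>, each carried into the smaller
  path space by an involution \<open>s n\<close>, and the extension is defined by transporting the pieces.  An element \<open>g\<close>
  splits a set further, according to the piece \<open>D i\<close> in which a point lies and the piece \<open>D j\<close> in which
  its image lies.  The two transported copies of such a part differ by an element of the larger group acting
  between subsets of the smaller path space, so they have equal measure.\<close>

lemma extension_exists:
  assumes inv: "invariant_borel_measure K B \<mu>"
  shows "\<exists>\<nu>. invariant_borel_measure K A \<nu> \<and> restrict_space \<nu> (path_space K B) = \<mu> \<and>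
    emeasure \<nu> (path_space K A - FC_orbit K A (path_space K B)) = 0"
proof -
  obtain s D where s: "\<And>n::nat. s n \<in> FC K A" and D: "\<And>n. D n \<in> sets (path_borel K A)" "disjoint_family D"
    "(\<Union>n. D n) = saturation K A (path_space K B)" "\<And>n. s n ` D n \<subseteq> path_space K B"
    and ss: "\<And>n x. x \<in> path_space K A \<Longrightarrow> s n (s n x) = x"
    by (rule saturation_partition[OF fin path_space_B_sets]) blast
  have setsD: "E \<inter> D n \<in> sets (path_borel K A)" if "E \<in> sets (path_borel K A)" for E n
    using that D(1) by blast
  have sD: "s n ` (E \<inter> D n) \<in> sets (path_borel K A)" "s n ` (E \<inter> D n) \<subseteq> path_space K B"
    "s n ` (E \<inter> D n) \<in> sets \<mu>"
    if "E \<in> sets (path_borel K A)" for E n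
  proof -
    show a: "s n ` (E \<inter> D n) \<in> sets (path_borel K A)" by (rule FC_image_sets[OF s setsD[OF that]])
    show b: "s n ` (E \<inter> D n) \<subseteq> path_space K B" using D(4)[of n] by blast
    show "s n ` (E \<inter> D n) \<in> sets \<mu>" using a b unfolding inv_sets[OF inv] sets_B by simp
  qed
  define m where "m E = (\<Sum>n. emeasure \<mu> (s n ` (E \<inter> D n)))" for E
  define \<nu> where "\<nu> = measure_of (path_space K A) (sets (path_borel K A)) m"
  have sets: "sets \<nu> = sets (path_borel K A)"
    unfolding \<nu>_def using sets.sets_measure_of_eq[of "path_borel K A"] by simp
  have ca: "countably_additive (sets \<nu>) m"
    unfolding countably_additive_def sets
  proof (intro allI impI)
    fix E :: "nat \<Rightarrow> 'v path set"
    assume E: "range E \<subseteq> sets (path_borel K A)" "disjoint_family E"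
    then have Ei: "E i \<in> sets (path_borel K A)" for i by blast
    have "(\<Sum>i. emeasure \<mu> (s n ` (E i \<inter> D n))) = emeasure \<mu> (s n ` ((\<Union>i. E i) \<inter> D n))" for n
    proof -
      have "disjoint_family (\<lambda>i. s n ` (E i \<inter> D n))"
        unfolding disjoint_family_on_def
      proof (intro ballI impI)
        fix i j :: nat assume "i \<noteq> j"
        then have "(E i \<inter> D n) \<inter> (E j \<inter> D n) = {}" using E(2) unfolding disjoint_family_on_def by blast
        then show "s n ` (E i \<inter> D n) \<inter> s n ` (E j \<inter> D n) = {}"
          using inj_on_image_Int[OF FC_inj[OF s[of n]], of "E i \<inter> D n" "E j \<inter> D n"]
            Borel_subset[OF setsD[OF Ei]] by simp
      qed
      then have "(\<Sum>i. emeasure \<mu> (s n ` (E i \<inter> D n))) = emeasure \<mu> (\<Union>i. s n ` (E i \<inter> D n))"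
        using sD(3)[OF Ei] by (intro suminf_emeasure) auto
      also have "(\<Union>i. s n ` (E i \<inter> D n)) = s n ` ((\<Union>i. E i) \<inter> D n)" by blast
      finally show ?thesis .
    qed
    then show "(\<Sum>i. m (E i)) = m (\<Union> (range E))"
      unfolding m_def by (subst suminf_swap_ennreal) simp
  qed
  have em: "emeasure \<nu> E = m E" if "E \<in> sets (path_borel K A)" for E
  proof (rule emeasure_measure_of[OF \<nu>_def])
    show "sets (path_borel K A) \<subseteq> Pow (path_space K A)" using Borel_subset by blast
    show "positive (sets \<nu>) m" by (simp add: positive_def m_def)
  qed (use ca that sets in auto)
  have inj: "s n ` X \<inter> s n ` Y = s n ` (X \<inter> Y)" if "X \<subseteq> path_space K A" "Y \<subseteq> path_space K A" for n X Y
    using inj_on_image_Int[OF FC_inj[OF s] that] by simp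
  have invn: "emeasure \<nu> (g ` E) = emeasure \<nu> E" if g: "g \<in> FC K A" and E: "E \<in> sets (path_borel K A)" for g E
  proof -
    have Esub: "E \<subseteq> path_space K A" by (rule Borel_subset[OF E])
    have gE: "g ` E \<in> sets (path_borel K A)" by (rule FC_image_sets[OF g E])
    \<comment> \<open>the points of E in the i-th piece whose image lies in the j-th piece\<close>
    define F where "F i j = E \<inter> D i \<inter> {x \<in> path_space K A. g x \<in> D j}" for i j
    have "{x \<in> path_space K A. g x \<in> D j} \<in> sets (path_borel K A)" for j
      using measurable_sets[OF FC_measurable[OF g] D(1)[of j]] by (simp add: vimage_def Int_def conj_commute)
    then have F: "F i j \<in> sets (path_borel K A)" for i j using E D(1) unfolding F_def by blast
    note gsat = FC_saturation_iff[OF g, of _ "path_space K B"]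
    have left: "emeasure \<mu> (s j ` (g ` E \<inter> D j)) = (\<Sum>i. emeasure \<mu> (s j ` (g ` F i j)))" for j
    proof -
      have "disjoint_family (\<lambda>i. s j ` (g ` F i j))"
        unfolding disjoint_family_on_def
      proof (intro ballI impI)
        fix i k :: nat assume "i \<noteq> k"
        then have dj: "F i j \<inter> F k j = {}" using D(2) unfolding disjoint_family_on_def F_def by blast
        have Fs: "F i j \<subseteq> path_space K A" "F k j \<subseteq> path_space K A" using Esub unfolding F_def by auto
        have "g ` F i j \<inter> g ` F k j = {}"
          using inj_on_image_Int[OF FC_inj[OF g] Fs] dj by simp
        moreover have "g ` F i j \<subseteq> path_space K A" "g ` F k j \<subseteq> path_space K A"
          using Fs FC_in[OF g] by auto
        ultimately show "s j ` g ` F i j \<inter> s j ` g ` F k j = {}" using inj by simp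
      qed
      moreover have "s j ` (g ` F i j) \<in> sets \<mu>" for i
      proof -
        have "g ` F i j = g ` F i j \<inter> D j" unfolding F_def by blast
        then show ?thesis using sD(3)[OF FC_image_sets[OF g F[of i j]], of j] by metis
      qed
      ultimately have "(\<Sum>i. emeasure \<mu> (s j ` (g ` F i j))) = emeasure \<mu> (\<Union>i. s j ` (g ` F i j))"
        by (intro suminf_emeasure) auto
      also have "(\<Union>i. s j ` (g ` F i j)) = s j ` (\<Union>i. g ` F i j)" by blast
      also have "(\<Union>i. g ` F i j) = g ` E \<inter> D j"
      proof (intro equalityI subsetI)
        fix y assume "y \<in> g ` E \<inter> D j"
        then obtain x where x: "x \<in> E" "y = g x" "g x \<in> D j" by blast
        then have "x \<in> saturation K A (path_space K B)" using gsat[of x] D(3) Esub by blast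
        then obtain i where "x \<in> D i" using D(3) by blast
        then have "x \<in> F i j" using x Esub unfolding F_def by blast
        then show "y \<in> (\<Union>i. g ` F i j)" using x(2) by blast
      qed (auto simp: F_def)
      finally show ?thesis ..
    qed
    have right: "emeasure \<mu> (s i ` (E \<inter> D i)) = (\<Sum>j. emeasure \<mu> (s i ` F i j))" for i
    proof -
      have "disjoint_family (\<lambda>j. s i ` F i j)"
        unfolding disjoint_family_on_def
      proof (intro ballI impI)
        fix j k :: nat assume "j \<noteq> k"
        then have dj: "F i j \<inter> F i k = {}" using D(2) unfolding disjoint_family_on_def F_def by blast
        have "F i j \<subseteq> path_space K A" "F i k \<subseteq> path_space K A" using Esub unfolding F_def by auto
        then show "s i ` F i j \<inter> s i ` F i k = {}" using inj dj by simp
      qed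
      moreover have "s i ` F i j \<in> sets \<mu>" for j
      proof -
        have "F i j = F i j \<inter> D i" unfolding F_def by blast
        then show ?thesis using sD(3)[OF F[of i j], of i] by metis
      qed
      ultimately have "(\<Sum>j. emeasure \<mu> (s i ` F i j)) = emeasure \<mu> (\<Union>j. s i ` F i j)"
        by (intro suminf_emeasure) auto
      also have "(\<Union>j. s i ` F i j) = s i ` (\<Union>j. F i j)" by blast
      also have "(\<Union>j. F i j) = E \<inter> D i"
      proof (intro equalityI subsetI)
        fix x assume x: "x \<in> E \<inter> D i"
        then have "g x \<in> saturation K A (path_space K B)" using gsat[of x] D(3) Esub by blast
        then obtain j where "g x \<in> D j" using D(3) by blast
        then show "x \<in> (\<Union>j. F i j)" using x Esub unfolding F_def by blast
      qed (auto simp: F_def)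
      finally show ?thesis ..
    qed
    have move: "emeasure \<mu> (s j ` (g ` F i j)) = emeasure \<mu> (s i ` F i j)" for i j
    proof -
      \<comment> \<open>from the i-th transported copy back to the orbit, along g, and into the j-th transported copy; s i is its own inverse\<close>
      define h where "h = compose (path_space K A) (s j) (compose (path_space K A) g (s i))"
      have h: "h \<in> FC K A" unfolding h_def by (intro FC_compose s g)
      have Fi: "F i j \<subseteq> path_space K A" using Esub unfolding F_def by blast
      have hx: "h (s i x) = s j (g x)" if "x \<in> F i j" for x
        using that Fi ss[of x i] FC_in[OF s, of x i] unfolding h_def compose_def by auto
      have img: "h ` (s i ` F i j) = s j ` (g ` F i j)"
        unfolding image_image by (rule image_cong[OF refl hx])
      have Feq: "F i j = F i j \<inter> D i" unfolding F_def by blast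
      have a: "s i ` F i j \<in> sets (path_borel K A)" "s i ` F i j \<subseteq> path_space K B"
        using sD(1,2)[OF F[of i j], of i] Feq by metis+
      have "h ` (s i ` F i j) \<subseteq> path_space K B"
        unfolding img using D(4)[of j] unfolding F_def by blast
      from transfer_invariant[OF inv h a this] show ?thesis unfolding img .
    qed
    show ?thesis
      unfolding em[OF gE] em[OF E] m_def left right move by (rule suminf_swap_ennreal)
  qed
  have invnu: "invariant_borel_measure K A \<nu>"
    unfolding invariant_borel_measure_def using sets invn by simp
  note R = sets_restrict_B[OF sets]
  have "restrict_space \<nu> (path_space K B) = \<mu>"
  proof (rule measure_eqI)
    show "sets (restrict_space \<nu> (path_space K B)) = sets \<mu>" unfolding R inv_sets[OF inv] ..
    fix E assume E0: "E \<in> sets (restrict_space \<nu> (path_space K B))"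
    then have E: "E \<in> sets (path_borel K A)" "E \<subseteq> path_space K B" unfolding R sets_B by auto
    have "emeasure \<mu> (s n ` (E \<inter> D n)) = emeasure \<mu> (E \<inter> D n)" for n
      by (rule transfer_invariant[OF inv s setsD[OF E(1)] _ sD(2)[OF E(1)]]) (use E(2) in blast)
    then have "m E = (\<Sum>n. emeasure \<mu> (E \<inter> D n))" unfolding m_def by simp
    also have "\<dots> = (\<Sum>n. emeasure \<mu> (E \<inter> (D n \<inter> path_space K B)))"
      using E(2) by (simp add: Int_absorb2 Int_assoc[symmetric] le_infI1)
    also have "\<dots> = emeasure \<mu> E"
    proof (rule emeasure_split_UN[symmetric])
      show "E \<in> sets \<mu>" using E0 unfolding R inv_sets[OF inv] .
      show "D n \<inter> path_space K B \<in> sets \<mu>" for n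
        using D(1)[of n] path_space_B_sets unfolding inv_sets[OF inv] sets_B by auto
      show "disjoint_family (\<lambda>n. D n \<inter> path_space K B)"
        using D(2) unfolding disjoint_family_on_def by blast
      show "E \<subseteq> (\<Union>n. D n \<inter> path_space K B)"
        using D(3) E(2) subset_saturation[OF path_space_sub] by blast
    qed
    finally show "emeasure (restrict_space \<nu> (path_space K B)) E = emeasure \<mu> E"
      unfolding R(3)[OF E(2)] em[OF E(1)] .
  qed
  moreover have "emeasure \<nu> (path_space K A - saturation K A (path_space K B)) = 0"
  proof -
    have "path_space K A - saturation K A (path_space K B) \<in> sets (path_borel K A)"
      by (intro sets.Diff saturation_sets fin path_space_B_sets path_space_in_sets)
    moreover have "(path_space K A - saturation K A (path_space K B)) \<inter> D n = {}" for n
      using D(3) by blast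
    ultimately show ?thesis using em unfolding m_def by simp
  qed
  ultimately show ?thesis
    using invnu FC_orbit_eq_saturation[OF path_space_sub] by metis
qed

text \<open>An invariant set that is null in the smaller path space is null in the orbit of that space, and the
  complement of the orbit is null; this is applied to an invariant set and to its complement.\<close>

lemma extension_ergodic:
  assumes inv: "invariant_borel_measure K A \<nu>"
    and erg: "ergodic (FC K B) (restrict_space \<nu> (path_space K B))"
    and null: "emeasure \<nu> (path_space K A - FC_orbit K A (path_space K B)) = 0"
  shows "ergodic (FC K A) \<nu>"
proof (rule ergodicI[OF inv_sets[OF inv]])
  note R = sets_restrict_B[OF inv_sets[OF inv]]
  fix E assume E: "E \<in> sets (path_borel K A)" and satE: "saturation K A E \<subseteq> E"
  have small: "emeasure \<nu> F = 0"
    if F: "F \<in> sets (path_borel K A)" "saturation K A F \<subseteq> F" "emeasure \<nu> (F \<inter> path_space K B) = 0" for F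
  proof -
    have FB: "F \<inter> path_space K B \<in> sets (path_borel K A)" using F(1) path_space_B_sets by blast
    have sB: "saturation K A (path_space K B) \<in> sets (path_borel K A)"
      by (rule saturation_sets[OF fin path_space_B_sets])
    have cover: "F \<subseteq> saturation K A (F \<inter> path_space K B) \<union> (path_space K A - saturation K A (path_space K B))"
    proof
      fix x assume x: "x \<in> F"
      have xA: "x \<in> path_space K A" using x Borel_subset[OF F(1)] by blast
      show "x \<in> saturation K A (F \<inter> path_space K B) \<union> (path_space K A - saturation K A (path_space K B))"
      proof (cases "x \<in> saturation K A (path_space K B)")
        case True
        then obtain y n where y: "y \<in> path_space K B" "\<forall>i>n. y i = x i" by (rule saturationE)
        have "y \<in> saturation K A F"
          by (rule saturationI[OF _ x, where n = n]) (use y path_space_sub in auto)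
        then have "y \<in> F \<inter> path_space K B" using F(2) y(1) by blast
        then have "x \<in> saturation K A (F \<inter> path_space K B)"
          by (rule saturationI[OF xA, where n = n]) (use y(2) in simp)
        then show ?thesis ..
      qed (use xA in blast)
    qed
    have sets: "saturation K A (F \<inter> path_space K B) \<in> sets \<nu>"
      "path_space K A - saturation K A (path_space K B) \<in> sets \<nu>"
      unfolding inv_sets[OF inv]
      by (rule saturation_sets[OF fin FB], rule sets.Diff[OF path_space_in_sets sB])
    have "emeasure \<nu> (saturation K A (F \<inter> path_space K B)) = 0"
      by (rule null_saturation[OF fin inv FB F(3)])
    moreover have "emeasure \<nu> (path_space K A - saturation K A (path_space K B)) = 0"
      using null unfolding FC_orbit_eq_saturation[OF path_space_sub] .
    ultimately have z: "emeasure \<nu> (saturation K A (F \<inter> path_space K B) \<union>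
        (path_space K A - saturation K A (path_space K B))) = 0"
      using emeasure_subadditive[OF sets] by simp
    show ?thesis
      by (rule emeasure_eq_0[OF sets.Un[OF sets] z cover])
  qed
  have EB: "E \<inter> path_space K B \<in> sets (path_borel K B)"
    using E path_space_B_sets unfolding sets_B by auto
  have "saturation K B (E \<inter> path_space K B) \<subseteq> E \<inter> path_space K B"
    using satE saturation_mono[of "E \<inter> path_space K B" E K A] unfolding saturation_B[OF Int_lower2] by blast
  then have "emeasure (restrict_space \<nu> (path_space K B)) (E \<inter> path_space K B) = 0 \<or>
    emeasure (restrict_space \<nu> (path_space K B)) (path_space K B - (E \<inter> path_space K B)) = 0"
    by (rule ergodicD[OF erg R(1) EB])
  then have "emeasure \<nu> (E \<inter> path_space K B) = 0 \<or> emeasure \<nu> (path_space K B - (E \<inter> path_space K B)) = 0"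
    using R(3)[of "E \<inter> path_space K B"] R(3)[of "path_space K B - (E \<inter> path_space K B)"] by auto
  then show "emeasure \<nu> E = 0 \<or> emeasure \<nu> (path_space K A - E) = 0"
  proof
    assume "emeasure \<nu> (E \<inter> path_space K B) = 0"
    then show ?thesis using small[OF E satE] by blast
  next
    assume a: "emeasure \<nu> (path_space K B - (E \<inter> path_space K B)) = 0"
    have "(path_space K A - E) \<inter> path_space K B = path_space K B - (E \<inter> path_space K B)"
      using path_space_sub by blast
    moreover have "saturation K A (path_space K A - E) \<subseteq> path_space K A - E"
    proof
      fix y assume y: "y \<in> saturation K A (path_space K A - E)"
      then obtain x n where x': "x \<in> path_space K A - E" "\<forall>i>n. x i = y i"
        by (rule saturationE)
      have x: "x \<in> path_space K A" "x \<notin> E" "y \<in> path_space K A"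
        using x'(1) y saturation_subset by auto
      have "y \<notin> E"
      proof
        assume "y \<in> E"
        then have "x \<in> saturation K A E"
          by (rule saturationI[OF x(1), where n = n]) (simp add: x'(2))
        then show False using satE x(2) by blast
      qed
      then show "y \<in> path_space K A - E" using x(3) by blast
    qed
    ultimately show ?thesis
      using small[OF sets.Diff[OF path_space_in_sets E]] a by simp
  qed
qed

end

section \<open>Conservativity\<close>

lemma eventually_separated:
  assumes "x \<noteq> y"
  shows "\<exists>m. \<forall>n\<ge>m. y \<notin> cylinder K A n x"
proof -
  obtain i where "x i \<noteq> y i" using assms by (metis ext)
  then have "y \<notin> cylinder K A n x" if "i \<le> n" for n
    using that unfolding cylinder_def by fastforce
  then show ?thesis by blast
qed

text \<open>Rewriting a sufficiently long prefix moves one point to another of its orbit and leaves a third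
  point alone.\<close>

lemma swap_fixing:
  assumes y: "y \<in> path_space K A" "z \<in> path_space K A" "\<forall>i>n. y i = z i" and x: "x \<noteq> y" "x \<noteq> z"
  obtains s where "s \<in> FC K A" "s y = z" "x \<in> path_space K A \<Longrightarrow> s x = x"
proof -
  obtain m1 where m1: "\<forall>n\<ge>m1. x \<notin> cylinder K A n y" using eventually_separated[of y x K A] x by blast
  obtain m2 where m2: "\<forall>n\<ge>m2. x \<notin> cylinder K A n z" using eventually_separated[of z x K A] x by blast
  define N where "N = max n (max m1 m2)"
  have N: "y i = z i" if "N < i" for i using that y(3) unfolding N_def by simp
  have "x \<notin> cylinder K A N y" "x \<notin> cylinder K A N z" using m1 m2 unfolding N_def by simp_all
  then have "cyl_swap K A N y z x = x" if "x \<in> path_space K A" using that by (simp add: cyl_swap_def)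
  then show ?thesis
    using that[of "cyl_swap K A N y z"] swaps_FC swap_path[OF y(1,2) N] by metis
qed

text \<open>In an infinite group of this kind two distinct elements agree at any given path: if the orbit of the
  path is finite, by the pigeonhole principle; otherwise the identity and the interchange of two other points of
  the orbit.  Hence a set with pairwise disjoint images under distinct elements is empty, and conservativity
  in the indexed sense is automatic.\<close>

lemma conservative_FC:
  assumes sets: "sets \<mu> = sets (path_borel K A)"
  shows "conservative (FC K A) \<mu>"
  unfolding conservative_def
proof (intro allI impI)
  fix E assume w: "wandering (FC K A) \<mu> E"
  then have E: "E \<in> sets (path_borel K A)" and inf: "infinite (FC K A)"
    and dis: "disjoint_family_on (\<lambda>\<gamma>. \<gamma> ` E) (FC K A)" using sets unfolding wandering_def by auto
  have "x \<notin> E" for x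
  proof
    assume xE: "x \<in> E"
    then have x: "x \<in> path_space K A" using Borel_subset[OF E] by blast
    have "\<exists>g\<in>FC K A. \<exists>h\<in>FC K A. g \<noteq> h \<and> g x = h x"
    proof (cases "finite (saturation K A {x})")
      case True
      have "(\<lambda>g. g x) ` FC K A \<subseteq> saturation K A {x}"
        using FC_orbit_eq_saturation[of "{x}" K A] x unfolding FC_orbit_def by auto
      then have "\<not> inj_on (\<lambda>g. g x) (FC K A)"
        using True inf by (meson finite_imageD finite_subset)
      then show ?thesis unfolding inj_on_def by blast
    next
      case False
      then have "infinite (saturation K A {x} - {x})" by simp
      then obtain y where y: "y \<in> saturation K A {x} - {x}" using infinite_imp_nonempty by blast
      have "infinite (saturation K A {x} - {x} - {y})" using \<open>infinite (saturation K A {x} - {x})\<close> by simp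
      then obtain z where z: "z \<in> saturation K A {x} - {x} - {y}" using infinite_imp_nonempty by blast
      obtain n where n: "\<forall>i>n. x i = y i" using y by (elim DiffE saturationE) simp
      obtain m where m: "\<forall>i>m. x i = z i" using z by (elim DiffE saturationE) simp
      have yz: "y \<in> path_space K A" "z \<in> path_space K A" using y z saturation_subset by blast+
      have "\<forall>i>max n m. y i = z i"
      proof (intro allI impI)
        fix i assume "max n m < i"
        then have "n < i" "m < i" by simp_all
        then have "x i = y i" "x i = z i" using n[rule_format, of i] m[rule_format, of i] by blast+
        then show "y i = z i" by (rule trans[OF sym])
      qed
      then obtain s where s: "s \<in> FC K A" "s y = z" "s x = x"
        using swap_fixing[OF yz, of "max n m" x] x y z by (metis Diff_iff singletonI)
      have "(\<lambda>x\<in>path_space K A. x) \<noteq> s"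
      proof
        assume "(\<lambda>x\<in>path_space K A. x) = s"
        then have "s y = y" using yz(1) by (metis restrict_apply')
        then show False using s(2) z by simp
      qed
      then show ?thesis using FC_id s(1,3) x by (metis restrict_apply')
    qed
    then obtain g h where "g \<in> FC K A" "h \<in> FC K A" "g \<noteq> h" "g x = h x" by blast
    then have "g x \<in> g ` E \<inter> h ` E" using xE by (metis IntI imageI)
    then show False using dis \<open>g \<in> FC K A\<close> \<open>h \<in> FC K A\<close> \<open>g \<noteq> h\<close> unfolding disjoint_family_on_def by blast
  qed
  then have "E = {}" by blast
  then show "emeasure \<mu> E = 0" by simp
qed

text \<open>Suppose the images of a set coincide or are disjoint and it has two distinct points.  A point of the set
  can be interchanged with any point of its orbit outside the set by an element fixing another point of
  the set; that image meets the set, so it equals the set.  The set is then invariant and has a single image.\<close>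

lemma wandering_images_singleton:
  assumes sets: "sets \<mu> = sets (path_borel K A)" and w: "wandering_images (FC K A) \<mu> E"
  obtains x where "x \<in> path_space K A" "E = {x}" "infinite (saturation K A {x})"
proof -
  have E: "E \<in> sets (path_borel K A)" and inf: "infinite ((\<lambda>g. g ` E) ` FC K A)"
    and dis: "disjoint ((\<lambda>g. g ` E) ` FC K A)" using w sets unfolding wandering_images_def by auto
  have Es: "E \<subseteq> path_space K A" by (rule Borel_subset[OF E])
  have "E \<noteq> {}"
  proof
    assume "E = {}"
    then have "(\<lambda>g. g ` E) ` FC K A \<subseteq> {{}}" by blast
    then show False using inf finite_subset by blast
  qed
  then obtain x where x: "x \<in> E" by blast
  have "y = x" if yE: "y \<in> E" for y
  proof (rule ccontr)
    assume yx: "y \<noteq> x"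
    have "saturation K A E \<subseteq> E"
    proof
      fix z assume z: "z \<in> saturation K A E"
      then obtain u n where u: "u \<in> E" "\<forall>i>n. u i = z i" by (rule saturationE)
      have zs: "z \<in> path_space K A" using z saturation_subset by blast
      obtain v where v: "v \<in> E" "v \<noteq> u" using x yE yx by metis
      show "z \<in> E"
      proof (cases "v = z")
        case False
        obtain s where s: "s \<in> FC K A" "s u = z" "s v = v"
          using swap_fixing[OF _ zs u(2) v(2) False] u(1) v(1) Es by (metis subsetD)
        have idE: "(\<lambda>x\<in>path_space K A. x) ` E = E" using Es by (auto simp: image_def)
        have "E \<in> (\<lambda>g. g ` E) ` FC K A" using image_eqI[of E "\<lambda>g. g ` E", OF idE[symmetric] FC_id] .
        moreover have "s ` E \<in> (\<lambda>g. g ` E) ` FC K A" using s(1) by blast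
        moreover have "v \<in> s ` E \<inter> E" using s(3) v(1) by (metis IntI imageI)
        ultimately have "s ` E = E" using dis unfolding disjoint_def by blast
        then show ?thesis using s(2) u(1) by (metis imageI)
      qed (use v in simp)
    qed
    then have "\<forall>g\<in>FC K A. g ` E = E" using FC_invariant_iff[OF Es] by blast
    then have "(\<lambda>g. g ` E) ` FC K A \<subseteq> {E}" by blast
    then show False using inf finite_subset by blast
  qed
  then have Ex: "E = {x}" using x by blast
  have "infinite (saturation K A {x})"
  proof
    assume fin: "finite (saturation K A {x})"
    have "(\<lambda>g. g ` E) ` FC K A \<subseteq> (\<lambda>y. {y}) ` saturation K A {x}"
      using FC_orbit_eq_saturation[of "{x}" K A] x Es unfolding FC_orbit_def Ex by auto
    then show False using inf fin finite_surj by blast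
  qed
  then show ?thesis using that Ex x Es by blast
qed

lemma conservative_images_iff:
  assumes sets: "sets \<mu> = sets (path_borel K A)"
  shows "conservative_images (FC K A) \<mu> \<longleftrightarrow>
    (\<forall>x\<in>path_space K A. infinite (saturation K A {x}) \<longrightarrow> emeasure \<mu> {x} = 0)"
proof
  assume c: "conservative_images (FC K A) \<mu>"
  show "\<forall>x\<in>path_space K A. infinite (saturation K A {x}) \<longrightarrow> emeasure \<mu> {x} = 0"
  proof (intro ballI impI)
    fix x assume x: "x \<in> path_space K A" "infinite (saturation K A {x})"
    have "(\<lambda>g. g ` {x}) ` FC K A = (\<lambda>y. {y}) ` saturation K A {x}"
      using FC_orbit_eq_saturation[of "{x}" K A] x(1) unfolding FC_orbit_def by auto
    moreover have "infinite ((\<lambda>y. {y}) ` saturation K A {x})"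
      using x(2) finite_imageD[of "\<lambda>y. {y}" "saturation K A {x}"] by auto
    moreover have "disjoint ((\<lambda>y. {y}) ` saturation K A {x})" unfolding disjoint_def by blast
    ultimately have "wandering_images (FC K A) \<mu> {x}"
      unfolding wandering_images_def using sets singleton_sets[OF x(1)] by simp
    then show "emeasure \<mu> {x} = 0" using c unfolding conservative_images_def by blast
  qed
next
  assume "\<forall>x\<in>path_space K A. infinite (saturation K A {x}) \<longrightarrow> emeasure \<mu> {x} = 0"
  then show "conservative_images (FC K A) \<mu>"
    unfolding conservative_images_def using wandering_images_singleton[OF sets] by metis
qed

context subsystem
begin

lemma conservative_images_restrict:
  assumes inv: "invariant_borel_measure K A \<nu>" and c: "conservative_images (FC K A) \<nu>"
  shows "conservative_images (FC K B) (restrict_space \<nu> (path_space K B))"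
proof -
  note R = sets_restrict_B[OF inv_sets[OF inv]]
  show ?thesis unfolding conservative_images_iff[OF R(1)]
  proof (intro ballI impI)
    fix x assume x: "x \<in> path_space K B" "infinite (saturation K B {x})"
    have "saturation K B {x} \<subseteq> saturation K A {x}" using saturation_B[of "{x}"] x(1) by blast
    then have "infinite (saturation K A {x})" using x(2) finite_subset by blast
    then have "emeasure \<nu> {x} = 0"
      using c x(1) path_space_sub unfolding conservative_images_iff[OF inv_sets[OF inv]] by blast
    then show "emeasure (restrict_space \<nu> (path_space K B)) {x} = 0" using R(3)[of "{x}"] x(1) by simp
  qed
qed

text \<open>An atom of the larger space lies on the orbit of the smaller path space, so it is moved to an atom
  there, whose orbit is infinite.\<close>

lemma conservative_images_extension:
  assumes inv: "invariant_borel_measure K A \<nu>"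
    and null: "emeasure \<nu> (path_space K A - FC_orbit K A (path_space K B)) = 0"
    and c: "conservative_images (FC K B) (restrict_space \<nu> (path_space K B))"
    and orb: "\<And>x. x \<in> path_space K B \<Longrightarrow> infinite (saturation K B {x})"
  shows "conservative_images (FC K A) \<nu>"
  unfolding conservative_images_iff[OF inv_sets[OF inv]]
proof (intro ballI impI)
  note R = sets_restrict_B[OF inv_sets[OF inv]]
  fix x assume x: "x \<in> path_space K A"
  show "emeasure \<nu> {x} = 0"
  proof (cases "x \<in> saturation K A (path_space K B)")
    case True
    then obtain y n where y: "y \<in> path_space K B" "\<forall>i>n. y i = x i" by (rule saturationE)
    have "emeasure (restrict_space \<nu> (path_space K B)) {y} = 0"
      using c y(1) orb unfolding conservative_images_iff[OF R(1)] by blast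
    then have z: "emeasure \<nu> {y} = 0" using R(3)[of "{y}"] y(1) by simp
    have yA: "y \<in> path_space K A" using y(1) path_space_sub by blast
    have s: "cyl_swap K A n y x \<in> swaps K A" "cyl_swap K A n y x y = x"
      by (rule swap_path[OF yA x], use y(2) in simp)+
    have "cyl_swap K A n y x ` {y} = {x}" using s(2) by simp
    then show ?thesis using inv_image[OF inv swaps_FC[OF s(1)] singleton_sets[OF yA]] z by simp
  next
    case False
    have "{x} \<subseteq> path_space K A - saturation K A (path_space K B)" using False x by blast
    then show ?thesis
      using null_subset[OF inv_sets[OF inv] _ null[unfolded FC_orbit_eq_saturation[OF path_space_sub]]]
        sets.Diff[OF path_space_in_sets saturation_sets[OF fin path_space_B_sets]] by blast
  qed
qed

end

section \<open>Cylinders and invariant measures\<close>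

lemma word_snoc:
  assumes "word K A n e" "g \<in> edges K A (Suc n)" "src g = tgt (e n)"
  shows "word K A (Suc n) (e(Suc n := g))"
  using assms unfolding word_def by (auto simp: le_Suc_eq less_Suc_eq)

lemma cylinder_snoc:
  "cylinder K A (Suc n) (e(Suc n := g)) = {x \<in> cylinder K A n e. x (Suc n) = g}"
  unfolding cylinder_def by (auto simp: le_Suc_eq)

definition out_edges :: "'v matseq \<Rightarrow> 'v alphabets \<Rightarrow> nat \<Rightarrow> 'v \<Rightarrow> 'v edge set" where
  "out_edges K A i a = {g \<in> edges K A i. src g = a}"

lemma out_edgesD: "g \<in> out_edges K A i a \<Longrightarrow> g \<in> edges K A i" "g \<in> out_edges K A i a \<Longrightarrow> src g = a"
  by (simp_all add: out_edges_def)

lemma finite_out_edges: "(\<And>i. finite (A i)) \<Longrightarrow> finite (out_edges K A i a)"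
  unfolding out_edges_def using finite_edges[of A K i] by simp

lemma sum_out_edges:
  fixes f :: "'v \<Rightarrow> 'b::comm_semiring_1"
  assumes fin: "\<And>i. finite (A i)" and a: "a \<in> A i"
  shows "(\<Sum>g\<in>out_edges K A i a. f (tgt g)) = (\<Sum>b\<in>A (Suc i). of_nat (K i a b) * f b)"
proof -
  have "out_edges K A i a = (\<lambda>(b, j). (a, b, j)) ` (SIGMA b:A (Suc i). {..<K i a b})"
    using a by (auto simp: out_edges_def edges_def src_def)
  moreover have "inj_on (\<lambda>(b, j). (a, b, j)) (SIGMA b:A (Suc i). {..<K i a b})"
    by (auto simp: inj_on_def)
  ultimately have "(\<Sum>g\<in>out_edges K A i a. f (tgt g)) = (\<Sum>(b, j)\<in>(SIGMA b:A (Suc i). {..<K i a b}). f b)"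
    by (simp add: sum.reindex tgt_def case_prod_beta)
  also have "\<dots> = (\<Sum>b\<in>A (Suc i). \<Sum>j<K i a b. f b)"
    using fin by (subst sum.Sigma) simp_all
  finally show ?thesis by simp
qed

lemma cylinder_split:
  "cylinder K A n e = (\<Union>g\<in>out_edges K A (Suc n) (tgt (e n)). cylinder K A (Suc n) (e(Suc n := g)))"
proof (intro equalityI subsetI)
  fix x assume x: "x \<in> cylinder K A n e"
  then have "x (Suc n) \<in> out_edges K A (Suc n) (tgt (e n))"
    using cylinder_tgt[OF x] unfolding out_edges_def cylinder_def path_space_def by simp
  then show "x \<in> (\<Union>g\<in>out_edges K A (Suc n) (tgt (e n)). cylinder K A (Suc n) (e(Suc n := g)))"
    using x unfolding cylinder_snoc by blast
qed (auto simp: cylinder_snoc)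

lemma emeasure_cylinder_split:
  assumes fin: "\<And>i. finite (A i)" and sets: "sets \<mu> = sets (path_borel K A)"
    and E: "E \<in> sets (path_borel K A)"
  shows "emeasure \<mu> (cylinder K A n e \<inter> E) =
    (\<Sum>g\<in>out_edges K A (Suc n) (tgt (e n)). emeasure \<mu> (cylinder K A (Suc n) (e(Suc n := g)) \<inter> E))"
proof -
  have "disjoint_family_on (\<lambda>g. cylinder K A (Suc n) (e(Suc n := g)) \<inter> E) (out_edges K A (Suc n) (tgt (e n)))"
    unfolding disjoint_family_on_def cylinder_snoc by blast
  then have "(\<Sum>g\<in>out_edges K A (Suc n) (tgt (e n)). emeasure \<mu> (cylinder K A (Suc n) (e(Suc n := g)) \<inter> E)) =
      emeasure \<mu> (\<Union>g\<in>out_edges K A (Suc n) (tgt (e n)). cylinder K A (Suc n) (e(Suc n := g)) \<inter> E)"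
    using finite_out_edges[of A K "Suc n", OF fin] sets E by (intro sum_emeasure) auto
  also have "(\<Union>g\<in>out_edges K A (Suc n) (tgt (e n)). cylinder K A (Suc n) (e(Suc n := g)) \<inter> E) =
      (\<Union>g\<in>out_edges K A (Suc n) (tgt (e n)). cylinder K A (Suc n) (e(Suc n := g))) \<inter> E"
    by blast
  also have "\<dots> = cylinder K A n e \<inter> E" by (simp only: cylinder_split[symmetric])
  finally show ?thesis ..
qed

lemma emeasure_cylinder_split_whole:
  assumes fin: "\<And>i. finite (A i)" and sets: "sets \<mu> = sets (path_borel K A)"
  shows "emeasure \<mu> (cylinder K A n e) =
    (\<Sum>g\<in>out_edges K A (Suc n) (tgt (e n)). emeasure \<mu> (cylinder K A (Suc n) (e(Suc n := g))))"
  using emeasure_cylinder_split[OF fin sets path_space_in_sets, of n e]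
  by (simp add: Int_absorb2[OF cylinder_subset])

lemma emeasure_path_space_split:
  assumes fin: "\<And>i. finite (A i)" and sets: "sets \<mu> = sets (path_borel K A)"
  shows "emeasure \<mu> (path_space K A) = (\<Sum>g\<in>edges K A 0. emeasure \<mu> (cylinder K A 0 (\<lambda>_. g)))"
proof -
  have "(\<Sum>g\<in>edges K A 0. emeasure \<mu> (cylinder K A 0 (\<lambda>_. g))) =
      emeasure \<mu> (\<Union>g\<in>edges K A 0. cylinder K A 0 (\<lambda>_. g))"
  proof (rule sum_emeasure)
    show "disjoint_family_on (\<lambda>g. cylinder K A 0 (\<lambda>_. g)) (edges K A 0)"
      unfolding disjoint_family_on_def cylinder_def by auto
    show "(\<lambda>g. cylinder K A 0 (\<lambda>_. g)) ` edges K A 0 \<subseteq> sets \<mu>"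
      unfolding sets by (intro image_subsetI cylinder_in_sets)
    show "finite (edges K A 0)" by (rule finite_edges[OF fin])
  qed
  also have "(\<Union>g\<in>edges K A 0. cylinder K A 0 (\<lambda>_. g)) = path_space K A"
  proof (intro equalityI subsetI)
    fix x assume x: "x \<in> path_space K A"
    then have "x 0 \<in> edges K A 0" "x \<in> cylinder K A 0 (\<lambda>_. x 0)"
      unfolding cylinder_def path_space_def by simp_all
    then show "x \<in> (\<Union>g\<in>edges K A 0. cylinder K A 0 (\<lambda>_. g))" by (rule UN_I)
  next
    fix x assume "x \<in> (\<Union>g\<in>edges K A 0. cylinder K A 0 (\<lambda>_. g))"
    then obtain g where "x \<in> cylinder K A 0 (\<lambda>_. g)" by (rule UN_E)
    then show "x \<in> path_space K A" by (rule subsetD[OF cylinder_subset])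
  qed
  finally show ?thesis ..
qed

lemma word_0: "g \<in> edges K A 0 \<Longrightarrow> word K A 0 (\<lambda>_. g)"
  by (simp add: word_def)

text \<open>Cylinders with a common end vertex are interchanged by a generator.\<close>

lemma cylinder_measure_cong:
  assumes inv: "invariant_borel_measure K A \<mu>"
    and w: "word K A n e" "word K A n f" "tgt (e n) = tgt (f n)"
  shows "emeasure \<mu> (cylinder K A n e) = emeasure \<mu> (cylinder K A n f)"
proof -
  let ?s = "cyl_swap K A n e f"
  have s: "?s \<in> swaps K A" using w unfolding swaps_def by blast
  have "?s ` cylinder K A n e = cylinder K A n f"
  proof (intro equalityI subsetI)
    fix y assume "y \<in> ?s ` cylinder K A n e"
    then obtain x where x: "x \<in> cylinder K A n e" "y = ?s x" by blast
    then have "x \<in> path_space K A" using cylinder_subset[of K A n e] by blast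
    then show "y \<in> cylinder K A n f"
      using x replace_prefix_cylinder[OF w(2)] w(3) cylinder_tgt[OF x(1)] by (simp add: cyl_swap_def)
  next
    fix y assume y: "y \<in> cylinder K A n f"
    then have ys: "y \<in> path_space K A" using cylinder_subset[of K A n f] by blast
    have "?s y \<in> cylinder K A n e"
    proof (cases "y \<in> cylinder K A n e")
      case True
      then have "replace_prefix n f y = y" using y unfolding cylinder_def replace_prefix_def by fastforce
      then show ?thesis using True ys by (simp add: cyl_swap_def)
    next
      case False
      then show ?thesis
        using ys y replace_prefix_cylinder[OF w(1) ys] w(3) cylinder_tgt[OF y] by (simp add: cyl_swap_def)
    qed
    moreover have "?s (?s y) = y" by (rule swaps_swap[OF s ys])
    ultimately show "y \<in> ?s ` cylinder K A n e" by (intro image_eqI[of y ?s "?s y"]) simp_all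
  qed
  then show ?thesis using inv_image[OF inv swaps_FC[OF s], of "cylinder K A n e"] by simp
qed

text \<open>A reduced sequence allows every step; a sequence with dead ends is handled by following the
  vertices at which an eigenvector sequence is positive.\<close>

lemma word_prolongation:
  assumes w: "word K A n e" and Q: "Q (Suc n) (tgt (e n))"
    and step: "\<And>i a. a \<in> A i \<Longrightarrow> Q i a \<Longrightarrow> \<exists>g\<in>out_edges K A i a. Q (Suc i) (tgt g)"
  shows "cylinder K A n e \<noteq> {}"
proof -
  define st where "st i a = (SOME g. g \<in> out_edges K A i a \<and> Q (Suc i) (tgt g))" for i a
  have st: "st i a \<in> edges K A i" "src (st i a) = a" "Q (Suc i) (tgt (st i a))" if "a \<in> A i" "Q i a" for i a
  proof -
    have "st i a \<in> out_edges K A i a \<and> Q (Suc i) (tgt (st i a))"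
      unfolding st_def by (rule someI_ex) (use step[OF that] in blast)
    then show "st i a \<in> edges K A i" "src (st i a) = a" "Q (Suc i) (tgt (st i a))"
      by (auto simp: out_edges_def)
  qed
  define g where "g = rec_nat (st (Suc n) (tgt (e n))) (\<lambda>k h. st (Suc (Suc (n + k))) (tgt h))"
  have g0: "g 0 = st (Suc n) (tgt (e n))" and gS: "g (Suc k) = st (Suc (Suc (n + k))) (tgt (g k))" for k
    by (simp_all add: g_def)
  have tn: "tgt (e n) \<in> A (Suc n)" using w tgt_in[of "e n" K A n] by (simp add: word_def)
  have gk: "g k \<in> edges K A (Suc (n + k)) \<and> Q (Suc (Suc (n + k))) (tgt (g k))" for k
  proof (induction k)
    case 0
    then show ?case using st[OF tn Q] by (simp add: g0)
  next
    case (Suc k)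
    then show ?case using st[of "tgt (g k)" "Suc (Suc (n + k))"] tgt_in[of "g k" K A] by (simp add: gS)
  qed
  have sg: "src (g (Suc k)) = tgt (g k)" for k
    using st(2)[of "tgt (g k)" "Suc (Suc (n + k))"] gk[of k] tgt_in[of "g k" K A] by (simp add: gS)
  have sg0: "src (g 0) = tgt (e n)" using st(2)[OF tn Q] by (simp add: g0)
  define x where "x i = (if i \<le> n then e i else g (i - Suc n))" for i
  have "x i \<in> edges K A i \<and> tgt (x i) = src (x (Suc i))" for i
  proof -
    consider "i < n" | "i = n" | k where "i = Suc (n + k)"
      by (metis less_imp_Suc_add linorder_neqE_nat)
    then show ?thesis
    proof cases
      case 1
      then show ?thesis using w by (simp add: x_def word_def)
    next
      case 2
      then show ?thesis using w sg0 by (simp add: x_def word_def)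
    next
      case 3
      then show ?thesis using gk[of k] sg[of k] by (simp add: x_def Suc_diff_le)
    qed
  qed
  then have "x \<in> cylinder K A n e" by (simp add: cylinder_def path_space_def x_def)
  then show ?thesis by blast
qed

section \<open>Measures from eigenvector sequences\<close>

lemma eigen_cone0D:
  assumes "w \<in> eigen_cone0 K A"
  shows "a \<notin> A i \<Longrightarrow> w i a = 0" and "a \<in> A i \<Longrightarrow> 0 \<le> w i a"
    and "a \<in> A i \<Longrightarrow> w i a = (\<Sum>b\<in>A (Suc i). real (K i a b) * w (Suc i) b)"
  using assms unfolding eigen_cone0_def by blast+

lemma eigen_nonneg: "w \<in> eigen_cone0 K A \<Longrightarrow> 0 \<le> w i a"
  using eigen_cone0D(1,2)[of w K A a i] by (cases "a \<in> A i") simp_all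

lemma eigen_sum:
  assumes fin: "\<And>i. finite (A i)" and w: "w \<in> eigen_cone0 K A" and a: "a \<in> A i"
  shows "w i a = (\<Sum>g\<in>out_edges K A i a. w (Suc i) (tgt g))"
  unfolding sum_out_edges[where A = A and i = i and a = a and f = "w (Suc i)", OF fin a]
  using eigen_cone0D(3)[OF w a] by simp

lemma word_tgt: "word K A n e \<Longrightarrow> tgt (e n) \<in> A (Suc n)"
  using tgt_in[of "e n" K A n] by (simp add: word_def)

text \<open>Along positive entries a word never runs into a dead end.  So an empty cylinder, which is contained in
  every set, contributes nothing to the sums below.\<close>

lemma eigen_empty_cylinder:
  assumes fin: "\<And>i. finite (A i)" and w: "w \<in> eigen_cone0 K A"
    and e: "word K A n e" "cylinder K A n e = {}"
  shows "w (Suc n) (tgt (e n)) = 0"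
proof (rule ccontr)
  assume ne: "w (Suc n) (tgt (e n)) \<noteq> 0"
  have "cylinder K A n e \<noteq> {}"
  proof (rule word_prolongation[where Q = "\<lambda>i a. w i a \<noteq> 0", OF e(1) ne])
    fix i a assume a: "a \<in> A i" "w i a \<noteq> 0"
    show "\<exists>g\<in>out_edges K A i a. w (Suc i) (tgt g) \<noteq> 0"
    proof (rule ccontr)
      assume "\<not> ?thesis"
      then have "(\<Sum>g\<in>out_edges K A i a. w (Suc i) (tgt g)) = 0" by (intro sum.neutral) blast
      then show False using a eigen_sum[OF fin w a(1)] by simp
    qed
  qed
  then show False using e(2) by blast
qed

lemma words_Suc:
  "words K A (Suc n) =
    (\<lambda>(e, g). e(Suc n := g)) ` (SIGMA e:words K A n. out_edges K A (Suc n) (tgt (e n)))"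
proof (intro equalityI subsetI)
  fix f assume f: "f \<in> words K A (Suc n)"
  then have w: "word K A (Suc n) f" and ext: "f \<in> extensional {..Suc n}" by (auto simp: words_def)
  have "restrict f {..n} \<in> words K A n"
    by (rule restrict_words) (use w in \<open>auto simp: word_def\<close>)
  moreover have "f (Suc n) \<in> out_edges K A (Suc n) (tgt (restrict f {..n} n))"
    using w by (auto simp: word_def out_edges_def)
  moreover have "f = (restrict f {..n})(Suc n := f (Suc n))"
  proof
    fix i
    consider "i \<le> n" | "i = Suc n" | "\<not> i \<le> Suc n" by linarith
    then show "f i = ((restrict f {..n})(Suc n := f (Suc n))) i"
      using ext by cases (auto simp: extensional_def)
  qed
  ultimately show "f \<in> (\<lambda>(e, g). e(Suc n := g)) ` (SIGMA e:words K A n. out_edges K A (Suc n) (tgt (e n)))"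
    by (intro image_eqI[of f _ "(restrict f {..n}, f (Suc n))"]) simp_all
next
  fix f assume "f \<in> (\<lambda>(e, g). e(Suc n := g)) ` (SIGMA e:words K A n. out_edges K A (Suc n) (tgt (e n)))"
  then obtain e g where eg: "e \<in> words K A n" "g \<in> out_edges K A (Suc n) (tgt (e n))" "f = e(Suc n := g)"
    by auto
  then have "word K A (Suc n) f"
    using word_snoc[of K A n e g] by (simp add: words_def out_edges_def)
  moreover have "f \<in> extensional {..Suc n}" using eg by (auto simp: words_def extensional_def)
  ultimately show "f \<in> words K A (Suc n)" by (simp add: words_def)
qed

lemma words_Suc_inj:
  "inj_on (\<lambda>(e, g). e(Suc n := g)) (SIGMA e:words K A n. out_edges K A (Suc n) (tgt (e n)))"
proof (rule inj_onI, clarify)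
  fix e g f h
  assume ef: "e \<in> words K A n" "f \<in> words K A n" and eq: "e(Suc n := g) = f(Suc n := h)"
  have "g = h" using fun_cong[OF eq, of "Suc n"] by simp
  moreover have "e i = f i" for i
    using fun_cong[OF eq, of i] ef by (cases "i = Suc n") (auto simp: words_def extensional_def)
  ultimately show "e = f \<and> g = h" by blast
qed

text \<open>The sets that are unions of cylinders of level \<open>n\<close>; over all levels these are the clopen sets.\<close>

definition determined :: "'v matseq \<Rightarrow> 'v alphabets \<Rightarrow> nat \<Rightarrow> 'v path set \<Rightarrow> bool" where
  "determined K A n E \<longleftrightarrow> E \<subseteq> path_space K A \<and> (\<forall>x\<in>E. cylinder K A n x \<subseteq> E)"

text \<open>The words \<open>e\<^sub>0 \<dots> e\<^sub>n\<close> end at level \<open>n + 1\<close>, hence the shift of the index of \<open>w\<close>.\<close>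

definition level_mass :: "'v matseq \<Rightarrow> 'v alphabets \<Rightarrow> 'v vecseq \<Rightarrow> nat \<Rightarrow> 'v path set \<Rightarrow> real" where
  "level_mass K A w n E =
    (\<Sum>e\<in>words K A n. if cylinder K A n e \<subseteq> E then w (Suc n) (tgt (e n)) else 0)"

lemma determined_mono: "determined K A n E \<Longrightarrow> n \<le> m \<Longrightarrow> determined K A m E"
  unfolding determined_def using cylinder_antimono by (meson subset_trans)

lemma determined_cylinder:
  assumes "determined K A n E" "x \<in> cylinder K A n e"
  shows "cylinder K A n e \<subseteq> E \<longleftrightarrow> x \<in> E"
  using assms cylinder_eq[OF assms(2)] unfolding determined_def by blast

text \<open>The eigenvector equation says that a cylinder has as much mass as its continuations together, so the
  mass of a set does not depend on the level at which it is computed.\<close>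

lemma level_mass_Suc:
  assumes fin: "\<And>i. finite (A i)" and w: "w \<in> eigen_cone0 K A" and E: "determined K A n E"
  shows "level_mass K A w (Suc n) E = level_mass K A w n E"
proof -
  let ?h = "\<lambda>e g. if cylinder K A (Suc n) (e(Suc n := g)) \<subseteq> E then w (Suc (Suc n)) (tgt g) else 0"
  have "level_mass K A w (Suc n) E =
      (\<Sum>(e, g)\<in>(SIGMA e:words K A n. out_edges K A (Suc n) (tgt (e n))). ?h e g)"
    unfolding level_mass_def words_Suc
    by (subst sum.reindex[OF words_Suc_inj]) (simp add: comp_def case_prod_beta' cong: if_cong)
  also have "\<dots> = (\<Sum>e\<in>words K A n. \<Sum>g\<in>out_edges K A (Suc n) (tgt (e n)). ?h e g)"
    by (rule sum.Sigma[symmetric]) (use finite_words[OF fin] finite_out_edges[of A, OF fin] in auto)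
  also have "\<dots> = level_mass K A w n E"
    unfolding level_mass_def
  proof (rule sum.cong[OF refl])
    fix e assume "e \<in> words K A n"
    then have e: "word K A n e" by (simp add: words_def)
    show "(\<Sum>g\<in>out_edges K A (Suc n) (tgt (e n)). ?h e g) =
        (if cylinder K A n e \<subseteq> E then w (Suc n) (tgt (e n)) else 0)"
    proof (cases "cylinder K A n e \<subseteq> E")
      case True
      have "cylinder K A (Suc n) (e(Suc n := g)) \<subseteq> E" for g using True unfolding cylinder_snoc by blast
      then show ?thesis using eigen_sum[OF fin w word_tgt[OF e]] True by simp
    next
      case False
      have "?h e g = 0" if g: "g \<in> out_edges K A (Suc n) (tgt (e n))" for g
      proof (cases "cylinder K A (Suc n) (e(Suc n := g)) \<subseteq> E")
        case True
        have "cylinder K A (Suc n) (e(Suc n := g)) = {}"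
        proof (rule ccontr)
          assume "cylinder K A (Suc n) (e(Suc n := g)) \<noteq> {}"
          then obtain x where x: "x \<in> cylinder K A (Suc n) (e(Suc n := g))" by blast
          then have "x \<in> cylinder K A n e" "x \<in> E" using True unfolding cylinder_snoc by blast+
          then show False using False determined_cylinder[OF E] by blast
        qed
        then have "w (Suc (Suc n)) (tgt ((e(Suc n := g)) (Suc n))) = 0"
          by (intro eigen_empty_cylinder[OF fin w] word_snoc[OF e] out_edgesD[OF g])
        then show ?thesis by simp
      qed simp
      then show ?thesis using False by simp
    qed
  qed
  finally show ?thesis .
qed

lemma level_mass_le:
  assumes fin: "\<And>i. finite (A i)" and w: "w \<in> eigen_cone0 K A" and E: "determined K A n E" and nm: "n \<le> m"
  shows "level_mass K A w m E = level_mass K A w n E"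
  using nm
proof (induction m rule: dec_induct)
  case (step m)
  then show ?case using level_mass_Suc[OF fin w determined_mono[OF E step(1)]] by simp
qed simp

lemma level_mass_Un:
  assumes fin: "\<And>i. finite (A i)" and w: "w \<in> eigen_cone0 K A"
    and E: "determined K A n E" "determined K A n F" "E \<inter> F = {}"
  shows "level_mass K A w n (E \<union> F) = level_mass K A w n E + level_mass K A w n F"
  unfolding level_mass_def sum.distrib[symmetric]
proof (rule sum.cong[OF refl])
  have EF: "determined K A n (E \<union> F)" using E(1,2) unfolding determined_def by blast
  fix e assume "e \<in> words K A n"
  then have e: "word K A n e" by (simp add: words_def)
  show "(if cylinder K A n e \<subseteq> E \<union> F then w (Suc n) (tgt (e n)) else 0) =
    (if cylinder K A n e \<subseteq> E then w (Suc n) (tgt (e n)) else 0) +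
    (if cylinder K A n e \<subseteq> F then w (Suc n) (tgt (e n)) else 0)"
  proof (cases "cylinder K A n e = {}")
    case True
    then show ?thesis using eigen_empty_cylinder[OF fin w e] by simp
  next
    case False
    then obtain x where x: "x \<in> cylinder K A n e" by blast
    show ?thesis
      unfolding determined_cylinder[OF EF x] determined_cylinder[OF E(1) x] determined_cylinder[OF E(2) x]
      using E(3) by auto
  qed
qed

lemma level_mass_cylinder:
  assumes fin: "\<And>i. finite (A i)" and w: "w \<in> eigen_cone0 K A" and e: "word K A n e"
  shows "level_mass K A w n (cylinder K A n e) = w (Suc n) (tgt (e n))"
proof -
  have "level_mass K A w n (cylinder K A n e) =
      (\<Sum>f\<in>words K A n. if f = restrict e {..n} then w (Suc n) (tgt (e n)) else 0)"
    unfolding level_mass_def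
  proof (rule sum.cong[OF refl])
    fix f assume f: "f \<in> words K A n"
    then have fw: "word K A n f" "f \<in> extensional {..n}" by (simp_all add: words_def)
    show "(if cylinder K A n f \<subseteq> cylinder K A n e then w (Suc n) (tgt (f n)) else 0) =
      (if f = restrict e {..n} then w (Suc n) (tgt (e n)) else 0)"
    proof (cases "f = restrict e {..n}")
      case True
      then have "tgt (f n) = tgt (e n)" "cylinder K A n f = cylinder K A n e"
        using cylinder_restrict by simp_all
      then show ?thesis using True by simp
    next
      case False
      then obtain i where i: "f i \<noteq> restrict e {..n} i" by (metis ext)
      have "i \<le> n"
      proof (rule ccontr)
        assume "\<not> i \<le> n"
        then show False using i extensional_arb[OF fw(2), of i] by simp
      qed
      then have ne: "f i \<noteq> e i" "i \<le> n" using i by simp_all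
      have "cylinder K A n f = {}" if "cylinder K A n f \<subseteq> cylinder K A n e"
      proof (rule ccontr)
        assume "cylinder K A n f \<noteq> {}"
        then obtain x where "x \<in> cylinder K A n f" by blast
        then have "x i = f i" "x i = e i" using that ne(2) unfolding cylinder_def by auto
        then show False using ne(1) by simp
      qed
      then show ?thesis using False eigen_empty_cylinder[OF fin w fw(1)] by auto
    qed
  qed
  also have "\<dots> = w (Suc n) (tgt (e n))"
    using finite_words[OF fin] restrict_words[OF e] by (simp add: sum.delta')
  finally show ?thesis .
qed

text \<open>The clopen sets form an algebra, and by compactness a finitely additive function on it is
  continuous at the empty set; Caratheodory's theorem extends it to the Borel sets.\<close>

lemma eigen_measure_exists:
  assumes fin: "\<And>i. finite (A i)" and w: "w \<in> eigen_cone0 K A"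
  shows "\<exists>\<mu>. sets \<mu> = sets (path_borel K A) \<and>
    (\<forall>n e. word K A n e \<longrightarrow> emeasure \<mu> (cylinder K A n e) = ennreal (w (Suc n) (tgt (e n))))"
proof -
  define C where "C = {E. \<exists>n. determined K A n E}"
  define f where "f E = ennreal (level_mass K A w (SOME n. determined K A n E) E)" for E
  have f: "f E = ennreal (level_mass K A w n E)" if E: "determined K A n E" for n E
  proof -
    define k where "k = (SOME n. determined K A n E)"
    have k: "determined K A k E" unfolding k_def using E by (rule someI)
    have "level_mass K A w k E = level_mass K A w (max k n) E"
      by (rule level_mass_le[OF fin w k, symmetric]) simp
    also have "\<dots> = level_mass K A w n E"
      by (rule level_mass_le[OF fin w E]) simp
    finally show ?thesis unfolding f_def k_def by simp
  qed
  have mass_nonneg: "0 \<le> level_mass K A w n E" for n E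
    unfolding level_mass_def by (intro sum_nonneg) (simp add: eigen_nonneg[OF w])
  have two: "\<exists>n. determined K A n E \<and> determined K A n F" if "E \<in> C" "F \<in> C" for E F
  proof -
    obtain n m where "determined K A n E" "determined K A m F" using \<open>E \<in> C\<close> \<open>F \<in> C\<close> unfolding C_def by blast
    then have "determined K A (max n m) E" "determined K A (max n m) F" by (auto elim!: determined_mono)
    then show ?thesis by blast
  qed
  have empty: "determined K A n {}" for n by (simp add: determined_def)
  interpret ring_of_sets "path_space K A" C
  proof (rule ring_of_setsI)
    show "C \<subseteq> Pow (path_space K A)" unfolding C_def determined_def by blast
    show "{} \<in> C" unfolding C_def using empty by blast
    fix E F assume "E \<in> C" "F \<in> C"
    then obtain n where n: "determined K A n E" "determined K A n F" using two by blast
    have "determined K A n (E \<union> F)" using n unfolding determined_def by blast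
    then show "E \<union> F \<in> C" unfolding C_def by blast
    have "determined K A n (E - F)"
      unfolding determined_def
    proof (intro conjI ballI)
      show "E - F \<subseteq> path_space K A" using n(1) unfolding determined_def by blast
      fix x assume x: "x \<in> E - F"
      then have xs: "x \<in> path_space K A" using n(1) unfolding determined_def by blast
      have "cylinder K A n x \<inter> F = {}"
      proof (rule ccontr)
        assume "cylinder K A n x \<inter> F \<noteq> {}"
        then obtain y where y: "y \<in> cylinder K A n x" "y \<in> F" by blast
        then have "cylinder K A n x \<subseteq> F" using determined_cylinder[OF n(2) y(1)] by blast
        then show False using in_cylinder_self[OF xs] x by blast
      qed
      then show "cylinder K A n x \<subseteq> E - F" using x n(1) unfolding determined_def by blast
    qed
    then show "E - F \<in> C" unfolding C_def by blast
  qed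
  have opn: "openin (path_topology K A) E" if "E \<in> C" for E
    using that unfolding C_def determined_def openin_path_iff by blast
  have "\<exists>\<mu> :: 'a path set \<Rightarrow> ennreal. (\<forall>s\<in>C. \<mu> s = f s) \<and> measure_space (path_space K A) (sigma_sets (path_space K A) C) \<mu>"
  proof (rule caratheodory_empty_continuous)
    have "level_mass K A w 0 {} = 0"
      unfolding level_mass_def
    proof (rule sum.neutral, rule ballI)
      fix e assume "e \<in> words K A 0"
      then show "(if cylinder K A 0 e \<subseteq> {} then w (Suc 0) (tgt (e 0)) else 0) = 0"
        using eigen_empty_cylinder[OF fin w, of 0 e] by (simp add: words_def)
    qed
    then show "positive C f" unfolding positive_def f[OF empty, of 0] by simp
    show "additive C f"
      unfolding additive_def
    proof (intro ballI impI)
      fix E F assume "E \<in> C" "F \<in> C" and dj: "E \<inter> F = {}"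
      then obtain n where n: "determined K A n E" "determined K A n F" using two by blast
      have "determined K A n (E \<union> F)" using n unfolding determined_def by blast
      then show "f (E \<union> F) = f E + f F"
        unfolding f[OF n(1)] f[OF n(2)]
        using f level_mass_Un[OF fin w n dj] mass_nonneg by simp
    qed
    show "E \<in> C \<Longrightarrow> f E \<noteq> \<infinity>" for E by (simp add: f_def)
    fix E :: "nat \<Rightarrow> 'a path set"
    assume E: "range E \<subseteq> C" "decseq E" "(\<Inter>i. E i) = {}"
    have clo: "closedin (path_topology K A) (E i)" for i
    proof -
      have Ei: "E i \<in> C" using E(1) by blast
      have "path_space K A \<in> C" unfolding C_def determined_def using cylinder_subset by blast
      then have "path_space K A - E i \<in> C" using Ei by (rule Diff)
      then have "openin (path_topology K A) (path_space K A - E i)" by (rule opn)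
      moreover have "E i \<subseteq> path_space K A" using Ei unfolding C_def determined_def by blast
      ultimately show ?thesis unfolding closedin_def topspace_path by blast
    qed
    obtain k where k: "E k = {}"
      using compact_space_imp_nest[OF compact_path_space[OF finite_edges[of A K, OF fin]] clo _ E(2)] E(3) by blast
    have f0: "f {} = 0" using \<open>positive C f\<close> by (simp add: positive_def)
    have "eventually (\<lambda>i. f (E i) = 0) sequentially"
      unfolding eventually_sequentially
    proof (intro exI[of _ k] allI impI)
      fix i assume "k \<le> i"
      then have "E i \<subseteq> E k" using E(2) by (simp add: decseq_def)
      then show "f (E i) = 0" using k f0 by simp
    qed
    then show "(\<lambda>i. f (E i)) \<longlonglongrightarrow> 0" by (rule tendsto_eventually)
  qed
  then obtain m where m: "\<And>E. E \<in> C \<Longrightarrow> m E = f E"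
    and ms: "measure_space (path_space K A) (sigma_sets (path_space K A) C) m" by blast
  have Csub: "C \<subseteq> Pow (path_space K A)" unfolding C_def determined_def by blast
  have detc: "determined K A n (cylinder K A n e)" for n e
    unfolding determined_def using cylinder_subset cylinder_eq by (metis subset_refl)
  have sig: "sigma_sets (path_space K A) C = sets (path_borel K A)"
  proof
    show "sigma_sets (path_space K A) C \<subseteq> sets (path_borel K A)"
      using sets.sigma_sets_subset[of C "path_borel K A"] opn open_in_sets by auto
    show "sets (path_borel K A) \<subseteq> sigma_sets (path_space K A) C"
      unfolding sets_path_borel_cylinders[where N = 0, OF fin]
    proof (rule sigma_sets_mono, rule subsetI)
      fix S assume "S \<in> insert {} {cylinder K A n x |n x. 0 \<le> n \<and> x \<in> path_space K A}"
      then have "S \<in> C"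
      proof (elim insertE CollectE exE conjE)
        fix n x assume "S = cylinder K A n x"
        then show "S \<in> C" unfolding C_def using detc by blast
      qed simp
      then show "S \<in> sigma_sets (path_space K A) C" by (rule sigma_sets.Basic)
    qed
  qed
  define \<mu> where "\<mu> = measure_of (path_space K A) (sigma_sets (path_space K A) C) m"
  have sm: "sets \<mu> = sets (path_borel K A)"
    unfolding \<mu>_def using Csub sigma_sets_sigma_sets_eq[OF Csub] sig
    by (metis (no_types, lifting) Pow_iff sets_measure_of sigma_sets_into_sp subsetI)
  have em: "emeasure \<mu> E = m E" if E: "E \<in> sets (path_borel K A)" for E
  proof (rule emeasure_measure_of[OF \<mu>_def])
    show "sigma_sets (path_space K A) C \<subseteq> Pow (path_space K A)"
      using Csub by (metis Pow_iff sigma_sets_into_sp subsetI)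
    show "E \<in> sets \<mu>" using E sm by simp
    show "positive (sets \<mu>) m" "countably_additive (sets \<mu>) m"
      using ms unfolding measure_space_def sm sig by simp_all
  qed
  have "emeasure \<mu> (cylinder K A n e) = ennreal (w (Suc n) (tgt (e n)))" if e: "word K A n e" for n e
  proof -
    have "cylinder K A n e \<in> C" unfolding C_def using detc by blast
    then have "emeasure \<mu> (cylinder K A n e) = f (cylinder K A n e)"
      unfolding em[OF cylinder_in_sets] by (rule m)
    then show ?thesis unfolding f[OF detc] level_mass_cylinder[OF fin w e] .
  qed
  then show ?thesis using sm by blast
qed

text \<open>The defining property of \<open>eigen_measure\<close>, which needs existence and uniqueness before it can be used.\<close>

definition represents :: "'v matseq \<Rightarrow> 'v alphabets \<Rightarrow> 'v vecseq \<Rightarrow> 'v path measure \<Rightarrow> bool" where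
  "represents K A w \<mu> \<longleftrightarrow> sets \<mu> = sets (path_borel K A) \<and>
    (\<forall>n e. word K A n e \<longrightarrow> emeasure \<mu> (cylinder K A n e) = ennreal (w (Suc n) (tgt (e n))))"

lemma representsD:
  assumes "represents K A w \<mu>"
  shows "sets \<mu> = sets (path_borel K A)"
    and "word K A n e \<Longrightarrow> emeasure \<mu> (cylinder K A n e) = ennreal (w (Suc n) (tgt (e n)))"
  using assms unfolding represents_def by blast+

lemma represents_unique:
  assumes fin: "\<And>i. finite (A i)" and r: "represents K A w \<mu>" "represents K A w \<nu>"
  shows "\<mu> = \<nu>"
proof (rule measure_eqI_cylinders[where N = 0, OF fin representsD(1)[OF r(1)] representsD(1)[OF r(2)]])
  fix n x assume "x \<in> path_space K A"
  then have "word K A n x" by (rule path_word)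
  then show "emeasure \<mu> (cylinder K A n x) = emeasure \<nu> (cylinder K A n x)"
    "emeasure \<mu> (cylinder K A n x) \<noteq> \<infinity>"
    using representsD(2)[OF r(1)] representsD(2)[OF r(2)] by simp_all
qed

lemma eigen_measure_eqI:
  assumes fin: "\<And>i. finite (A i)" and r: "represents K A w \<mu>"
  shows "eigen_measure K A w = \<mu>"
  unfolding eigen_measure_def represents_def[symmetric]
  by (rule the_equality, rule r) (rule represents_unique[OF fin _ r])

lemma represents_eigen_measure:
  assumes fin: "\<And>i. finite (A i)" and w: "w \<in> eigen_cone0 K A"
  shows "represents K A w (eigen_measure K A w)"
proof -
  obtain \<mu> where r: "represents K A w \<mu>"
    using eigen_measure_exists[OF fin w] unfolding represents_def by blast
  then show ?thesis using eigen_measure_eqI[OF fin r] by simp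
qed

lemma represents_total:
  assumes fin: "\<And>i. finite (A i)" and w: "w \<in> eigen_cone0 K A" and r: "represents K A w \<mu>"
  shows "emeasure \<mu> (path_space K A) = ennreal (\<Sum>a\<in>A 0. w 0 a)"
proof -
  have "emeasure \<mu> (path_space K A) = (\<Sum>g\<in>edges K A 0. emeasure \<mu> (cylinder K A 0 (\<lambda>_. g)))"
    by (rule emeasure_path_space_split[OF fin representsD(1)[OF r]])
  also have "\<dots> = (\<Sum>g\<in>edges K A 0. ennreal (w 1 (tgt g)))"
    using representsD(2)[OF r word_0] by simp
  also have "\<dots> = ennreal (\<Sum>g\<in>edges K A 0. w 1 (tgt g))"
    by (rule sum_ennreal) (rule eigen_nonneg[OF w])
  also have "edges K A 0 = (\<Union>a\<in>A 0. out_edges K A 0 a)"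
    using src_in[of _ K A 0] by (auto simp: out_edges_def)
  also have "(\<Sum>g\<in>(\<Union>a\<in>A 0. out_edges K A 0 a). w 1 (tgt g)) = (\<Sum>a\<in>A 0. \<Sum>g\<in>out_edges K A 0 a. w 1 (tgt g))"
    by (rule sum.UNION_disjoint) (use fin finite_out_edges[of A, OF fin] in \<open>auto simp: out_edges_def\<close>)
  also have "\<dots> = (\<Sum>a\<in>A 0. w 0 a)"
    using eigen_sum[OF fin w] by simp
  finally show ?thesis .
qed

text \<open>A group element maps a sufficiently long cylinder to a cylinder and keeps the tail, so it keeps the last
  vertex and with it the measure; long cylinders determine a measure.\<close>

lemma represents_invariant:
  assumes fin: "\<And>i. finite (A i)" and r: "represents K A w \<mu>"
  shows "invariant_borel_measure K A \<mu>"
  unfolding invariant_borel_measure_def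
proof (intro conjI ballI)
  note S = representsD(1)[OF r]
  have sp: "space \<mu> = path_space K A" using sets_eq_imp_space_eq[OF S] by simp
  show "sets \<mu> = sets (path_borel K A)" by (rule S)
  fix g E assume g: "g \<in> FC K A" and "E \<in> sets \<mu>"
  then have E: "E \<in> sets (path_borel K A)" using S by simp
  obtain h where h: "h \<in> FC K A" "\<And>x. x \<in> path_space K A \<Longrightarrow> h (g x) = x"
    "\<And>x. x \<in> path_space K A \<Longrightarrow> g (h x) = x" by (rule FC_inverse[OF g]) blast
  have hm: "h \<in> measurable \<mu> (path_borel K A)"
    using FC_measurable[OF h(1)] measurable_cong_sets[OF S refl] by blast
  have img: "h -` F \<inter> space \<mu> = g ` F" if F: "F \<subseteq> path_space K A" for F
  proof (intro equalityI subsetI)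
    fix x assume "x \<in> h -` F \<inter> space \<mu>"
    then show "x \<in> g ` F" using h(3)[of x] unfolding sp by (intro image_eqI[of x g "h x"]) auto
  next
    fix x assume "x \<in> g ` F"
    then show "x \<in> h -` F \<inter> space \<mu>" using h(2) F FC_in[OF g] unfolding sp by auto
  qed
  obtain N where N: "(\<forall>x\<in>path_space K A. \<forall>i>N. g x i = x i) \<and>
    (\<forall>x\<in>path_space K A. \<forall>y\<in>path_space K A. \<forall>n\<ge>N. (\<forall>i\<le>n. x i = y i) \<longrightarrow> (\<forall>i\<le>n. g x i = g y i))"
    using FC_prefix[OF g] ..
  obtain L where L: "(\<forall>x\<in>path_space K A. \<forall>i>L. h x i = x i) \<and>
    (\<forall>x\<in>path_space K A. \<forall>y\<in>path_space K A. \<forall>n\<ge>L. (\<forall>i\<le>n. x i = y i) \<longrightarrow> (\<forall>i\<le>n. h x i = h y i))"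
    using FC_prefix[OF h(1)] ..
  have cyl: "g ` cylinder K A n x = cylinder K A n (g x)"
    if x: "x \<in> path_space K A" and n: "max N L \<le> n" for n x
  proof (intro equalityI subsetI)
    fix z assume "z \<in> g ` cylinder K A n x"
    then obtain y where y: "y \<in> cylinder K A n x" "z = g y" by blast
    then have ys: "y \<in> path_space K A" "\<forall>i\<le>n. y i = x i" unfolding cylinder_def by auto
    have "\<forall>i\<le>n. g y i = g x i" using conjunct2[OF N] ys x n by (metis max.bounded_iff)
    then show "z \<in> cylinder K A n (g x)" using y(2) FC_in[OF g ys(1)] unfolding cylinder_def by simp
  next
    fix z assume "z \<in> cylinder K A n (g x)"
    then have zs: "z \<in> path_space K A" "\<forall>i\<le>n. z i = g x i" unfolding cylinder_def by auto
    have "\<forall>i\<le>n. h z i = h (g x) i" using conjunct2[OF L] zs FC_in[OF g x] n by (metis max.bounded_iff)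
    then have "h z \<in> cylinder K A n x" using h(2)[OF x] FC_in[OF h(1) zs(1)] unfolding cylinder_def by simp
    then show "z \<in> g ` cylinder K A n x" using h(3)[OF zs(1)] by (intro image_eqI[of z g "h z"]) simp_all
  qed
  have "\<mu> = distr \<mu> (path_borel K A) h"
  proof (rule measure_eqI_cylinders[where N = "max N L", OF fin S])
    show "sets (distr \<mu> (path_borel K A) h) = sets (path_borel K A)" by simp
    fix n x assume n: "max N L \<le> n" and x: "x \<in> path_space K A"
    have gx: "g x \<in> path_space K A" by (rule FC_in[OF g x])
    have "emeasure (distr \<mu> (path_borel K A) h) (cylinder K A n x) = emeasure \<mu> (cylinder K A n (g x))"
      unfolding emeasure_distr[OF hm cylinder_in_sets] img[OF cylinder_subset] cyl[OF x n] ..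
    moreover have "tgt (g x n) = tgt (x n)"
    proof -
      have "g x (Suc n) = x (Suc n)" using conjunct1[OF N] x n by simp
      then show ?thesis using x gx unfolding path_space_def by simp
    qed
    ultimately show "emeasure \<mu> (cylinder K A n x) = emeasure (distr \<mu> (path_borel K A) h) (cylinder K A n x)"
      using representsD(2)[OF r path_word[OF x]] representsD(2)[OF r path_word[OF gx]] by simp
    show "emeasure \<mu> (cylinder K A n x) \<noteq> \<infinity>" using representsD(2)[OF r path_word[OF x]] by simp
  qed
  then have "emeasure \<mu> E = emeasure (distr \<mu> (path_borel K A) h) E" by simp
  then show "emeasure \<mu> (g ` E) = emeasure \<mu> E"
    unfolding emeasure_distr[OF hm E] img[OF Borel_subset[OF E]] by simp
qed

section \<open>Ergodic measures and extreme rays\<close>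

lemma add_measure_exists:
  assumes "sets M = sets N"
  shows "\<exists>\<kappa>. sets \<kappa> = sets M \<and> (\<forall>E\<in>sets M. emeasure \<kappa> E = emeasure M E + emeasure N E)"
proof -
  define \<kappa> where "\<kappa> = measure_of (space M) (sets M) (\<lambda>E. emeasure M E + emeasure N E)"
  have s: "sets \<kappa> = sets M" unfolding \<kappa>_def by simp
  have "emeasure \<kappa> E = emeasure M E + emeasure N E" if "E \<in> sets M" for E
  proof (rule emeasure_measure_of[OF \<kappa>_def])
    show "sets M \<subseteq> Pow (space M)" by (rule sets.space_closed)
    show "E \<in> sets \<kappa>" using that s by simp
    show "positive (sets \<kappa>) (\<lambda>E. emeasure M E + emeasure N E)" by (simp add: positive_def)
    show "countably_additive (sets \<kappa>) (\<lambda>E. emeasure M E + emeasure N E)"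
      unfolding countably_additive_def
    proof (intro allI impI)
      fix E :: "nat \<Rightarrow> 'a set"
      assume E: "range E \<subseteq> sets \<kappa>" "disjoint_family E"
      have "(\<Sum>i. emeasure M (E i)) = emeasure M (\<Union>i. E i)"
        by (rule suminf_emeasure) (use E s in simp_all)
      moreover have "(\<Sum>i. emeasure N (E i)) = emeasure N (\<Union>i. E i)"
        by (rule suminf_emeasure) (use E s assms in simp_all)
      ultimately show "(\<Sum>i. emeasure M (E i) + emeasure N (E i)) = emeasure M (\<Union> (range E)) + emeasure N (\<Union> (range E))"
        by (subst suminf_add[symmetric]) simp_all
    qed
  qed
  then show ?thesis using s by blast
qed

text \<open>If a measure falls short of a larger one on some set, finiteness leaves no way to make up for it on the
  complement.\<close>

lemma measure_eq_of_le:
  assumes sets: "sets M = sets N" and le: "\<And>E. E \<in> sets M \<Longrightarrow> emeasure M E \<le> emeasure N E"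
    and tot: "emeasure M (space M) = emeasure N (space N)" "emeasure N (space N) \<noteq> \<infinity>"
  shows "M = N"
proof (rule measure_eqI[OF sets])
  fix E assume E: "E \<in> sets M"
  have sp: "space M = space N" by (rule sets_eq_imp_space_eq[OF sets])
  have E': "E \<in> sets N" using E sets by simp
  interpret M: finite_measure M using tot by (intro finite_measureI) simp
  interpret N: finite_measure N using tot by (intro finite_measureI) simp
  have mle: "measure M F \<le> measure N F" if "F \<in> sets M" for F
    using le[OF that] by (simp add: M.emeasure_eq_measure N.emeasure_eq_measure)
  have "measure M E \<le> measure N E" "measure M (space M - E) \<le> measure N (space N - E)"
    using mle[OF E] mle[OF sets.compl_sets[OF E]] sp by simp_all
  moreover have "measure M (space M) = measure N (space N)"
    using tot(1) by (simp add: M.emeasure_eq_measure N.emeasure_eq_measure)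
  ultimately have "measure M E = measure N E"
    using M.finite_measure_compl[OF E] N.finite_measure_compl[OF E'] by linarith
  then show "emeasure M E = emeasure N E" by (simp add: M.emeasure_eq_measure N.emeasure_eq_measure)
qed

text \<open>The saturation of a Hahn set for two invariant measures is again a Hahn set, and ergodicity makes
  it null or conull; so one of the two measures dominates the other, and equal total masses force equality.\<close>

lemma ergodic_dominated_unique:
  assumes fin: "\<And>i. finite (A i)"
    and inv: "invariant_borel_measure K A N" "invariant_borel_measure K A M"
    and erg: "ergodic (FC K A) M"
    and tot: "emeasure N (path_space K A) = emeasure M (path_space K A)" "emeasure M (path_space K A) \<noteq> \<infinity>"
    and ac: "\<And>E. E \<in> sets (path_borel K A) \<Longrightarrow> emeasure M E = 0 \<Longrightarrow> emeasure N E = 0"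
  shows "N = M"
proof -
  note sN = inv_sets[OF inv(1)] and sM = inv_sets[OF inv(2)]
  note spN = inv_space[OF inv(1)] and spM = inv_space[OF inv(2)]
  have fM: "finite_measure M" using tot spM by (intro finite_measureI) simp
  have fN: "finite_measure N" using tot spN by (intro finite_measureI) simp
  have NM: "sets N = sets M" using sN sM by simp
  obtain Y where Y: "Y \<in> sets M" "\<forall>X\<in>sets M. X \<subseteq> Y \<longrightarrow> emeasure N X \<le> emeasure M X"
    "\<forall>X\<in>sets M. X \<inter> Y = {} \<longrightarrow> emeasure M X \<le> emeasure N X"
    using finite_unsigned_Hahn_decomposition[OF fM fN NM] by blast
  have YB: "Y \<in> sets (path_borel K A)" using Y(1) sM by simp
  let ?Z = "saturation K A Y"
  have Z: "?Z \<in> sets (path_borel K A)" by (rule saturation_sets[OF fin YB])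
  have YZ: "Y \<subseteq> ?Z" by (rule subset_saturation[OF Borel_subset[OF YB]])
  have "emeasure M ?Z = 0 \<or> emeasure M (path_space K A - ?Z) = 0"
    by (rule ergodicD[OF erg sM Z saturation_idem])
  then show ?thesis
  proof
    assume z: "emeasure M ?Z = 0"
    have "emeasure M E \<le> emeasure N E" if E: "E \<in> sets M" for E
    proof -
      have Y0: "emeasure M Y = 0" by (rule null_subset[OF sM Z z YZ])
      have EY: "E - Y \<in> sets M" using E Y(1) by (rule sets.Diff)
      have "emeasure M E \<le> emeasure M (E - Y) + emeasure M Y"
        by (rule order_trans[OF emeasure_mono emeasure_subadditive[OF EY Y(1)]]) (use E Y(1) in auto)
      also have "\<dots> = emeasure M (E - Y)" using Y0 by simp
      also have "\<dots> \<le> emeasure N (E - Y)"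
      proof -
        have "(E - Y) \<inter> Y = {}" by blast
        then show ?thesis using Y(3) EY by blast
      qed
      also have "\<dots> \<le> emeasure N E" by (rule emeasure_mono) (use E NM in auto)
      finally show ?thesis .
    qed
    then have "M = N"
      by (rule measure_eq_of_le[OF NM[symmetric]]) (use tot spM spN in simp_all)
    then show ?thesis by simp
  next
    assume z: "emeasure M (path_space K A - ?Z) = 0"
    have Zc: "path_space K A - ?Z \<in> sets (path_borel K A)" by (rule sets.Diff[OF path_space_in_sets Z])
    have nz: "emeasure N (path_space K A - ?Z) = 0" by (rule ac[OF Zc z])
    have "emeasure N E \<le> emeasure M E" if "E \<in> sets N" for E
    proof -
      have E: "E \<in> sets (path_borel K A)" using that sN by simp
      have EZ: "E \<inter> ?Z \<in> sets (path_borel K A)" using E Z by (rule sets.Int)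
      have "E \<subseteq> (E \<inter> ?Z) \<union> (path_space K A - ?Z)" using Borel_subset[OF E] by blast
      then have "emeasure N E \<le> emeasure N ((E \<inter> ?Z) \<union> (path_space K A - ?Z))"
        by (rule emeasure_mono) (use EZ Zc sN in simp)
      also have "\<dots> \<le> emeasure N (E \<inter> ?Z) + emeasure N (path_space K A - ?Z)"
        by (rule emeasure_subadditive) (use EZ Zc sN in simp_all)
      also have "\<dots> = emeasure N (E \<inter> ?Z)" using nz by simp
      also have "\<dots> \<le> emeasure M (E \<inter> ?Z)"
        by (rule invariant_le_on_saturation[OF fin inv YB _ EZ]) (use Y(2) sM in auto)
      also have "\<dots> \<le> emeasure M E" by (rule emeasure_mono) (use E sM in auto)
      finally show ?thesis .
    qed
    then show ?thesis
      by (rule measure_eq_of_le[OF NM]) (use tot spM spN in simp_all)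
  qed
qed

lemma eigen_scale:
  assumes "w \<in> eigen_cone0 K A" "0 \<le> t"
  shows "(\<lambda>i a. t * w i a) \<in> eigen_cone0 K A"
  unfolding eigen_cone0_def
proof (intro CollectI conjI allI impI ballI)
  fix i a assume a: "a \<in> A i"
  show "0 \<le> t * w i a" using assms(2) eigen_nonneg[OF assms(1)] by simp
  have "t * w i a = t * (\<Sum>b\<in>A (Suc i). real (K i a b) * w (Suc i) b)"
    using eigen_cone0D(3)[OF assms(1) a] by simp
  then show "t * w i a = (\<Sum>b\<in>A (Suc i). real (K i a b) * (t * w (Suc i) b))"
    by (simp add: sum_distrib_left mult.left_commute)
qed (use eigen_cone0D(1)[OF assms(1)] in simp)

lemma represents_scale:
  assumes "represents K A w \<mu>" "0 \<le> t"
  shows "represents K A (\<lambda>i a. t * w i a) (scale_measure (ennreal t) \<mu>)"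
  unfolding represents_def using representsD[OF assms(1)] assms(2)
  by (simp add: ennreal_mult')

text \<open>Vertices that no word from level 0 reaches are invisible to measures; where every vertex is the
  end of a word, a sequence is recovered from the measure it represents.\<close>

definition all_reached :: "'v matseq \<Rightarrow> 'v alphabets \<Rightarrow> bool" where
  "all_reached K A \<longleftrightarrow> (\<forall>n. \<forall>s\<in>A (Suc n). \<exists>e. word K A n e \<and> tgt (e n) = s)"

lemma represents_vector_unique:
  assumes ar: "all_reached K A" and w: "w \<in> eigen_cone0 K A" "v \<in> eigen_cone0 K A"
    and r: "represents K A w \<mu>" "represents K A v \<mu>"
  shows "w = v"
proof (intro ext)
  fix i a
  have S: "w (Suc n) s = v (Suc n) s" for n s
  proof (cases "s \<in> A (Suc n)")
    case True
    then obtain e where e: "word K A n e" "tgt (e n) = s" using ar unfolding all_reached_def by blast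
    have "ennreal (w (Suc n) s) = ennreal (v (Suc n) s)"
      using representsD(2)[OF r(1) e(1)] representsD(2)[OF r(2) e(1)] e(2) by simp
    then show ?thesis using eigen_nonneg[OF w(1)] eigen_nonneg[OF w(2)] by simp
  next
    case False
    then show ?thesis using eigen_cone0D(1)[OF w(1)] eigen_cone0D(1)[OF w(2)] by simp
  qed
  show "w i a = v i a"
  proof (cases "a \<in> A i")
    case True
    then show ?thesis using eigen_cone0D(3)[OF w(1) True] eigen_cone0D(3)[OF w(2) True] S by simp
  next
    case False
    then show ?thesis using eigen_cone0D(1)[OF w(1)] eigen_cone0D(1)[OF w(2)] by simp
  qed
qed

text \<open>A summand of the sequence is represented by a measure dominated by the ergodic one.  Rescaled to the
  same total mass it is equal to it.\<close>

lemma ergodic_summand: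
  assumes fin: "\<And>i. finite (A i)" and ar: "all_reached K A"
    and w: "w \<in> eigen_cone0 K A" and r: "represents K A w \<mu>"
    and erg: "ergodic (FC K A) \<mu>" and pos: "emeasure \<mu> (path_space K A) \<noteq> 0"
    and u: "u \<in> eigen_cone0 K A" and v: "v \<in> eigen_cone0 K A"
    and uv: "(\<lambda>i a. u i a + v i a) = (\<lambda>i a. t * w i a)" and t: "t > 0"
  shows "u \<in> insert (\<lambda>i a. 0) (ray w)"
proof -
  define U where "U = eigen_measure K A u"
  have rU: "represents K A u U" unfolding U_def by (rule represents_eigen_measure[OF fin u])
  define V where "V = eigen_measure K A v"
  have rV: "represents K A v V" unfolding V_def by (rule represents_eigen_measure[OF fin v])
  note sm = representsD(1)[OF r] and sU = representsD(1)[OF rU] and sV = representsD(1)[OF rV]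
  have invm: "invariant_borel_measure K A \<mu>" by (rule represents_invariant[OF fin r])
  have invU: "invariant_borel_measure K A U" by (rule represents_invariant[OF fin rU])
  obtain S where S: "sets S = sets U" "\<forall>E\<in>sets U. emeasure S E = emeasure U E + emeasure V E"
    using add_measure_exists[of U V] sU sV by auto
  have "represents K A (\<lambda>i a. t * w i a) S"
    unfolding represents_def
  proof (intro conjI allI impI)
    show "sets S = sets (path_borel K A)" using S(1) sU by simp
    fix n e assume e: "word K A n e"
    have "cylinder K A n e \<in> sets U" using sU by simp
    then have "emeasure S (cylinder K A n e) = ennreal (u (Suc n) (tgt (e n))) + ennreal (v (Suc n) (tgt (e n)))"
      using S(2) representsD(2)[OF rU e] representsD(2)[OF rV e] by simp
    also have "\<dots> = ennreal (u (Suc n) (tgt (e n)) + v (Suc n) (tgt (e n)))"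
      using eigen_nonneg[OF u] eigen_nonneg[OF v] by (simp add: ennreal_plus)
    also have "u (Suc n) (tgt (e n)) + v (Suc n) (tgt (e n)) = t * w (Suc n) (tgt (e n))"
      using fun_cong[OF fun_cong[OF uv]] by blast
    finally show "emeasure S (cylinder K A n e) = ennreal (t * w (Suc n) (tgt (e n)))" .
  qed
  then have Sm: "S = scale_measure (ennreal t) \<mu>"
    by (rule represents_unique[OF fin]) (use represents_scale[OF r] t in simp)
  have ac: "emeasure U E = 0" if E: "E \<in> sets (path_borel K A)" "emeasure \<mu> E = 0" for E
  proof -
    have "emeasure U E + emeasure V E = ennreal t * emeasure \<mu> E"
      using S(2) E(1) sU Sm by (metis emeasure_scale_measure)
    then show ?thesis using E(2) by simp
  qed
  define a where "a = (\<Sum>a\<in>A 0. u 0 a)"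
  define b where "b = (\<Sum>a\<in>A 0. w 0 a)"
  have tU: "emeasure U (path_space K A) = ennreal a" unfolding a_def by (rule represents_total[OF fin u rU])
  have tm: "emeasure \<mu> (path_space K A) = ennreal b" unfolding b_def by (rule represents_total[OF fin w r])
  have a0: "0 \<le> a" unfolding a_def by (intro sum_nonneg eigen_nonneg[OF u])
  have b0: "0 < b" using pos tm by (metis ennreal_neg linorder_not_less)
  show ?thesis
  proof (cases "a = 0")
    case True
    have "represents K A (\<lambda>i a. 0) U"
      unfolding represents_def
    proof (intro conjI allI impI)
      fix n e
      have "emeasure U (cylinder K A n e) = 0"
        by (rule null_subset[OF sU path_space_in_sets _ cylinder_subset]) (simp add: tU True)
      then show "emeasure U (cylinder K A n e) = ennreal 0" by simp
    qed (rule sU)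
    moreover have "(\<lambda>i a. 0) \<in> eigen_cone0 K A" using eigen_scale[OF u, of 0] by simp
    ultimately have "u = (\<lambda>i a. 0)" by (intro represents_vector_unique[OF ar u _ rU])
    then show ?thesis by simp
  next
    case False
    \<comment> \<open>the ratio of the total masses\<close>
    define c where "c = a / b"
    have c: "c > 0" using False a0 b0 by (simp add: c_def)
    let ?M = "scale_measure (ennreal c) \<mu>"
    have rM: "represents K A (\<lambda>i a. c * w i a) ?M" by (rule represents_scale[OF r]) (use c in simp)
    have cne: "ennreal c \<noteq> 0" using c by simp
    have "U = ?M"
    proof (rule ergodic_dominated_unique[OF fin invU represents_invariant[OF fin rM]])
      show "ergodic (FC K A) ?M"
        using erg unfolding ergodic_def by (auto simp: space_scale_measure)
      have "emeasure ?M (path_space K A) = ennreal c * ennreal b" using tm by simp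
      also have "\<dots> = ennreal (c * b)" using c by (simp add: ennreal_mult')
      also have "c * b = a" using b0 by (simp add: c_def)
      finally show tM: "emeasure U (path_space K A) = emeasure ?M (path_space K A)" using tU by simp
      show "emeasure ?M (path_space K A) \<noteq> \<infinity>" using tM tU by (metis ennreal_neq_top infinity_ennreal_def)
      show "emeasure U E = 0" if "E \<in> sets (path_borel K A)" "emeasure ?M E = 0" for E
        using ac[OF that(1)] that(2) cne by simp
    qed
    then have "represents K A u ?M" using rU by simp
    then have "u = (\<lambda>i a. c * w i a)"
      using represents_vector_unique[OF ar u _ _ rM] eigen_scale[OF w, of c] c by simp
    then show ?thesis unfolding ray_def using c by blast
  qed
qed

lemma ergodic_in_extreme_ray:
  assumes fin: "\<And>i. finite (A i)" and ar: "all_reached K A"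
    and w: "w \<in> eigen_cone K A" and r: "represents K A w \<mu>"
    and erg: "ergodic (FC K A) \<mu>" and pos: "emeasure \<mu> (path_space K A) \<noteq> 0"
  shows "ray w \<in> extreme_rays K A"
  unfolding extreme_rays_def
proof (intro CollectI exI[of _ w] conjI refl w ballI impI)
  have w0: "w \<in> eigen_cone0 K A" using w by (simp add: eigen_cone_def)
  fix u v assume u: "u \<in> eigen_cone0 K A" and v: "v \<in> eigen_cone0 K A"
    and "(\<lambda>i a. u i a + v i a) \<in> ray w"
  then obtain t where t: "t > 0" "(\<lambda>i a. u i a + v i a) = (\<lambda>i a. t * w i a)" unfolding ray_def by blast
  have t': "(\<lambda>i a. v i a + u i a) = (\<lambda>i a. t * w i a)" using t(2) by (simp add: add.commute)
  show "u \<in> insert (\<lambda>i a. 0) (ray w)" by (rule ergodic_summand[OF fin ar w0 r erg pos u v t(2,1)])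
  show "v \<in> insert (\<lambda>i a. 0) (ray w)" by (rule ergodic_summand[OF fin ar w0 r erg pos v u t' t(1)])
qed

lemma extreme_ray_in_cone:
  assumes "R \<in> extreme_rays K A" "w \<in> R"
  shows "w \<in> eigen_cone K A"
proof -
  obtain v where v: "R = ray v" "v \<in> eigen_cone K A" using assms(1) unfolding extreme_rays_def by blast
  then obtain t where t: "t > 0" "w = (\<lambda>i a. t * v i a)" using assms(2) unfolding ray_def by blast
  have "w \<in> eigen_cone0 K A" unfolding t(2) using v(2) t(1) by (intro eigen_scale) (simp_all add: eigen_cone_def)
  moreover have "w i \<noteq> (\<lambda>a. 0)" for i
  proof
    assume "w i = (\<lambda>a. 0)"
    then have "v i = (\<lambda>a. 0)" using t by (auto simp: fun_eq_iff)
    then show False using v(2) by (simp add: eigen_cone_def)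
  qed
  ultimately show ?thesis by (simp add: eigen_cone_def)
qed

text \<open>The entry at a vertex is the measure of any cylinder ending there.  No word ends at level 0, so the
  entries there are computed from level 1.\<close>

lemma invariant_represents:
  assumes fin: "\<And>i. finite (A i)" and inv: "invariant_borel_measure K A \<mu>"
    and finite: "emeasure \<mu> (path_space K A) \<noteq> \<infinity>" and ar: "all_reached K A"
  shows "\<exists>w\<in>eigen_cone0 K A. represents K A w \<mu>"
proof -
  note sm = inv_sets[OF inv]
  define c where "c n s = measure \<mu> (cylinder K A n (SOME e. word K A n e \<and> tgt (e n) = s))" for n s
  have fm: "finite_measure \<mu>" using finite inv_space[OF inv] by (intro finite_measureI) simp
  have c: "emeasure \<mu> (cylinder K A n e) = ennreal (c n (tgt (e n)))" if e: "word K A n e" for n e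
  proof -
    define f where "f = (SOME f. word K A n f \<and> tgt (f n) = tgt (e n))"
    have f: "word K A n f \<and> tgt (f n) = tgt (e n)"
      unfolding f_def by (rule someI[of _ e]) (simp add: e)
    have "emeasure \<mu> (cylinder K A n e) = emeasure \<mu> (cylinder K A n f)"
      using f by (intro cylinder_measure_cong[OF inv e]) auto
    then show ?thesis
      unfolding c_def f_def[symmetric] using finite_measure.emeasure_eq_measure[OF fm] by simp
  qed
  define w where "w i a = (if a \<notin> A i then 0 else case i of 0 \<Rightarrow> (\<Sum>b\<in>A 1. real (K 0 a b) * c 0 b)
    | Suc n \<Rightarrow> c n a)" for i a
  have wS: "w (Suc n) a = c n a" if "a \<in> A (Suc n)" for n a using that by (simp add: w_def)
  have cpos: "0 \<le> c n a" for n a unfolding c_def by simp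
  have rep: "represents K A w \<mu>"
    unfolding represents_def using sm c wS word_tgt by metis
  have "w \<in> eigen_cone0 K A"
    unfolding eigen_cone0_def
  proof (intro CollectI conjI allI impI ballI)
    fix i a assume a: "a \<in> A i"
    show "0 \<le> w i a" unfolding w_def by (auto intro!: sum_nonneg mult_nonneg_nonneg cpos split: nat.split)
    show "w i a = (\<Sum>b\<in>A (Suc i). real (K i a b) * w (Suc i) b)"
    proof (cases i)
      case 0
      have "(\<Sum>b\<in>A 1. real (K 0 a b) * c 0 b) = (\<Sum>b\<in>A (Suc 0). real (K 0 a b) * w (Suc 0) b)"
        using wS by simp
      then show ?thesis using 0 a by (simp add: w_def[of 0 a])
    next
      case (Suc n)
      then obtain e where e: "word K A n e" "tgt (e n) = a" using ar a unfolding all_reached_def by blast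
      have wn: "0 \<le> w (Suc i) b" for b unfolding w_def using cpos by simp
      have "ennreal (w i a) = emeasure \<mu> (cylinder K A n e)"
        using c[OF e(1)] e(2) wS a Suc by simp
      also have "\<dots> = (\<Sum>g\<in>out_edges K A (Suc n) a. emeasure \<mu> (cylinder K A (Suc n) (e(Suc n := g))))"
        using emeasure_cylinder_split_whole[OF fin sm, of n e] e(2) by simp
      also have "\<dots> = (\<Sum>g\<in>out_edges K A (Suc n) a. ennreal (w (Suc (Suc n)) (tgt g)))"
      proof (rule sum.cong[OF refl])
        fix g assume g: "g \<in> out_edges K A (Suc n) a"
        have "word K A (Suc n) (e(Suc n := g))"
          using out_edgesD[OF g] e(2) by (intro word_snoc[OF e(1)]) simp_all
        then show "emeasure \<mu> (cylinder K A (Suc n) (e(Suc n := g))) = ennreal (w (Suc (Suc n)) (tgt g))"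
          using representsD(2)[OF rep] by fastforce
      qed
      also have "\<dots> = ennreal (\<Sum>g\<in>out_edges K A (Suc n) a. w (Suc (Suc n)) (tgt g))"
        using wn Suc by (intro sum_ennreal) simp
      also have "(\<Sum>g\<in>out_edges K A (Suc n) a. w (Suc (Suc n)) (tgt g)) =
          (\<Sum>b\<in>A (Suc i). real (K i a b) * w (Suc i) b)"
        using sum_out_edges[where A = A and i = i and a = a and f = "w (Suc i)" and K = K, OF fin a] Suc by simp
      finally show ?thesis
        using cpos wn wS[of a n] a Suc by (subst (asm) ennreal_inj) (auto intro!: sum_nonneg)
    qed
  qed (simp add: w_def)
  then show ?thesis using rep by blast
qed

lemma represents_nonzero:
  assumes fin: "\<And>i. finite (A i)" and w: "w \<in> eigen_cone0 K A" and r: "represents K A w \<mu>"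
    and pos: "emeasure \<mu> (path_space K A) \<noteq> 0"
  shows "w \<in> eigen_cone K A"
proof -
  have "w i \<noteq> (\<lambda>a. 0)" for i
  proof (induction i)
    case 0
    show ?case
    proof
      assume "w 0 = (\<lambda>a. 0)"
      then have "emeasure \<mu> (path_space K A) = 0" using represents_total[OF fin w r] by simp
      then show False using pos by simp
    qed
  next
    case (Suc i)
    show ?case
    proof
      assume z: "w (Suc i) = (\<lambda>a. 0)"
      have "w i a = 0" for a
        using eigen_cone0D(1)[OF w, of a i] eigen_cone0D(3)[OF w, of a i] z by (cases "a \<in> A i") simp_all
      then show False using Suc by blast
    qed
  qed
  then show ?thesis using w by (simp add: eigen_cone_def)
qed

lemma finite_iff_extreme:
  assumes fin: "\<And>i. finite (A i)" and ar: "all_reached K A"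
    and inv: "invariant_borel_measure K A \<mu>" and erg: "ergodic (FC K A) \<mu>"
    and pos: "emeasure \<mu> (path_space K A) \<noteq> 0"
  shows "emeasure \<mu> (path_space K A) < \<infinity> \<longleftrightarrow>
    (\<exists>R\<in>extreme_rays K A. \<exists>w\<in>R. \<mu> = eigen_measure K A w)"
proof
  assume "emeasure \<mu> (path_space K A) < \<infinity>"
  then obtain w where w: "w \<in> eigen_cone0 K A" "represents K A w \<mu>"
    using invariant_represents[OF fin inv _ ar] by (metis order_less_irrefl)
  have wc: "w \<in> eigen_cone K A" by (rule represents_nonzero[OF fin w pos])
  have R: "ray w \<in> extreme_rays K A" by (rule ergodic_in_extreme_ray[OF fin ar wc w(2) erg pos])
  have "(\<lambda>i a. 1 * w i a) \<in> ray w" unfolding ray_def by (intro CollectI exI[of _ 1]) simp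
  then have "w \<in> ray w" by simp
  moreover have "\<mu> = eigen_measure K A w" using eigen_measure_eqI[OF fin w(2)] by simp
  ultimately show "\<exists>R\<in>extreme_rays K A. \<exists>w\<in>R. \<mu> = eigen_measure K A w" using R by blast
next
  assume "\<exists>R\<in>extreme_rays K A. \<exists>w\<in>R. \<mu> = eigen_measure K A w"
  then obtain R w where Rw: "R \<in> extreme_rays K A" "w \<in> R" "\<mu> = eigen_measure K A w" by blast
  have w: "w \<in> eigen_cone0 K A" using extreme_ray_in_cone[OF Rw(1,2)] by (simp add: eigen_cone_def)
  show "emeasure \<mu> (path_space K A) < \<infinity>"
    using represents_total[OF fin w represents_eigen_measure[OF fin w]] Rw(3) by simp
qed

lemma open_contains_cylinder:
  assumes "openin (path_topology K A) U" "U \<noteq> {}"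
  obtains x n where "x \<in> path_space K A" "cylinder K A n x \<subseteq> U"
proof -
  obtain x where x: "x \<in> U" using assms(2) by blast
  have U: "U \<subseteq> path_space K A" "\<forall>x\<in>U. \<exists>n. cylinder K A n x \<subseteq> U"
    using assms(1) unfolding openin_path_iff by (rule conjunct1, rule conjunct2)
  obtain n where "cylinder K A n x \<subseteq> U" using U(2) x by blast
  then show ?thesis using that U(1) x by blast
qed

section \<open>Reduced primitive sequences\<close>

locale primitive_system =
  fixes K :: "'v matseq" and A :: "'v alphabets"
  assumes fin: "\<And>i. finite (A i)" and reduced: "reduced K A" and primitive: "primitive K A"
begin

lemma reached: "all_reached K A"
  unfolding all_reached_def
proof (intro allI ballI)
  fix n s show "s \<in> A (Suc n) \<Longrightarrow> \<exists>e. word K A n e \<and> tgt (e n) = s"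
  proof (induction n arbitrary: s)
    case 0
    then obtain a where a: "a \<in> A 0" "K 0 a s \<noteq> 0" using reduced unfolding reduced_def by blast
    have "(a, s, 0) \<in> edges K A 0" using a 0 by (simp add: edges_def)
    then have "word K A 0 (\<lambda>_. (a, s, 0))" by (rule word_0)
    then show ?case by (intro exI[of _ "\<lambda>_. (a, s, 0)"]) (simp add: tgt_def)
  next
    case (Suc n)
    then obtain a where a: "a \<in> A (Suc n)" "K (Suc n) a s \<noteq> 0" using reduced unfolding reduced_def by blast
    obtain e where e: "word K A n e" "tgt (e n) = a" using Suc.IH[OF a(1)] by blast
    have "(a, s, 0) \<in> edges K A (Suc n)" using a Suc.prems by (simp add: edges_def)
    then have "word K A (Suc n) (e(Suc n := (a, s, 0)))"
      using e by (intro word_snoc) (simp_all add: src_def)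
    then show ?case by (intro exI[of _ "e(Suc n := (a, s, 0))"]) (simp add: tgt_def del: fun_upd_apply, simp)
  qed
qed

lemma cylinder_nonempty:
  assumes "word K A n e" shows "cylinder K A n e \<noteq> {}"
proof (rule word_prolongation[where Q = "\<lambda>_ _. True", OF assms TrueI])
  fix i a assume "a \<in> A i"
  then obtain b where "b \<in> A (Suc i)" "K i a b \<noteq> 0" using reduced unfolding reduced_def by blast
  then have "(a, b, 0) \<in> out_edges K A i a" using \<open>a \<in> A i\<close> by (simp add: out_edges_def edges_def src_def)
  then show "\<exists>g\<in>out_edges K A i a. True" by blast
qed

lemma word_connect:
  assumes e: "word K A n e"
  shows "mat_prod K A (Suc n) m (tgt (e n)) b > 0 \<Longrightarrow> b \<in> A (Suc n + m) \<Longrightarrow>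
    \<exists>f. word K A (n + m) f \<and> (\<forall>i\<le>n. f i = e i) \<and> tgt (f (n + m)) = b"
proof (induction m arbitrary: b)
  case 0
  then have "tgt (e n) = b" by (simp split: if_splits)
  then show ?case using e by (intro exI[of _ e]) simp
next
  case (Suc m)
  have "\<exists>c\<in>A (Suc n + m). mat_prod K A (Suc n) m (tgt (e n)) c * K (Suc n + m) c b \<noteq> 0"
  proof (rule ccontr)
    assume "\<not> ?thesis"
    then have "(\<Sum>c\<in>A (Suc n + m). mat_prod K A (Suc n) m (tgt (e n)) c * K (Suc n + m) c b) = 0"
      by (intro sum.neutral) blast
    then show False using Suc.prems(1) by simp
  qed
  then obtain c where c: "c \<in> A (Suc n + m)" "mat_prod K A (Suc n) m (tgt (e n)) c > 0" "K (Suc n + m) c b > 0"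
    by auto
  obtain f where f: "word K A (n + m) f" "\<forall>i\<le>n. f i = e i" "tgt (f (n + m)) = c"
    using Suc.IH[OF c(2,1)] by blast
  have "(c, b, 0) \<in> edges K A (Suc (n + m))" using c Suc.prems(2) by (simp add: edges_def)
  then have "word K A (Suc (n + m)) (f(Suc (n + m) := (c, b, 0)))"
    using f by (intro word_snoc) (simp_all add: src_def)
  moreover have "\<forall>i\<le>n. (f(Suc (n + m) := (c, b, 0))) i = e i" using f(2) by simp
  moreover have "tgt ((f(Suc (n + m) := (c, b, 0))) (n + Suc m)) = b" by (simp add: tgt_def)
  ultimately show ?case by (metis add_Suc_right)
qed

text \<open>Primitivity in the form used below: at a suitable later level, every vertex is the end of a continuation
  of the given word, so the continuation can join any given path there.\<close>

lemma word_join: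
  assumes e: "word K A n e"
  shows "\<exists>N\<ge>n. \<forall>b\<in>A (Suc N). \<exists>f. word K A N f \<and> (\<forall>i\<le>n. f i = e i) \<and> tgt (f N) = b"
proof -
  obtain N where N: "N > Suc n" "\<forall>a\<in>A (Suc n). \<forall>b\<in>A (Suc N). mat_prod K A (Suc n) (Suc N - Suc n) a b > 0"
    using primitive unfolding primitive_def by blast
  have "\<exists>f. word K A N f \<and> (\<forall>i\<le>n. f i = e i) \<and> tgt (f N) = b" if b: "b \<in> A (Suc N)" for b
  proof -
    have "mat_prod K A (Suc n) (N - n) (tgt (e n)) b > 0" using N(2) word_tgt[OF e] b by simp
    moreover have "b \<in> A (Suc n + (N - n))" using b N(1) by simp
    ultimately show ?thesis using word_connect[OF e, of "N - n" b] N(1) by simp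
  qed
  then show ?thesis using N(1) by (intro exI[of _ N]) simp
qed

text \<open>The predicate \<open>P\<close> stands for being nonzero, or for being infinite: a cylinder with the
  property contains arbitrarily small ones with it, and each of those is matched by a cylinder of the
  same measure inside any given one.\<close>

lemma cylinder_dichotomy:
  fixes P :: "ennreal \<Rightarrow> bool"
  assumes inv: "invariant_borel_measure K A \<mu>"
    and P0: "\<not> P 0" and Padd: "\<And>a b. P (a + b) \<Longrightarrow> P a \<or> P b" and Pmono: "\<And>a b. P a \<Longrightarrow> a \<le> b \<Longrightarrow> P b"
    and e: "word K A n e" "P (emeasure \<mu> (cylinder K A n e))"
    and f: "word K A m f"
  shows "P (emeasure \<mu> (cylinder K A m f))"
proof -
  note sm = inv_sets[OF inv]
  have Psum: "\<exists>x\<in>X. P (h x)" if "finite X" "P (sum h X)" for X :: "'v edge set" and h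
    using that by (induction X rule: finite_induct) (use P0 Padd in auto)
  have long: "\<exists>e'. word K A (n + k) e' \<and> P (emeasure \<mu> (cylinder K A (n + k) e'))" for k
  proof (induction k)
    case 0
    then show ?case using e by auto
  next
    case (Suc k)
    then obtain e' where e': "word K A (n + k) e'" "P (emeasure \<mu> (cylinder K A (n + k) e'))" by blast
    obtain g where g: "g \<in> out_edges K A (Suc (n + k)) (tgt (e' (n + k)))"
      "P (emeasure \<mu> (cylinder K A (Suc (n + k)) (e'(Suc (n + k) := g))))"
      using Psum[OF finite_out_edges[of A, OF fin]] e'(2) emeasure_cylinder_split_whole[OF fin sm, of "n + k" e'] by metis
    have "word K A (Suc (n + k)) (e'(Suc (n + k) := g))" by (intro word_snoc e' out_edgesD[OF g(1)])
    then show ?case using g(2) by auto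
  qed
  obtain N where N: "N \<ge> m" "\<forall>b\<in>A (Suc N). \<exists>f'. word K A N f' \<and> (\<forall>i\<le>m. f' i = f i) \<and> tgt (f' N) = b"
    using word_join[OF f] by blast
  obtain e' where e': "word K A (n + N) e'" "P (emeasure \<mu> (cylinder K A (n + N) e'))" using long by blast
  have tN: "tgt (e' N) \<in> A (Suc N)" using e'(1) tgt_in[of "e' N" K A N] by (simp add: word_def)
  then obtain f' where f': "word K A N f'" "\<forall>i\<le>m. f' i = f i" "tgt (f' N) = tgt (e' N)" using N(2) by blast
  \<comment> \<open>a continuation of f up to level N, and from there along the small cylinder of e\<close>
  define h where "h i = (if i \<le> N then f' i else e' i)" for i
  have h: "word K A (n + N) h"
    unfolding word_def
  proof (intro conjI allI impI)
    fix i assume "i \<le> n + N"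
    then show "h i \<in> edges K A i" using f'(1) e'(1) unfolding h_def word_def by simp
  next
    fix i assume i: "i < n + N"
    consider "i < N" | "i = N" | "N < i" by linarith
    then show "tgt (h i) = src (h (Suc i))"
      using f' e'(1) i unfolding h_def word_def by cases auto
  qed
  have hend: "tgt (h (n + N)) = tgt (e' (n + N))" using f'(3) by (cases "n = 0") (simp_all add: h_def)
  have "cylinder K A (n + N) h \<subseteq> cylinder K A m f"
    using N(1) f'(2) unfolding cylinder_def h_def by auto
  then have "emeasure \<mu> (cylinder K A (n + N) h) \<le> emeasure \<mu> (cylinder K A m f)"
    using sm by (intro emeasure_mono) simp_all
  moreover have "emeasure \<mu> (cylinder K A (n + N) h) = emeasure \<mu> (cylinder K A (n + N) e')"
    by (rule cylinder_measure_cong[OF inv h e'(1) hend])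
  ultimately show ?thesis using e'(2) Pmono by metis
qed

lemma open_positive:
  assumes inv: "invariant_borel_measure K A \<mu>" and pos: "emeasure \<mu> (path_space K A) \<noteq> 0"
    and U: "openin (path_topology K A) U" "U \<noteq> {}"
  shows "emeasure \<mu> U \<noteq> 0"
proof -
  note sm = inv_sets[OF inv]
  have "\<exists>g\<in>edges K A 0. emeasure \<mu> (cylinder K A 0 (\<lambda>_. g)) \<noteq> 0"
  proof (rule ccontr)
    assume "\<not> ?thesis"
    then have "(\<Sum>g\<in>edges K A 0. emeasure \<mu> (cylinder K A 0 (\<lambda>_. g))) = 0"
      by (intro sum.neutral) blast
    then show False using pos emeasure_path_space_split[OF fin sm] by simp
  qed
  then obtain g where g: "g \<in> edges K A 0" "emeasure \<mu> (cylinder K A 0 (\<lambda>_. g)) \<noteq> 0" by blast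
  obtain x n where x: "x \<in> path_space K A" "cylinder K A n x \<subseteq> U" by (rule open_contains_cylinder[OF U])
  have "emeasure \<mu> (cylinder K A n x) \<noteq> 0"
    by (rule cylinder_dichotomy[where P = "\<lambda>c. c \<noteq> 0", OF inv _ _ _ word_0[OF g(1)] g(2) path_word[OF x(1)]]) auto
  moreover have "emeasure \<mu> (cylinder K A n x) \<le> emeasure \<mu> U"
    using x(2) open_in_sets[OF U(1)] sm by (intro emeasure_mono) simp_all
  ultimately show ?thesis by auto
qed

lemma open_infinite:
  assumes inv: "invariant_borel_measure K A \<mu>" and infin: "emeasure \<mu> (path_space K A) = \<infinity>"
    and U: "openin (path_topology K A) U" "U \<noteq> {}"
  shows "emeasure \<mu> U = \<infinity>"
proof -
  note sm = inv_sets[OF inv]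
  have "\<exists>g\<in>edges K A 0. emeasure \<mu> (cylinder K A 0 (\<lambda>_. g)) = \<infinity>"
  proof (rule ccontr)
    assume "\<not> ?thesis"
    then have "(\<Sum>g\<in>edges K A 0. emeasure \<mu> (cylinder K A 0 (\<lambda>_. g))) \<noteq> \<infinity>"
      using finite_edges[of A K 0, OF fin] by (simp add: less_top[symmetric])
    then show False using infin emeasure_path_space_split[OF fin sm] by simp
  qed
  then obtain g where g: "g \<in> edges K A 0" "emeasure \<mu> (cylinder K A 0 (\<lambda>_. g)) = \<infinity>" by blast
  obtain x n where x: "x \<in> path_space K A" "cylinder K A n x \<subseteq> U" by (rule open_contains_cylinder[OF U])
  have "emeasure \<mu> (cylinder K A n x) = \<infinity>"
    by (rule cylinder_dichotomy[where P = "\<lambda>c. c = \<infinity>", OF inv _ _ _ word_0[OF g(1)] g(2) path_word[OF x(1)]])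
      (auto simp: top_unique)
  moreover have "emeasure \<mu> (cylinder K A n x) \<le> emeasure \<mu> U"
    using x(2) open_in_sets[OF U(1)] sm by (intro emeasure_mono) simp_all
  ultimately show ?thesis by (simp add: top_unique)
qed

text \<open>Every prefix can be continued so as to join the tail of the given path; hence the orbit has at least as
  many points as there are prefixes of any given length, and these are unboundedly many.\<close>

lemma infinite_orbit:
  assumes inf: "infinite (path_space K A)" and x: "x \<in> path_space K A"
  shows "infinite (saturation K A {x})"
proof
  assume fs: "finite (saturation K A {x})"
  obtain F where F: "F \<subseteq> path_space K A" "finite F" "card F = Suc (card (saturation K A {x}))"
    using infinite_arbitrarily_large[OF inf] by blast
  \<comment> \<open>a level n at which all members of F have distinct prefixes\<close>
  define d where "d = (\<lambda>(y :: 'v path, z :: 'v path). LEAST i. y i \<noteq> z i)"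
  define n where "n = Max (insert 0 (d ` (F \<times> F)))"
  have sep: "y = z" if yz: "y \<in> F" "z \<in> F" "\<forall>i\<le>n. y i = z i" for y z
  proof (rule ccontr)
    assume "y \<noteq> z"
    then have "\<exists>i. y i \<noteq> z i" by (simp add: fun_eq_iff)
    then have "y (d (y, z)) \<noteq> z (d (y, z))" unfolding d_def prod.case by (rule LeastI_ex)
    moreover have "d (y, z) \<le> n"
      unfolding n_def using F(2) yz by (intro Max_ge) auto
    ultimately show False using yz(3) by blast
  qed
  have "\<exists>z\<in>saturation K A {x}. \<forall>i\<le>n. z i = y i" if y: "y \<in> F" for y
  proof -
    have yw: "word K A n y" using y F(1) path_word by blast
    obtain N where N: "N \<ge> n" "\<forall>b\<in>A (Suc N). \<exists>f. word K A N f \<and> (\<forall>i\<le>n. f i = y i) \<and> tgt (f N) = b"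
      using word_join[OF yw] by blast
    have "src (x (Suc N)) \<in> A (Suc N)" using x src_in unfolding path_space_def by blast
    then obtain f where f: "word K A N f" "\<forall>i\<le>n. f i = y i" "tgt (f N) = src (x (Suc N))" using N(2) by blast
    have c: "replace_prefix N f x \<in> cylinder K A N f" by (rule replace_prefix_cylinder[OF f(1) x f(3)])
    have "replace_prefix N f x \<in> saturation K A {x}"
    proof (rule saturationI[where n = N and x = x])
      show "replace_prefix N f x \<in> path_space K A" by (rule subsetD[OF cylinder_subset c])
    qed (simp_all add: replace_prefix_def)
    moreover have "\<forall>i\<le>n. replace_prefix N f x i = y i" using f(2) N(1) by (simp add: replace_prefix_def)
    ultimately show ?thesis by blast
  qed
  then obtain p where p: "\<And>y. y \<in> F \<Longrightarrow> p y \<in> saturation K A {x}" "\<And>y. y \<in> F \<Longrightarrow> \<forall>i\<le>n. p y i = y i"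
    by metis
  have "inj_on p F"
  proof (rule inj_onI)
    fix y z assume yz: "y \<in> F" "z \<in> F" "p y = p z"
    then have "\<forall>i\<le>n. y i = z i" using p(2) by metis
    then show "y = z" by (rule sep[OF yz(1,2)])
  qed
  then have "card F \<le> card (saturation K A {x})" using p(1) fs by (intro card_inj_on_le[of p]) auto
  then show False using F(3) by simp
qed

end

section \<open>A block inside a larger sequence\<close>

text \<open>Splitting off the first factor instead of the last follows the decomposition of a cylinder by its next
  edge.\<close>

lemma mat_prod_Suc_left:
  assumes fin: "\<And>i. finite (A i)" and a: "a \<in> A i"
  shows "b \<in> A (i + Suc m) \<Longrightarrow>
    mat_prod K A i (Suc m) a b = (\<Sum>c\<in>A (Suc i). K i a c * mat_prod K A (Suc i) m c b)"
proof (induction m arbitrary: b)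
  case 0
  have "(\<Sum>c\<in>A i. (if a = c then 1 else 0) * K i c b) = (\<Sum>c\<in>A i. if a = c then K i c b else 0)"
    by (rule sum.cong) auto
  moreover have "(\<Sum>c\<in>A (Suc i). K i a c * (if c = b then 1 else 0)) = (\<Sum>c\<in>A (Suc i). if c = b then K i a c else 0)"
    by (rule sum.cong) auto
  ultimately show ?case using 0 a fin by (simp add: sum.delta sum.delta')
next
  case (Suc m)
  have "mat_prod K A i (Suc (Suc m)) a b = (\<Sum>d\<in>A (i + Suc m). mat_prod K A i (Suc m) a d * K (i + Suc m) d b)"
    by simp
  also have "\<dots> = (\<Sum>d\<in>A (i + Suc m). \<Sum>c\<in>A (Suc i). K i a c * mat_prod K A (Suc i) m c d * K (i + Suc m) d b)"
    by (rule sum.cong[OF refl]) (simp only: Suc.IH sum_distrib_right)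
  also have "\<dots> = (\<Sum>c\<in>A (Suc i). \<Sum>d\<in>A (i + Suc m). K i a c * mat_prod K A (Suc i) m c d * K (i + Suc m) d b)"
    by (rule sum.swap)
  also have "\<dots> = (\<Sum>c\<in>A (Suc i). K i a c * mat_prod K A (Suc i) (Suc m) c b)"
    by (simp add: sum_distrib_left mult.assoc)
  finally show ?case .
qed

lemma mat_iterate_0:
  assumes "finite (A i)" "a \<in> A i" shows "mat_iterate K A 0 v i a = v i a"
proof -
  have "mat_iterate K A 0 v i a = (\<Sum>b\<in>A i. if a = b then v i b else 0)"
    unfolding mat_iterate_def by (simp, rule sum.cong) auto
  then show ?thesis using assms by (simp add: sum.delta)
qed

lemma mat_iterate_Suc:
  assumes fin: "\<And>i. finite (A i)" and a: "a \<in> A i"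
  shows "mat_iterate K A (Suc m) v i a = (\<Sum>c\<in>A (Suc i). real (K i a c) * mat_iterate K A m v (Suc i) c)"
proof -
  have "mat_iterate K A (Suc m) v i a =
      (\<Sum>b\<in>A (i + Suc m). \<Sum>c\<in>A (Suc i). real (K i a c) * real (mat_prod K A (Suc i) m c b) * v (i + Suc m) b)"
    unfolding mat_iterate_def
    by (rule sum.cong[OF refl], subst mat_prod_Suc_left[where A = A and i = i and a = a, OF fin a])
      (simp_all add: sum_distrib_right)
  also have "\<dots> = (\<Sum>c\<in>A (Suc i). \<Sum>b\<in>A (i + Suc m). real (K i a c) * real (mat_prod K A (Suc i) m c b) * v (i + Suc m) b)"
    by (rule sum.swap)
  finally show ?thesis unfolding mat_iterate_def by (simp add: sum_distrib_left mult.assoc)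
qed

locale block_system = subsystem K A B + blk: primitive_system K B
  for K :: "'v matseq" and A B :: "'v alphabets" +
  assumes convex: "\<And>x n j m. x \<in> path_space K A \<Longrightarrow> src (x n) \<in> B n \<Longrightarrow> n \<le> j \<Longrightarrow> j \<le> m \<Longrightarrow>
    src (x m) \<in> B m \<Longrightarrow> src (x j) \<in> B j"
begin

lemma eventually_in_block:
  assumes "x \<in> saturation K A (path_space K B)"
  shows "\<exists>N. \<forall>i\<ge>N. src (x i) \<in> B i"
proof -
  obtain y n where y: "y \<in> path_space K B" "\<forall>i>n. y i = x i" using assms by (rule saturationE)
  have "src (x i) \<in> B i" if "i \<ge> Suc n" for i
  proof -
    have "src (y i) \<in> B i" using y(1) path_space_B_iff by blast
    then show ?thesis using y(2) that by simp
  qed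
  then show ?thesis by blast
qed

lemma stays_in_block:
  assumes x: "x \<in> saturation K A (path_space K B)" and n: "src (x n) \<in> B n" "n \<le> j"
  shows "src (x j) \<in> B j"
proof -
  obtain N where N: "\<forall>i\<ge>N. src (x i) \<in> B i" using eventually_in_block[OF x] ..
  show ?thesis
    by (rule convex[where x = x and n = n and j = j and m = "max N j"])
      (use x saturation_subset N n in auto)
qed

end

locale block_measure = block_system K A B
  for K :: "'v matseq" and A B :: "'v alphabets" +
  fixes \<nu> :: "'v path measure"
  assumes inv: "invariant_borel_measure K A \<nu>"
    and null: "emeasure \<nu> (path_space K A - FC_orbit K A (path_space K B)) = 0"
begin

abbreviation "orb \<equiv> saturation K A (path_space K B)"

lemma orb_sets: "orb \<in> sets (path_borel K A)"
  by (rule saturation_sets[OF fin path_space_B_sets])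

lemma null_off_orbit: "emeasure \<nu> (path_space K A - orb) = 0"
  using null unfolding FC_orbit_eq_saturation[OF path_space_sub] .

lemma restrict_orb:
  assumes E: "E \<in> sets (path_borel K A)"
  shows "emeasure \<nu> (E \<inter> orb) = emeasure \<nu> E"
proof (rule antisym)
  note sn = inv_sets[OF inv]
  show "emeasure \<nu> (E \<inter> orb) \<le> emeasure \<nu> E" using E sn by (intro emeasure_mono) auto
  have EO: "E \<inter> orb \<in> sets \<nu>" "path_space K A - orb \<in> sets \<nu>"
    unfolding sn by (rule sets.Int[OF E orb_sets], rule sets.Diff[OF path_space_in_sets orb_sets])
  have "emeasure \<nu> E \<le> emeasure \<nu> ((E \<inter> orb) \<union> (path_space K A - orb))"
    using Borel_subset[OF E] EO by (intro emeasure_mono sets.Un) auto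
  also have "\<dots> \<le> emeasure \<nu> (E \<inter> orb) + emeasure \<nu> (path_space K A - orb)"
    by (rule emeasure_subadditive[OF EO])
  finally show "emeasure \<nu> E \<le> emeasure \<nu> (E \<inter> orb)" using null_off_orbit by simp
qed

abbreviation "\<rho> \<equiv> restrict_space \<nu> (path_space K B)"

lemmas rho = sets_restrict_B[OF inv_sets[OF inv]]

lemma rho_inv: "invariant_borel_measure K B \<rho>"
  by (rule restrict_invariant[OF inv])

text \<open>A path that starts with a word in the block and is eventually in the block never leaves it, so the
  rest of the cylinder is null.\<close>

lemma block_cylinder:
  assumes f: "word K B n f"
  shows "emeasure \<nu> (cylinder K A n f) = emeasure \<rho> (cylinder K B n f)"
proof -
  have "cylinder K A n f \<inter> orb = cylinder K B n f"
  proof (intro equalityI subsetI)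
    fix x assume x: "x \<in> cylinder K A n f \<inter> orb"
    then have xc: "x \<in> cylinder K A n f" "x \<in> path_space K A" using cylinder_subset by blast+
    have "src (x 0) \<in> B 0"
      using xc(1) f src_in[of "f 0" K B 0] unfolding cylinder_def word_def by simp
    then have "src (x i) \<in> B i" for i using x stays_in_block[of x 0 i] by blast
    then have "x \<in> path_space K B" using path_space_B_iff xc(2) by blast
    then show "x \<in> cylinder K B n f" using xc(1) unfolding cylinder_B by blast
  next
    fix x assume "x \<in> cylinder K B n f"
    then show "x \<in> cylinder K A n f \<inter> orb"
      using subset_saturation[OF path_space_sub] unfolding cylinder_B by blast
  qed
  then have "emeasure \<nu> (cylinder K A n f) = emeasure \<nu> (cylinder K B n f)"
    using restrict_orb[OF cylinder_in_sets, of n f] by simp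
  then show ?thesis using rho(3)[OF cylinder_subset] by metis
qed

text \<open>However a word got into the block, its cylinder has the measure of one inside the block, since a word
  of the block ends at the same vertex.\<close>

lemma entering_cylinder:
  assumes e: "word K A n e" and b: "tgt (e n) \<in> B (Suc n)"
  shows "\<exists>f. word K B n f \<and> tgt (f n) = tgt (e n) \<and>
    emeasure \<nu> (cylinder K A n e) = emeasure \<rho> (cylinder K B n f)"
proof -
  obtain f where f: "word K B n f" "tgt (f n) = tgt (e n)"
    using blk.reached b unfolding all_reached_def by blast
  have "emeasure \<nu> (cylinder K A n e) = emeasure \<nu> (cylinder K A n f)"
    by (rule cylinder_measure_cong[OF inv e word_sub[OF f(1)] f(2)[symmetric]])
  then show ?thesis using f block_cylinder[OF f(1)] by metis
qed

lemma block_dichotomy: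
  assumes pos: "emeasure \<nu> (path_space K B) \<noteq> 0"
  shows "(\<forall>U. openin (path_topology K B) U \<and> U \<noteq> {} \<longrightarrow> emeasure \<rho> U = \<infinity>) \<or>
    (\<forall>U. openin (path_topology K B) U \<and> U \<noteq> {} \<longrightarrow> 0 < emeasure \<rho> U \<and> emeasure \<rho> U < \<infinity>)"
proof -
  have pos': "emeasure \<rho> (path_space K B) \<noteq> 0" using pos rho(3)[OF subset_refl] by simp
  show ?thesis
  proof (cases "emeasure \<rho> (path_space K B) = \<infinity>")
    case True
    then show ?thesis using blk.open_infinite[OF rho_inv] by blast
  next
    case False
    have "0 < emeasure \<rho> U \<and> emeasure \<rho> U < \<infinity>" if U: "openin (path_topology K B) U" "U \<noteq> {}" for U
    proof
      show "0 < emeasure \<rho> U" using blk.open_positive[OF rho_inv pos' U] by (simp add: zero_less_iff_neq_zero)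
      have "emeasure \<rho> U \<le> emeasure \<rho> (path_space K B)"
        using Borel_subset[OF open_in_sets[OF U(1)]] rho(1) path_space_in_sets by (intro emeasure_mono) simp_all
      then show "emeasure \<rho> U < \<infinity>" using False by (simp add: less_top top_unique order.strict_trans1)
    qed
    then show ?thesis by blast
  qed
qed

text \<open>The cylinder of the larger space around a path in the block is open and has the measure of its trace
  on the block.  Conversely an open set of positive measure contains a cylinder that ends in the block, whose finite
  measure is that of a cylinder in the block.\<close>

lemma finite_on_open_iff:
  assumes pos: "emeasure \<nu> (path_space K B) \<noteq> 0"
  shows "(\<exists>U. openin (path_topology K A) U \<and> 0 < emeasure \<nu> U \<and> emeasure \<nu> U < \<infinity>) \<longleftrightarrow>
    (0 < emeasure \<rho> (space \<rho>) \<and> emeasure \<rho> (space \<rho>) < \<infinity>)"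
proof -
  have pos': "emeasure \<rho> (path_space K B) \<noteq> 0" using pos rho(3)[OF subset_refl] by simp
  show ?thesis unfolding rho(2)
  proof
    assume "0 < emeasure \<rho> (path_space K B) \<and> emeasure \<rho> (path_space K B) < \<infinity>"
    then have fin: "emeasure \<rho> (path_space K B) < \<infinity>" ..
    have "path_space K B \<noteq> {}" using pos' by auto
    then obtain x where x: "x \<in> path_space K B" by blast
    have eq: "emeasure \<nu> (cylinder K A 0 x) = emeasure \<rho> (cylinder K B 0 x)"
      by (rule block_cylinder[OF path_word[OF x]])
    have ne: "cylinder K B 0 x \<noteq> {}" using in_cylinder_self[OF x] by blast
    have "emeasure \<rho> (cylinder K B 0 x) \<noteq> 0"
      by (rule blk.open_positive[OF rho_inv pos' openin_cylinder ne])
    moreover have "emeasure \<rho> (cylinder K B 0 x) \<le> emeasure \<rho> (path_space K B)"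
      using rho(1) by (intro emeasure_mono cylinder_subset) simp
    ultimately have "0 < emeasure \<nu> (cylinder K A 0 x) \<and> emeasure \<nu> (cylinder K A 0 x) < \<infinity>"
      unfolding eq using fin by (auto simp: zero_less_iff_neq_zero order.strict_trans1)
    then show "\<exists>U. openin (path_topology K A) U \<and> 0 < emeasure \<nu> U \<and> emeasure \<nu> U < \<infinity>"
      using openin_cylinder by blast
  next
    assume "\<exists>U. openin (path_topology K A) U \<and> 0 < emeasure \<nu> U \<and> emeasure \<nu> U < \<infinity>"
    then obtain U where U: "openin (path_topology K A) U" "0 < emeasure \<nu> U" "emeasure \<nu> U < \<infinity>" by blast
    note Us = open_in_sets[OF U(1)]
    have "U \<inter> orb \<noteq> {}" using restrict_orb[OF Us] U(2) by auto
    then obtain x where x: "x \<in> U" "x \<in> orb" by blast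
    have xA: "x \<in> path_space K A" using x(2) saturation_subset by blast
    have "\<forall>x\<in>U. \<exists>n. cylinder K A n x \<subseteq> U" using U(1) unfolding openin_path_iff by (rule conjunct2)
    then obtain n where n: "cylinder K A n x \<subseteq> U" using x(1) by blast
    obtain N where N: "\<forall>i\<ge>N. src (x i) \<in> B i" using eventually_in_block[OF x(2)] ..
    define m where "m = max n N"
    have xw: "word K A m x" by (rule path_word[OF xA])
    have "tgt (x m) = src (x (Suc m))" using xA by (simp add: path_space_def)
    then have "tgt (x m) \<in> B (Suc m)" using N unfolding m_def by simp
    then obtain f where f: "word K B m f" "emeasure \<nu> (cylinder K A m x) = emeasure \<rho> (cylinder K B m f)"
      using entering_cylinder[OF xw] by blast
    have "emeasure \<nu> (cylinder K A m x) \<le> emeasure \<nu> U"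
      using n cylinder_antimono[of n m K A x] Us inv_sets[OF inv]
      unfolding m_def by (intro emeasure_mono) auto
    then have lt: "emeasure \<rho> (cylinder K B m f) < \<infinity>" using U(3) f(2) by simp
    have "emeasure \<rho> (path_space K B) \<noteq> \<infinity>"
    proof
      assume "emeasure \<rho> (path_space K B) = \<infinity>"
      then have "emeasure \<rho> (cylinder K B m f) = \<infinity>"
        by (rule blk.open_infinite[OF rho_inv _ openin_cylinder blk.cylinder_nonempty[OF f(1)]])
      then show False using lt by simp
    qed
    then show "0 < emeasure \<rho> (path_space K B) \<and> emeasure \<rho> (path_space K B) < \<infinity>"
      using pos' by (simp add: zero_less_iff_neq_zero less_top)
  qed
qed

text \<open>Of the paths that start with the given word, the \<open>m\<close>-th iterate counts those that are in the block \<open>m\<close>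
  levels after the end of the word, each continuation weighted by the measure of a cylinder ending there.\<close>

lemma iterate_measure:
  assumes r: "represents K B w \<rho>" and w: "w \<in> eigen_cone0 K B"
  shows "word K A n e \<Longrightarrow>
    emeasure \<nu> (cylinder K A n e \<inter> {x \<in> path_space K A. src (x (Suc n + m)) \<in> B (Suc n + m)}) =
    ennreal (mat_iterate K A m (zero_fill B w) (Suc n) (tgt (e n)))"
proof (induction m arbitrary: n e)
  case 0
  have tA: "tgt (e n) \<in> A (Suc n)" by (rule word_tgt[OF 0])
  have src: "src (x (Suc n)) = tgt (e n)" if "x \<in> cylinder K A n e" for x
    using cylinder_tgt[OF that] by simp
  show ?case
  proof (cases "tgt (e n) \<in> B (Suc n)")
    case True
    have "cylinder K A n e \<inter> {x \<in> path_space K A. src (x (Suc n + 0)) \<in> B (Suc n + 0)} = cylinder K A n e"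
      using src True cylinder_subset[of K A n e] by auto
    moreover obtain f where f: "word K B n f" "tgt (f n) = tgt (e n)"
      "emeasure \<nu> (cylinder K A n e) = emeasure \<rho> (cylinder K B n f)"
      using entering_cylinder[OF 0 True] by blast
    moreover have "mat_iterate K A 0 (zero_fill B w) (Suc n) (tgt (e n)) = w (Suc n) (tgt (e n))"
      using mat_iterate_0[where A = A and i = "Suc n", OF fin tA] True by (simp add: zero_fill_def)
    ultimately show ?thesis using representsD(2)[OF r f(1)] by simp
  next
    case False
    have "cylinder K A n e \<inter> {x \<in> path_space K A. src (x (Suc n + 0)) \<in> B (Suc n + 0)} = {}"
      using src False by auto
    moreover have "mat_iterate K A 0 (zero_fill B w) (Suc n) (tgt (e n)) = 0"
      using mat_iterate_0[where A = A and i = "Suc n", OF fin tA] False by (simp add: zero_fill_def)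
    ultimately show ?thesis by simp
  qed
next
  case (Suc m)
  let ?V = "{x \<in> path_space K A. src (x (Suc n + Suc m)) \<in> B (Suc n + Suc m)}"
  have tA: "tgt (e n) \<in> A (Suc n)" by (rule word_tgt[OF Suc.prems])
  have V: "?V \<in> sets (path_borel K A)" by (rule coordinate_event_sets)
  have nn: "0 \<le> mat_iterate K A m (zero_fill B w) i a" for i a
    unfolding mat_iterate_def zero_fill_def using eigen_nonneg[OF w] by (intro sum_nonneg) simp
  have "emeasure \<nu> (cylinder K A n e \<inter> ?V) =
      (\<Sum>g\<in>out_edges K A (Suc n) (tgt (e n)). emeasure \<nu> (cylinder K A (Suc n) (e(Suc n := g)) \<inter> ?V))"
    by (rule emeasure_cylinder_split[OF fin inv_sets[OF inv] V])
  also have "\<dots> = (\<Sum>g\<in>out_edges K A (Suc n) (tgt (e n)).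
      ennreal (mat_iterate K A m (zero_fill B w) (Suc (Suc n)) (tgt g)))"
  proof (rule sum.cong[OF refl])
    fix g assume g: "g \<in> out_edges K A (Suc n) (tgt (e n))"
    have "word K A (Suc n) (e(Suc n := g))" by (intro word_snoc Suc.prems out_edgesD[OF g])
    from Suc.IH[OF this]
    show "emeasure \<nu> (cylinder K A (Suc n) (e(Suc n := g)) \<inter> ?V) =
        ennreal (mat_iterate K A m (zero_fill B w) (Suc (Suc n)) (tgt g))"
      by (simp only: add_Suc add_Suc_right fun_upd_same)
  qed
  also have "\<dots> = ennreal (\<Sum>g\<in>out_edges K A (Suc n) (tgt (e n)).
      mat_iterate K A m (zero_fill B w) (Suc (Suc n)) (tgt g))"
    by (rule sum_ennreal) (rule nn)
  also have "(\<Sum>g\<in>out_edges K A (Suc n) (tgt (e n)). mat_iterate K A m (zero_fill B w) (Suc (Suc n)) (tgt g)) =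
      mat_iterate K A (Suc m) (zero_fill B w) (Suc n) (tgt (e n))"
    unfolding mat_iterate_Suc[where A = A and i = "Suc n", OF fin tA]
    by (rule sum_out_edges[where A = A and i = "Suc n", OF fin tA])
  finally show ?case .
qed

text \<open>Almost every path of the cylinder ends up in the block and does not leave it again, so the events
  of being in the block at a given level increase to the cylinder.\<close>

lemma iterate_tendsto:
  assumes r: "represents K B w \<rho>" and w: "w \<in> eigen_cone0 K B" and e: "word K A n e"
  shows "(\<lambda>m. ennreal (mat_iterate K A m (zero_fill B w) (Suc n) (tgt (e n)))) \<longlonglongrightarrow> emeasure \<nu> (cylinder K A n e)"
proof -
  define W where "W m = cylinder K A n e \<inter> {x \<in> path_space K A. src (x (Suc n + m)) \<in> B (Suc n + m)}" for m
  have WA: "W m \<in> sets (path_borel K A)" for m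
    unfolding W_def by (rule sets.Int[OF cylinder_in_sets coordinate_event_sets])
  have "(\<lambda>m. emeasure \<nu> (W m \<inter> orb)) \<longlonglongrightarrow> emeasure \<nu> (\<Union>m. W m \<inter> orb)"
  proof (rule Lim_emeasure_incseq)
    show "range (\<lambda>m. W m \<inter> orb) \<subseteq> sets \<nu>"
      unfolding inv_sets[OF inv] by (intro image_subsetI sets.Int WA orb_sets)
    show "incseq (\<lambda>m. W m \<inter> orb)"
    proof (rule incseq_SucI, rule subsetI)
      fix m x assume x: "x \<in> W m \<inter> orb"
      then have "src (x (Suc n + Suc m)) \<in> B (Suc n + Suc m)"
        using stays_in_block[of x "Suc n + m" "Suc n + Suc m"] unfolding W_def by simp
      then show "x \<in> W (Suc m) \<inter> orb" using x unfolding W_def by simp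
    qed
  qed
  also have "(\<Union>m. W m \<inter> orb) = cylinder K A n e \<inter> orb"
  proof (intro equalityI subsetI)
    fix x assume x: "x \<in> cylinder K A n e \<inter> orb"
    obtain N where N: "\<forall>i\<ge>N. src (x i) \<in> B i" using eventually_in_block[of x] x by blast
    then have "src (x (Suc n + N)) \<in> B (Suc n + N)" by simp
    then have "x \<in> W N" using x cylinder_subset[of K A n e] unfolding W_def by blast
    then show "x \<in> (\<Union>m. W m \<inter> orb)" using x by blast
  qed (auto simp: W_def)
  finally show ?thesis
    unfolding restrict_orb[OF WA] restrict_orb[OF cylinder_in_sets]
    unfolding W_def iterate_measure[OF r w e] .
qed

lemma iterate_limit:
  assumes r: "represents K B w \<rho>" and w: "w \<in> eigen_cone0 K B" and e: "word K A n e"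
  shows "convergent (\<lambda>m. mat_iterate K A m (zero_fill B w) (Suc n) (tgt (e n))) \<longleftrightarrow>
      emeasure \<nu> (cylinder K A n e) < \<infinity>"
    and "convergent (\<lambda>m. mat_iterate K A m (zero_fill B w) (Suc n) (tgt (e n))) \<Longrightarrow>
      emeasure \<nu> (cylinder K A n e) = ennreal (lim (\<lambda>m. mat_iterate K A m (zero_fill B w) (Suc n) (tgt (e n))))"
proof -
  let ?s = "\<lambda>m. mat_iterate K A m (zero_fill B w) (Suc n) (tgt (e n))"
  have nn: "0 \<le> ?s m" for m
    unfolding mat_iterate_def zero_fill_def using eigen_nonneg[OF w] by (intro sum_nonneg) simp
  note t = iterate_tendsto[OF r w e]
  show 2: "emeasure \<nu> (cylinder K A n e) = ennreal (lim ?s)" if "convergent ?s"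
  proof -
    have "?s \<longlonglongrightarrow> lim ?s" using that by (simp add: convergent_LIMSEQ_iff)
    then have "(\<lambda>m. ennreal (?s m)) \<longlonglongrightarrow> ennreal (lim ?s)" by (rule tendsto_ennrealI)
    then show ?thesis using t LIMSEQ_unique by blast
  qed
  show "convergent ?s \<longleftrightarrow> emeasure \<nu> (cylinder K A n e) < \<infinity>"
  proof
    assume "convergent ?s"
    then show "emeasure \<nu> (cylinder K A n e) < \<infinity>" using 2 by simp
  next
    assume "emeasure \<nu> (cylinder K A n e) < \<infinity>"
    then obtain L where L: "0 \<le> L" "emeasure \<nu> (cylinder K A n e) = ennreal L"
      by (cases "emeasure \<nu> (cylinder K A n e)") auto
    then have "?s \<longlonglongrightarrow> L" using t tendsto_ennreal_iff[of ?s sequentially L] nn by simp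
    then show "convergent ?s" by (rule convergentI)
  qed
qed

text \<open>Cylinders see the limits only at vertices that some word reaches from level 0.  At the others, and at
  level 0, convergence is inherited along the outgoing edges; the rank bounds how long that takes.\<close>

lemma finite_iff_distinguished:
  fixes rank :: "nat \<Rightarrow> 'v \<Rightarrow> nat"
  assumes r: "represents K B w \<rho>" and w: "w \<in> eigen_cone K B"
    and rank: "\<And>n a. a \<in> A (Suc n) \<Longrightarrow> (\<exists>e. word K A n e \<and> tgt (e n) = a) \<or>
      (\<forall>b\<in>A (Suc (Suc n)). K (Suc n) a b \<noteq> 0 \<longrightarrow> rank (Suc (Suc n)) b < rank (Suc n) a)"
  shows "emeasure \<nu> (space \<nu>) < \<infinity> \<longleftrightarrow> distinguished K A B w"
proof
  have w0: "w \<in> eigen_cone0 K B" using w by (simp add: eigen_cone_def)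
  let ?s = "\<lambda>i a m. mat_iterate K A m (zero_fill B w) i a"
  note lim = iterate_limit[OF r w0]
  {
    assume fnu: "emeasure \<nu> (space \<nu>) < \<infinity>"
    have cf: "emeasure \<nu> (cylinder K A n e) < \<infinity>" for n e
      using fnu emeasure_space[of \<nu> "cylinder K A n e"] by (rule order.strict_trans1[rotated])
    have step: "convergent (?s i a)"
      if a: "a \<in> A i" and b: "\<And>b. b \<in> A (Suc i) \<Longrightarrow> K i a b \<noteq> 0 \<Longrightarrow> convergent (?s (Suc i) b)" for i a
    proof -
      have "convergent (\<lambda>m. real (K i a b) * ?s (Suc i) b m)" if "b \<in> A (Suc i)" for b
        using b[OF that] by (cases "K i a b = 0") (auto intro: convergent_mult convergent_const)
      then have "convergent (\<lambda>m. \<Sum>b\<in>A (Suc i). real (K i a b) * ?s (Suc i) b m)"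
        by (rule convergent_sum)
      then have "convergent (\<lambda>m. ?s i a (Suc m))"
        unfolding mat_iterate_Suc[where A = A and i = i, OF fin a] .
      then show ?thesis by (subst (asm) convergent_Suc_iff)
    qed
    have reach: "convergent (?s (Suc n) a)" if "a \<in> A (Suc n)" for n a
      using that
    proof (induction "rank (Suc n) a" arbitrary: n a rule: less_induct)
      case less
      from rank[OF less.prems] show ?case
      proof
        assume "\<exists>e. word K A n e \<and> tgt (e n) = a"
        then obtain e where "word K A n e" "tgt (e n) = a" by blast
        then show ?thesis using lim(1)[of n e] cf by simp
      next
        assume dec: "\<forall>b\<in>A (Suc (Suc n)). K (Suc n) a b \<noteq> 0 \<longrightarrow> rank (Suc (Suc n)) b < rank (Suc n) a"
        show ?thesis
        proof (rule step[OF less.prems])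
          fix b assume b: "b \<in> A (Suc (Suc n))" "K (Suc n) a b \<noteq> 0"
          show "convergent (?s (Suc (Suc n)) b)"
            by (rule less.hyps[OF dec[rule_format, OF b] b(1)])
        qed
      qed
    qed
    have "convergent (?s i a)" if a: "a \<in> A i" for i a
    proof (cases i)
      case 0
      show ?thesis unfolding 0 by (rule step) (use a 0 reach in simp_all)
    next
      case (Suc n)
      show ?thesis unfolding Suc by (rule reach) (use a Suc in simp)
    qed
    then show "distinguished K A B w" unfolding distinguished_def using w by blast
  }
  assume d: "distinguished K A B w"
  have cl: "emeasure \<nu> (cylinder K A 0 (\<lambda>_. g)) \<noteq> \<infinity>" if g: "g \<in> edges K A 0" for g
  proof -
    have "convergent (\<lambda>m. mat_iterate K A m (zero_fill B w) (Suc 0) (tgt g))"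
      using d tgt_in[OF g] unfolding distinguished_def by blast
    then show ?thesis using lim(2)[OF word_0[OF g]] by simp
  qed
  have "(\<Sum>g\<in>edges K A 0. emeasure \<nu> (cylinder K A 0 (\<lambda>_. g))) \<noteq> \<infinity>"
  proof
    assume "(\<Sum>g\<in>edges K A 0. emeasure \<nu> (cylinder K A 0 (\<lambda>_. g))) = \<infinity>"
    then have "\<exists>g\<in>edges K A 0. emeasure \<nu> (cylinder K A 0 (\<lambda>_. g)) = \<infinity>"
      using finite_edges[of A K 0, OF fin] by simp
    then show False using cl by blast
  qed
  then have "(\<Sum>g\<in>edges K A 0. emeasure \<nu> (cylinder K A 0 (\<lambda>_. g))) < \<infinity>"
    by (simp add: less_top)
  then show "emeasure \<nu> (space \<nu>) < \<infinity>"
    unfolding inv_space[OF inv] emeasure_path_space_split[OF fin inv_sets[OF inv]] .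
qed

lemma distinguished_eq_eigen_measure:
  assumes r: "represents K B w \<rho>" and d: "distinguished K A B w"
  shows "\<nu> = eigen_measure K A (iota K A B w)"
proof -
  have w0: "w \<in> eigen_cone0 K B" using d by (simp add: distinguished_def eigen_cone_def)
  have "represents K A (iota K A B w) \<nu>"
    unfolding represents_def
  proof (intro conjI allI impI)
    show "sets \<nu> = sets (path_borel K A)" by (rule inv_sets[OF inv])
    fix n e assume e: "word K A n e"
    have "convergent (\<lambda>m. mat_iterate K A m (zero_fill B w) (Suc n) (tgt (e n)))"
      using d word_tgt[OF e] unfolding distinguished_def by blast
    then show "emeasure \<nu> (cylinder K A n e) = ennreal (iota K A B w (Suc n) (tgt (e n)))"
      using iterate_limit(2)[OF r w0 e] word_tgt[OF e] by (simp add: iota_def)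
  qed
  then show ?thesis by (rule eigen_measure_eqI[OF fin, symmetric])
qed

end

section \<open>Sequences in fixed-size Frobenius normal form\<close>

lemma zero_seqD: "zero_seq K A \<Longrightarrow> a \<in> A i \<Longrightarrow> b \<in> A (Suc i) \<Longrightarrow> K i a b = 0"
  by (simp add: zero_seq_def)

locale frobenius =
  fixes l lh :: nat and M :: "'v matseq" and A :: "'v alphabets" and B :: "nat \<Rightarrow> 'v alphabets"
  assumes nf: "fixed_size_frobenius_nf l lh M A B"
begin

lemma nf_alphabets: "\<forall>i. finite (A i) \<and> card (A i) = l"
  using nf unfolding fixed_size_frobenius_nf_def by (elim conjE)

lemma nf_partition: "\<forall>i. A i = (\<Union>k\<in>{1..lh}. B k i) \<and> disjoint_family_on (\<lambda>k. B k i) {1..lh}"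
  using nf unfolding fixed_size_frobenius_nf_def by (elim conjE)

lemma nf_triangular: "\<forall>j\<in>{1..lh}. \<forall>k\<in>{1..lh}. k < j \<longrightarrow> (\<forall>i. \<forall>a\<in>B j i. \<forall>b\<in>B k (Suc i). M i a b = 0)"
  using nf unfolding fixed_size_frobenius_nf_def by (elim conjE)

lemma nf_blocks: "\<forall>k\<in>{1..lh}. zero_seq M (B k) \<or> (reduced M (B k) \<and> primitive M (B k))"
  using nf unfolding fixed_size_frobenius_nf_def by (elim conjE)

lemma finA: "finite (A i)"
  by (rule conjunct1[OF spec[OF nf_alphabets]])

lemma A_blocks: "A i = (\<Union>k\<in>{1..lh}. B k i)"
  by (rule conjunct1[OF spec[OF nf_partition]])

lemma blocks_disjoint: "disjoint_family_on (\<lambda>k. B k i) {1..lh}"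
  by (rule conjunct2[OF spec[OF nf_partition]])

lemma triangular:
  assumes "j \<in> {1..lh}" "k \<in> {1..lh}" "k < j" "a \<in> B j i" "b \<in> B k (Suc i)"
  shows "M i a b = 0"
  by (rule nf_triangular[rule_format, OF assms])

lemma block_kind: "k \<in> {1..lh} \<Longrightarrow> zero_seq M (B k) \<or> (reduced M (B k) \<and> primitive M (B k))"
  by (rule nf_blocks[rule_format])

definition block_of :: "nat \<Rightarrow> 'v \<Rightarrow> nat" where
  "block_of i a = (THE k. k \<in> {1..lh} \<and> a \<in> B k i)"

lemma block_of_eq:
  assumes "k \<in> {1..lh}" "a \<in> B k i" shows "block_of i a = k"
  unfolding block_of_def
proof (rule the_equality)
  show "k \<in> {1..lh} \<and> a \<in> B k i" using assms by blast
  show "j = k" if "j \<in> {1..lh} \<and> a \<in> B j i" for j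
    using that assms blocks_disjoint[of i] unfolding disjoint_family_on_def by blast
qed

lemma block_of:
  assumes "a \<in> A i" shows "block_of i a \<in> {1..lh}" "a \<in> B (block_of i a) i"
proof -
  obtain k where k: "k \<in> {1..lh}" "a \<in> B k i" using assms A_blocks by blast
  show "block_of i a \<in> {1..lh}" "a \<in> B (block_of i a) i" using k block_of_eq[OF k] by simp_all
qed

lemma block_of_mono:
  assumes "a \<in> A i" "b \<in> A (Suc i)" "M i a b \<noteq> 0"
  shows "block_of i a \<le> block_of (Suc i) b"
  using triangular[OF block_of(1)[OF assms(1)] block_of(1)[OF assms(2)] _ block_of(2)[OF assms(1)] block_of(2)[OF assms(2)]]
    assms(3) by (meson not_le)

lemma path_src: "x \<in> path_space M A \<Longrightarrow> src (x i) \<in> A i"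
  using src_in unfolding path_space_def by blast

lemma path_step:
  assumes x: "x \<in> path_space M A"
  shows "M i (src (x i)) (src (x (Suc i))) \<noteq> 0"
proof -
  have "x i \<in> edges M A i" "tgt (x i) = src (x (Suc i))" using x by (auto simp: path_space_def)
  then show ?thesis by (auto simp: edges_def src_def tgt_def)
qed

lemma path_block_mono:
  assumes x: "x \<in> path_space M A" and ij: "i \<le> j"
  shows "block_of i (src (x i)) \<le> block_of j (src (x j))"
  by (rule lift_Suc_mono_le[OF _ ij, of "\<lambda>i. block_of i (src (x i))"])
    (rule block_of_mono[OF path_src[OF x] path_src[OF x] path_step[OF x]])

lemma subsys: "k \<in> {1..lh} \<Longrightarrow> subsystem A (B k)"
  by unfold_locales (use finA A_blocks in auto)

lemma nonzero_block:
  assumes k: "k \<in> {1..lh}" and x: "x \<in> path_space M A" "src (x i) \<in> B k i" "src (x (Suc i)) \<in> B k (Suc i)"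
  shows "reduced M (B k) \<and> primitive M (B k)"
proof -
  have "\<not> zero_seq M (B k)" using zero_seqD[where K = M, OF _ x(2,3)] path_step[OF x(1), of i] by blast
  then show ?thesis using block_kind[OF k] by blast
qed

lemma block_sys:
  assumes k: "k \<in> {1..lh}" and rp: "reduced M (B k) \<and> primitive M (B k)"
  shows "block_system M A (B k)"
proof -
  interpret subsystem M A "B k" by (rule subsys[OF k])
  show ?thesis
  proof (unfold_locales)
    show "finite (B k i)" for i by (rule finB)
    show "reduced M (B k)" "primitive M (B k)" using rp by blast+
    fix x n j m
    assume x: "x \<in> path_space M A" "src (x n) \<in> B k n" "n \<le> j" "j \<le> m" "src (x m) \<in> B k m"
    have "block_of j (src (x j)) = k"
      using path_block_mono[OF x(1) x(3)] path_block_mono[OF x(1) x(4)] block_of_eq[OF k x(2)] block_of_eq[OF k x(5)]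
      by simp
    then show "src (x j) \<in> B k j" using block_of(2)[OF path_src[OF x(1), of j]] by simp
  qed
qed

text \<open>The block number of the vertices along a path is nondecreasing, hence eventually constant, and the
  path then differs from a path inside that block in a prefix only.\<close>

lemma path_in_some_orbit:
  assumes x: "x \<in> path_space M A"
  shows "\<exists>k\<in>{1..lh}. x \<in> saturation M A (path_space M (B k))"
proof -
  define \<kappa> where "\<kappa> i = block_of i (src (x i))" for i
  have rng: "range \<kappa> \<subseteq> {1..lh}" unfolding \<kappa>_def using block_of(1)[OF path_src[OF x]] by blast
  then have fr: "finite (range \<kappa>)" using finite_subset by blast
  define k where "k = Max (range \<kappa>)"
  have kr: "k \<in> range \<kappa>" unfolding k_def using fr by (intro Max_in) auto
  then obtain N where N: "\<kappa> N = k" by blast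
  have k: "k \<in> {1..lh}" using kr rng by blast
  have const: "src (x i) \<in> B k i" if "N \<le> i" for i
  proof -
    have "\<kappa> N \<le> \<kappa> i" unfolding \<kappa>_def by (rule path_block_mono[OF x that])
    moreover have "\<kappa> i \<le> k" unfolding k_def using fr by (intro Max_ge) auto
    ultimately have "\<kappa> i = k" using N by simp
    then show ?thesis using block_of(2)[OF path_src[OF x, of i]] unfolding \<kappa>_def by simp
  qed
  have "reduced M (B k) \<and> primitive M (B k)"
    by (rule nonzero_block[OF k x const[OF order_refl] const[OF le_SucI[OF order_refl]]])
  then interpret block_system M A "B k" by (rule block_sys[OF k])
  have "src (x (Suc N)) \<in> B k (Suc N)" by (rule const) simp
  then obtain f where f: "word M (B k) N f" "tgt (f N) = src (x (Suc N))"
    using blk.reached unfolding all_reached_def by blast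
  let ?y = "replace_prefix N f x"
  have y: "?y \<in> path_space M A"
    by (rule subsetD[OF cylinder_subset replace_prefix_cylinder[OF word_sub[OF f(1)] x f(2)]])
  have "src (?y i) \<in> B k i" for i
  proof (cases "i \<le> N")
    case True
    then show ?thesis using f(1) src_in[of "f i" M "B k" i] by (simp add: replace_prefix_def word_def)
  next
    case False
    then show ?thesis using const by (simp add: replace_prefix_def)
  qed
  then have yB: "?y \<in> path_space M (B k)" using path_space_B_iff y by blast
  have "x \<in> saturation M A (path_space M (B k))"
    by (rule saturationI[where n = N, OF x yB]) (simp add: replace_prefix_def)
  then show ?thesis using k by blast
qed

text \<open>A path cannot have its late vertices in two disjoint subalphabets.\<close>

lemma orbits_disjoint:
  assumes jk: "j \<in> {1..lh}" "k \<in> {1..lh}" "j \<noteq> k"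
  shows "saturation M A (path_space M (B j)) \<inter> saturation M A (path_space M (B k)) = {}"
proof (rule ccontr)
  assume "\<not> ?thesis"
  then obtain x where x: "x \<in> saturation M A (path_space M (B j))" "x \<in> saturation M A (path_space M (B k))" by blast
  obtain y n where y: "y \<in> path_space M (B j)" "\<forall>i>n. y i = x i" using x(1) by (rule saturationE)
  obtain z m where z: "z \<in> path_space M (B k)" "\<forall>i>m. z i = x i" using x(2) by (rule saturationE)
  define i where "i = Suc (max n m)"
  have "y i = x i" "z i = x i" using y(2) z(2) unfolding i_def by simp_all
  moreover have "src (y i) \<in> B j i" "src (z i) \<in> B k i"
    using y(1) z(1) subsystem.path_space_B_iff[OF subsys] jk(1,2) by blast+
  ultimately have "src (x i) \<in> B j i" "src (x i) \<in> B k i" by simp_all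
  then show False using block_of_eq[OF jk(1)] block_of_eq[OF jk(2)] jk(3) by metis
qed

lemma positive_block_nonzero:
  assumes k: "k \<in> {1..lh}" and pos: "positive_on_block M B \<nu> k"
  shows "block_system M A (B k)"
proof -
  have "path_space M (B k) \<noteq> {}" using pos unfolding positive_on_block_def by auto
  then obtain x where x: "x \<in> path_space M (B k)" by blast
  then have "x \<in> path_space M A" "\<forall>i. src (x i) \<in> B k i"
    using subsystem.path_space_B_iff[OF subsys[OF k]] by blast+
  then show ?thesis using nonzero_block[OF k] by (intro block_sys[OF k]) blast
qed

lemma ergodic_measuresD:
  assumes "\<nu> \<in> ergodic_measures M A"
  shows "invariant_borel_measure M A \<nu>" "ergodic (FC M A) \<nu>" "emeasure \<nu> (path_space M A) \<noteq> 0"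
  using assms inv_space[of M A \<nu>] unfolding ergodic_measures_def by auto

lemma orbit_sets: "k \<in> {1..lh} \<Longrightarrow> saturation M A (path_space M (B k)) \<in> sets (path_borel M A)"
  by (rule saturation_sets[OF finA subsystem.path_space_B_sets[OF subsys]])

text \<open>The orbit of a block is invariant, so ergodicity makes it null or conull.\<close>

lemma positive_block_null:
  assumes nu: "\<nu> \<in> ergodic_measures M A" and k: "k \<in> {1..lh}" and pos: "positive_on_block M B \<nu> k"
  shows "emeasure \<nu> (path_space M A - saturation M A (path_space M (B k))) = 0"
proof -
  note D = ergodic_measuresD[OF nu]
  interpret subsystem M A "B k" by (rule subsys[OF k])
  have "emeasure \<nu> (saturation M A (path_space M (B k))) \<noteq> 0"
  proof
    assume "emeasure \<nu> (saturation M A (path_space M (B k))) = 0"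
    then have "emeasure \<nu> (path_space M (B k)) = 0"
      by (rule null_subset[OF inv_sets[OF D(1)] orbit_sets[OF k] _ subset_saturation[OF path_space_sub]])
    then show False using pos by (simp add: positive_on_block_def)
  qed
  then show ?thesis
    using ergodicD[OF D(2) inv_sets[OF D(1)] orbit_sets[OF k] saturation_idem] by blast
qed

lemma unique_positive_block:
  assumes nu: "\<nu> \<in> ergodic_measures M A"
  shows "\<exists>!k. k \<in> {1..lh} \<and> positive_on_block M B \<nu> k"
proof -
  note D = ergodic_measuresD[OF nu] and sn = inv_sets[OF ergodic_measuresD(1)[OF nu]]
  have "\<exists>k\<in>{1..lh}. positive_on_block M B \<nu> k"
  proof (rule ccontr)
    assume none: "\<not> ?thesis"
    have z: "emeasure \<nu> (saturation M A (path_space M (B k))) = 0" if k: "k \<in> {1..lh}" for k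
    proof (rule null_saturation[OF finA D(1) subsystem.path_space_B_sets[OF subsys[OF k]]])
      show "emeasure \<nu> (path_space M (B k)) = 0"
        using none k unfolding positive_on_block_def by (metis zero_less_iff_neq_zero)
    qed
    have "(\<Union>k\<in>{1..lh}. saturation M A (path_space M (B k))) = path_space M A"
      using path_in_some_orbit saturation_subset by blast
    moreover have "emeasure \<nu> (\<Union>k\<in>{1..lh}. saturation M A (path_space M (B k))) \<le>
        (\<Sum>k\<in>{1..lh}. emeasure \<nu> (saturation M A (path_space M (B k))))"
      using orbit_sets sn by (intro emeasure_subadditive_finite) auto
    moreover have "(\<Sum>k\<in>{1..lh}. emeasure \<nu> (saturation M A (path_space M (B k)))) = 0"
      using z by (intro sum.neutral) blast
    ultimately show False using D(3) by simp
  qed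
  then obtain k where k: "k \<in> {1..lh}" "positive_on_block M B \<nu> k" by blast
  show ?thesis
  proof (rule ex1I[of _ k])
    show "k \<in> {1..lh} \<and> positive_on_block M B \<nu> k" using k by blast
    fix j assume j: "j \<in> {1..lh} \<and> positive_on_block M B \<nu> j"
    show "j = k"
    proof (rule ccontr)
      assume "j \<noteq> k"
      have "path_space M (B j) \<subseteq> saturation M A (path_space M (B j))"
        by (rule subset_saturation[OF subsystem.path_space_sub[OF subsys]]) (use j in blast)
      then have "path_space M (B j) \<subseteq> path_space M A - saturation M A (path_space M (B k))"
        using orbits_disjoint[of j k] j k(1) \<open>j \<noteq> k\<close> saturation_subset by blast
      then have "emeasure \<nu> (path_space M (B j)) = 0"
        by (rule null_subset[OF sn sets.Diff[OF path_space_in_sets orbit_sets[OF k(1)]] positive_block_null[OF nu k]])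
      then show False using j by (simp add: positive_on_block_def)
    qed
  qed
qed

lemma positive_block_eq:
  assumes nu: "\<nu> \<in> ergodic_measures M A" and k: "k \<in> {1..lh}" and pos: "positive_on_block M B \<nu> k"
  shows "positive_block M lh B \<nu> = k"
  unfolding positive_block_def
  by (rule the1_equality[OF unique_positive_block[OF nu]]) (use k pos in blast)

lemma block_measure:
  assumes nu: "\<nu> \<in> ergodic_measures M A" and k: "k \<in> {1..lh}" and pos: "positive_on_block M B \<nu> k"
  shows "block_measure M A (B k) \<nu>"
proof -
  interpret block_system M A "B k" by (rule positive_block_nonzero[OF k pos])
  show ?thesis
    by unfold_locales
      (use ergodic_measuresD(1)[OF nu] positive_block_null[OF nu k pos] FC_orbit_eq_saturation[OF path_space_sub] in simp_all)
qed

lemma restrict_in_ergodic_measures: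
  assumes nu: "\<nu> \<in> ergodic_measures M A" and k: "k \<in> {1..lh}" and pos: "positive_on_block M B \<nu> k"
  shows "restrict_space \<nu> (path_space M (B k)) \<in> ergodic_measures M (B k)"
proof -
  interpret block_measure M A "B k" \<nu> by (rule block_measure[OF assms])
  have "ergodic (FC M (B k)) \<rho>" by (rule restrict_ergodic[OF inv ergodic_measuresD(2)[OF nu]])
  moreover have "emeasure \<rho> (space \<rho>) \<noteq> 0"
    using pos rho(3)[OF subset_refl] unfolding rho(2) positive_on_block_def by simp
  ultimately show ?thesis using rho_inv unfolding ergodic_measures_def by blast
qed

text \<open>Injectivity is uniqueness of the invariant extension, surjectivity its existence; the extension of a
  measure on a block is positive on that block, which is then the one selected by \<open>positive_block\<close>.\<close>

lemma restriction_bijective: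
  "bij_betw
     (\<lambda>\<mu>. (positive_block M lh B \<mu>, restrict_space \<mu> (path_space M (B (positive_block M lh B \<mu>)))))
     (ergodic_measures M A)
     (SIGMA k:{1..lh}. ergodic_measures M (B k))"
  (is "bij_betw ?f _ _")
proof -
  have pb: "positive_block M lh B \<mu> \<in> {1..lh}" "positive_on_block M B \<mu> (positive_block M lh B \<mu>)"
    if "\<mu> \<in> ergodic_measures M A" for \<mu>
    using theI'[OF unique_positive_block[OF that]] unfolding positive_block_def by blast+
  show ?thesis
    unfolding bij_betw_def
  proof (intro conjI inj_onI equalityI subsetI)
    fix \<mu> \<nu> assume m: "\<mu> \<in> ergodic_measures M A" and n: "\<nu> \<in> ergodic_measures M A" and eq: "?f \<mu> = ?f \<nu>"
    define k where "k = positive_block M lh B \<mu>"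
    have kn: "positive_block M lh B \<nu> = k" using eq unfolding k_def by simp
    have k: "k \<in> {1..lh}" and pm: "positive_on_block M B \<mu> k" unfolding k_def by (rule pb[OF m])+
    have pn: "positive_on_block M B \<nu> k" using pb(2)[OF n] unfolding kn .
    interpret m: block_measure M A "B k" \<mu> by (rule block_measure[OF m k pm])
    interpret n: block_measure M A "B k" \<nu> by (rule block_measure[OF n k pn])
    show "\<mu> = \<nu>"
    proof (rule m.extension_unique[OF m.inv n.inv _ m.null n.null])
      show "restrict_space \<mu> (path_space M (B k)) = restrict_space \<nu> (path_space M (B k))"
        using eq kn unfolding k_def by simp
    qed
  next
    fix p assume "p \<in> ?f ` ergodic_measures M A"
    then obtain \<mu> where m: "\<mu> \<in> ergodic_measures M A" "p = ?f \<mu>" by blast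
    then show "p \<in> (SIGMA k:{1..lh}. ergodic_measures M (B k))"
      using restrict_in_ergodic_measures[OF m(1) pb[OF m(1)]] pb(1)[OF m(1)] by simp
  next
    fix p assume "p \<in> (SIGMA k:{1..lh}. ergodic_measures M (B k))"
    then obtain k \<mu> where p: "p = (k, \<mu>)" "k \<in> {1..lh}" "\<mu> \<in> ergodic_measures M (B k)" by blast
    interpret subsystem M A "B k" by (rule subsys[OF p(2)])
    have im: "invariant_borel_measure M (B k) \<mu>" and em: "ergodic (FC M (B k)) \<mu>"
      and pm: "emeasure \<mu> (space \<mu>) \<noteq> 0" using p(3) unfolding ergodic_measures_def by auto
    obtain \<nu> where nu: "invariant_borel_measure M A \<nu>" "restrict_space \<nu> (path_space M (B k)) = \<mu>"
      "emeasure \<nu> (path_space M A - FC_orbit M A (path_space M (B k))) = 0"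
      using extension_exists[OF im] by blast
    have en: "ergodic (FC M A) \<nu>" using extension_ergodic[OF nu(1) _ nu(3)] em nu(2) by blast
    have "emeasure \<nu> (path_space M (B k)) = emeasure \<mu> (space \<mu>)"
      using sets_restrict_B(3)[OF inv_sets[OF nu(1)] subset_refl] inv_space[OF im] nu(2) by metis
    then have pos: "emeasure \<nu> (path_space M (B k)) \<noteq> 0" using pm by simp
    have "emeasure \<nu> (space \<nu>) \<noteq> 0"
    proof
      assume "emeasure \<nu> (space \<nu>) = 0"
      then have "emeasure \<nu> (path_space M (B k)) = 0"
        using null_subset[OF inv_sets[OF nu(1)] path_space_in_sets _ path_space_sub] inv_space[OF nu(1)] by simp
      then show False using pos by simp
    qed
    then have ne: "\<nu> \<in> ergodic_measures M A" using nu(1) en unfolding ergodic_measures_def by blast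
    have "positive_on_block M B \<nu> k" using pos unfolding positive_on_block_def by (simp add: zero_less_iff_neq_zero)
    then have "positive_block M lh B \<nu> = k" by (rule positive_block_eq[OF ne p(2)])
    then have "p = ?f \<nu>" using p(1) nu(2) by simp
    then show "p \<in> ?f ` ergodic_measures M A" using ne by (rule image_eqI)
  qed
qed

text \<open>Only vertices of zero blocks can be out of reach of words from level 0, and every edge leaving such a
  vertex leads to a block with a larger number.\<close>

lemma rank_decreases:
  assumes a: "a \<in> A (Suc n)"
  shows "(\<exists>e. word M A n e \<and> tgt (e n) = a) \<or>
    (\<forall>b\<in>A (Suc (Suc n)). M (Suc n) a b \<noteq> 0 \<longrightarrow> lh - block_of (Suc (Suc n)) b < lh - block_of (Suc n) a)"
proof -
  let ?k = "block_of (Suc n) a"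
  have k: "?k \<in> {1..lh}" "a \<in> B ?k (Suc n)" using block_of[OF a] by auto
  from block_kind[OF k(1)] show ?thesis
  proof
    assume z: "zero_seq M (B ?k)"
    have "lh - block_of (Suc (Suc n)) b < lh - ?k" if b: "b \<in> A (Suc (Suc n))" "M (Suc n) a b \<noteq> 0" for b
    proof -
      have "?k \<le> block_of (Suc (Suc n)) b" by (rule block_of_mono[OF a b])
      moreover have "?k \<noteq> block_of (Suc (Suc n)) b"
      proof
        assume "?k = block_of (Suc (Suc n)) b"
        then have "b \<in> B ?k (Suc (Suc n))" using block_of(2)[OF b(1)] by simp
        then have "M (Suc n) a b = 0" by (rule zero_seqD[OF z k(2)])
        then show False using b(2) by simp
      qed
      moreover have "block_of (Suc (Suc n)) b \<le> lh" using block_of(1)[OF b(1)] by simp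
      ultimately show ?thesis by linarith
    qed
    then show ?thesis by blast
  next
    assume "reduced M (B ?k) \<and> primitive M (B ?k)"
    then interpret block_system M A "B ?k" by (rule block_sys[OF k(1)])
    obtain e where "word M (B ?k) n e" "tgt (e n) = a"
      using blk.reached k(2) unfolding all_reached_def by blast
    then show ?thesis using word_sub by blast
  qed
qed

end

section \<open>Ergodic measures and blocks\<close>

theorem theorem5p1:
  fixes M :: "'v matseq" and A :: "'v alphabets" and B :: "nat \<Rightarrow> 'v alphabets"
    and l lh :: nat and \<nu> :: "'v path measure"
  assumes "fixed_size_frobenius_nf l lh M A B"
    and "\<nu> \<in> ergodic_measures M A"
  shows
    "(\<exists>!k. k \<in> {1..lh} \<and> positive_on_block M B \<nu> k) \<and>
     (\<forall>k\<in>{1..lh}. positive_on_block M B \<nu> k \<longrightarrow>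
       (let \<nu>k = restrict_space \<nu> (path_space M (B k));
            pos_finite = (0 < emeasure \<nu>k (space \<nu>k) \<and> emeasure \<nu>k (space \<nu>k) < \<infinity>)
        in
          invariant_borel_measure M (B k) \<nu>k \<and>
          ergodic (FC M (B k)) \<nu>k \<and>
          \<nu> = invariant_extension M A (B k) \<nu>k \<and>
          ((\<forall>U. openin (path_topology M (B k)) U \<and> U \<noteq> {} \<longrightarrow> emeasure \<nu>k U = \<infinity>) \<or>
           (\<forall>U. openin (path_topology M (B k)) U \<and> U \<noteq> {} \<longrightarrow>
                0 < emeasure \<nu>k U \<and> emeasure \<nu>k U < \<infinity>)) \<and>
          (conservative (FC M A) \<nu> \<longleftrightarrow> conservative (FC M (B k)) \<nu>k) \<and>
          (conservative_images (FC M A) \<nu> \<longrightarrow> conservative_images (FC M (B k)) \<nu>k) \<and>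
          (conservative_images (FC M (B k)) \<nu>k \<and> infinite (path_space M (B k)) \<longrightarrow>
             conservative_images (FC M A) \<nu>) \<and>
          ((\<exists>U. openin (path_topology M A) U \<and> 0 < emeasure \<nu> U \<and> emeasure \<nu> U < \<infinity>)
             \<longleftrightarrow> pos_finite) \<and>
          (pos_finite \<longleftrightarrow>
             (\<exists>R\<in>extreme_rays M (B k). \<exists>w\<in>R. \<nu>k = eigen_measure M (B k) w)) \<and>
          (\<forall>R\<in>extreme_rays M (B k). \<forall>w\<in>R. \<nu>k = eigen_measure M (B k) w \<longrightarrow>
             (emeasure \<nu> (space \<nu>) < \<infinity> \<longleftrightarrow> distinguished M A (B k) w) \<and>
             (distinguished M A (B k) w \<longrightarrow> \<nu> = eigen_measure M A (iota M A (B k) w))))) \<and>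
     bij_betw
       (\<lambda>\<mu>. (positive_block M lh B \<mu>, restrict_space \<mu> (path_space M (B (positive_block M lh B \<mu>)))))
       (ergodic_measures M A)
       (SIGMA k:{1..lh}. ergodic_measures M (B k))"
proof -
  interpret frobenius l lh M A B by unfold_locales (rule assms(1))
  note nu = assms(2)
  show ?thesis
    unfolding Let_def
  proof (intro conjI ballI impI unique_positive_block[OF nu] restriction_bijective)
    fix k assume k: "k \<in> {1..lh}" and pos: "positive_on_block M B \<nu> k"
    interpret block_measure M A "B k" \<nu> by (rule block_measure[OF nu k pos])
    have pos0: "emeasure \<nu> (path_space M (B k)) \<noteq> 0" using pos by (simp add: positive_on_block_def)
    have posr: "emeasure \<rho> (path_space M (B k)) \<noteq> 0" using pos0 rho(3)[OF subset_refl] by simp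
    show "invariant_borel_measure M (B k) \<rho>" by (rule rho_inv)
    show erg: "ergodic (FC M (B k)) \<rho>" by (rule restrict_ergodic[OF inv ergodic_measuresD(2)[OF nu]])
    show "\<nu> = invariant_extension M A (B k) \<rho>" using invariant_extension_eqI[OF inv null] by simp
    show "(\<forall>U. openin (path_topology M (B k)) U \<and> U \<noteq> {} \<longrightarrow> emeasure \<rho> U = \<infinity>) \<or>
       (\<forall>U. openin (path_topology M (B k)) U \<and> U \<noteq> {} \<longrightarrow> 0 < emeasure \<rho> U \<and> emeasure \<rho> U < \<infinity>)"
      by (rule block_dichotomy[OF pos0])
    show "conservative (FC M A) \<nu> \<longleftrightarrow> conservative (FC M (B k)) \<rho>"
      using conservative_FC[OF inv_sets[OF inv]] conservative_FC[OF rho(1)] by blast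
    show "conservative_images (FC M (B k)) \<rho>" if "conservative_images (FC M A) \<nu>"
      by (rule conservative_images_restrict[OF inv that])
    show "conservative_images (FC M A) \<nu>"
      if "conservative_images (FC M (B k)) \<rho> \<and> infinite (path_space M (B k))"
      by (rule conservative_images_extension[OF inv null conjunct1[OF that] blk.infinite_orbit[OF conjunct2[OF that]]])
    show "(\<exists>U. openin (path_topology M A) U \<and> 0 < emeasure \<nu> U \<and> emeasure \<nu> U < \<infinity>) \<longleftrightarrow>
      (0 < emeasure \<rho> (space \<rho>) \<and> emeasure \<rho> (space \<rho>) < \<infinity>)"
      by (rule finite_on_open_iff[OF pos0])
    show "(0 < emeasure \<rho> (space \<rho>) \<and> emeasure \<rho> (space \<rho>) < \<infinity>) \<longleftrightarrow>
      (\<exists>R\<in>extreme_rays M (B k). \<exists>w\<in>R. \<rho> = eigen_measure M (B k) w)"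
      using finite_iff_extreme[OF finB blk.reached rho_inv erg posr] posr
      unfolding rho(2) by (simp add: zero_less_iff_neq_zero)
    fix R w assume R: "R \<in> extreme_rays M (B k)" and w: "w \<in> R" and eq: "\<rho> = eigen_measure M (B k) w"
    have wc: "w \<in> eigen_cone M (B k)" by (rule extreme_ray_in_cone[OF R w])
    then have "w \<in> eigen_cone0 M (B k)" by (simp add: eigen_cone_def)
    then have rep: "represents M (B k) w \<rho>" unfolding eq by (rule represents_eigen_measure[OF finB])
    show "emeasure \<nu> (space \<nu>) < \<infinity> \<longleftrightarrow> distinguished M A (B k) w"
      by (rule finite_iff_distinguished[OF rep wc rank_decreases])
    show "\<nu> = eigen_measure M A (iota M A (B k) w)" if "distinguished M A (B k) w"
      by (rule distinguished_eq_eigen_measure[OF rep that])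
  qed
qed

end
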